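(* Let $d\ge2$ and let the smoothness parameter satisfy $\beta>1$. If $n\ge C\log(d/s)\,s^{(4\beta-1)/(2\beta-2)}$ for some constant $C$ large enough, then for $q=1,2$, $$\inf_{\hat{\boldsymbol\theta}}\ \sup_{(\boldsymbol\theta,P)\in\Theta_{\beta,s}}\mathbb P_P\left[\|\hat{\boldsymbol\theta}-\boldsymbol\theta\|_q\ge c\,s^{\frac1q-\frac12}\left(\frac{s\log(d/s)}{n}\right)^{\beta/(2\beta+1)}\right]>c',$$ where $c,c'>0$ are constants independent of $n,d$ and $s$, and the infimum is over all estimators $\hat{\boldsymbol\theta}$ based on $n$ i.i.d. observations from $P$.
   Context: $P$ denotes a distribution of $(X,Y,\mathbf Z)$ with $X\in\mathbb R$, $Y\in\{-1,1\}$, $\mathbf Z\in\mathbb R^d$, with conditional density $f(x\mid y,\mathbf z)$ of $X$ given $Y=y,\mathbf Z=\mathbf z$ (derivatives $f^{(l)}$ in $x$) and conditional density $f(\mathbf z\mid y)$ of $\mathbf Z$ given $Y=y$. The risk is $R_P(\boldsymbol\theta)=\mathbb E_P[w(Y)L_{01}(Y(X-\boldsymbol\theta^T\mathbf Z))]$ with $L_{01}(u)=\frac12(1-\mathrm{sign}(u))$ and $w(y)=1/\mathbb P_P(Y=y)$. $\|\cdot\|_0$ counts nonzero entries. $\lfloor\beta\rfloor$ is the greatest integer strictly less than $\beta$; put $l=\lfloor\beta\rfloor$. For a distribution $P$ with (unique) risk minimizer $\boldsymbol\theta^*$, $P\in\mathcal P(\beta,L)=\mathcal P(\beta,L,s')$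 if $f(x\mid y,\mathbf z)$ is $l$ times differentiable in $x$ and $$\left|\int\mathbf v^T\mathbf z\,[f^{(l)}(\Delta+\boldsymbol\theta^{*T}\mathbf z\mid y,\mathbf z)-f^{(l)}(\boldsymbol\theta^{*T}\mathbf z\mid y,\mathbf z)]f(\mathbf z\mid y)d\mathbf z\right|\le L\|\mathbf v\|_2|\Delta|^{\beta-l}$$ for all $y\in\{-1,1\}$, $\Delta\in\mathbb R$ and all $\mathbf v\in\mathbb R^d$ with $\|\mathbf v\|_0\le s'$, where $s'=C's$ for a sufficiently large constant $C'$. The parameter space is $$\Theta_{\beta,s}=\{(\boldsymbol\theta^*,P):\|\boldsymbol\theta^*\|_0\le s,\ P\in\mathcal P(\beta,L),\ \boldsymbol\theta^*=\arg\min_{\boldsymbol\theta}R_P(\boldsymbol\theta),\ \lambda_{\min}(\nabla^2R_P(\boldsymbol\theta^* ))\ge\rho\},$$ where the minimizer is assumed to exist and be unique, $\lambda_{\min}$ is the minimum eigenvalue, $L>0$ is a constant and $\rho>0$ is some positive constant (independent of $n,d,s$). *)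

theory Defs
  imports "HOL-Probability.Probability" "Jordan_Normal_Form.Spectral_Radius"
begin

text \<open>
  The constants of the lower bound are uniform in the dimension \<open>d\<close>, so \<open>d\<close> has to be a term and not
  a type: a vector of \<open>\<real>\<^sup>d\<close> is an extensional function on \<open>{..<d}\<close>, and Lebesgue measure on \<open>\<real>\<^sup>d\<close> is
  the product measure.
\<close>

definition vecs :: "nat \<Rightarrow> (nat \<Rightarrow> real) set" where
  "vecs d = {..<d} \<rightarrow>\<^sub>E UNIV"

definition lebesgue_vec :: "nat \<Rightarrow> (nat \<Rightarrow> real) measure" where
  "lebesgue_vec d = (\<Pi>\<^sub>M i\<in>{..<d}. (lborel :: real measure))"

definition dot :: "nat \<Rightarrow> (nat \<Rightarrow> real) \<Rightarrow> (nat \<Rightarrow> real) \<Rightarrow> real" where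
  "dot d u v = (\<Sum>i<d. u i * v i)"

definition l0_norm :: "nat \<Rightarrow> (nat \<Rightarrow> real) \<Rightarrow> nat" where
  "l0_norm d v = card {i. i < d \<and> v i \<noteq> 0}"

definition lq_norm :: "nat \<Rightarrow> nat \<Rightarrow> (nat \<Rightarrow> real) \<Rightarrow> real" where
  "lq_norm d q v = root q (\<Sum>i<d. \<bar>v i\<bar> ^ q)"

lemma lq_norm_1: "lq_norm d 1 v = (\<Sum>i<d. \<bar>v i\<bar>)"
  by (simp add: lq_norm_def)

lemma lq_norm_2: "lq_norm d 2 v = L2_set v {..<d}"
  by (simp add: lq_norm_def L2_set_def sqrt_def)


text \<open>
  Frechet gradient and Hessian on \<open>\<real>\<^sup>d\<close>. The type \<^typ>\<open>nat \<Rightarrow> real\<close> carries no norm, so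
  \<open>has_derivative\<close> is spelled out. A Hessian exists only if the function is differentiable near the
  point with a gradient that is itself differentiable at the point; the Hessian is then symmetric.
\<close>

definition has_gradient ::
  "nat \<Rightarrow> ((nat \<Rightarrow> real) \<Rightarrow> real) \<Rightarrow> (nat \<Rightarrow> real) \<Rightarrow> (nat \<Rightarrow> real) \<Rightarrow> bool" where
  "has_gradient d F g t \<longleftrightarrow>
     (\<forall>e>0. \<exists>\<delta>>0. \<forall>u\<in>vecs d. lq_norm d 2 (\<lambda>i. u i - t i) < \<delta> \<longrightarrow>
        \<bar>F u - F t - dot d g (\<lambda>i. u i - t i)\<bar> \<le> e * lq_norm d 2 (\<lambda>i. u i - t i))"

definition has_hessian ::
  "nat \<Rightarrow> ((nat \<Rightarrow> real) \<Rightarrow> real) \<Rightarrow> real mat \<Rightarrow> (nat \<Rightarrow> real) \<Rightarrow> bool" where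
  "has_hessian d F H t \<longleftrightarrow> H \<in> carrier_mat d d \<and>
     (\<exists>G. (\<exists>\<delta>>0. \<forall>u\<in>vecs d. lq_norm d 2 (\<lambda>i. u i - t i) < \<delta> \<longrightarrow> has_gradient d F (\<lambda>i. G i u) u) \<and>
          (\<forall>i<d. has_gradient d (G i) (\<lambda>j. H $$ (i, j)) t))"

text \<open>Only used for Hessians, which are real symmetric, so that the spectrum is nonempty.\<close>

definition lambda_min :: "real mat \<Rightarrow> real" where
  "lambda_min A = Min (spectrum A)"


text \<open>An observation is a triple \<open>(x, y, z)\<close> with \<open>y \<in> {-1, 1}\<close>.\<close>

type_synonym obs = "real \<times> real \<times> (nat \<Rightarrow> real)"

definition obs_base :: "nat \<Rightarrow> obs measure" where
  "obs_base d = lborel \<Otimes>\<^sub>M (count_space {-1, 1} \<Otimes>\<^sub>M lebesgue_vec d)"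

definition prob_Y :: "obs measure \<Rightarrow> real \<Rightarrow> real" where
  "prob_Y P y = measure P {\<omega> \<in> space P. fst (snd \<omega>) = y}"

definition obs_laws :: "nat \<Rightarrow> obs measure set" where
  "obs_laws d = {P. prob_space P \<and> sets P = sets (obs_base d) \<and> prob_Y P (-1) > 0 \<and> prob_Y P 1 > 0}"

text \<open>
  \<open>f y z\<close> is (a version of) the conditional density \<open>f(\<cdot> | y, z)\<close> of \<open>X\<close> given \<open>Y = y, Z = z\<close>, and
  \<open>g y\<close> the conditional density \<open>f(\<cdot> | y)\<close> of \<open>Z\<close> given \<open>Y = y\<close>.
\<close>

definition cond_densities ::
  "nat \<Rightarrow> obs measure \<Rightarrow> (real \<Rightarrow> (nat \<Rightarrow> real) \<Rightarrow> real \<Rightarrow> real) \<Rightarrow> (real \<Rightarrow> (nat \<Rightarrow> real) \<Rightarrow> real) \<Rightarrow> bool" where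
  "cond_densities d P f g \<longleftrightarrow>
     (\<lambda>(x, y, z). f y z x) \<in> borel_measurable (obs_base d) \<and>
     (\<forall>y\<in>{-1, 1}. g y \<in> borel_measurable (lebesgue_vec d)) \<and>
     (\<forall>y\<in>{-1, 1}. \<forall>z\<in>vecs d. (\<forall>x. f y z x \<ge> 0) \<and> (\<integral>\<^sup>+x. ennreal (f y z x) \<partial>lborel) = 1) \<and>
     (\<forall>y\<in>{-1, 1}. (\<forall>z\<in>vecs d. g y z \<ge> 0) \<and> (\<integral>\<^sup>+z. ennreal (g y z) \<partial>lebesgue_vec d) = 1) \<and>
     P = density (obs_base d) (\<lambda>(x, y, z). ennreal (prob_Y P y * g y z * f y z x))"


definition L01 :: "real \<Rightarrow> real" where
  "L01 u = (1 - sgn u) / 2"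

definition risk :: "nat \<Rightarrow> obs measure \<Rightarrow> (nat \<Rightarrow> real) \<Rightarrow> real" where
  "risk d P t = (\<integral>(x, y, z). 1 / prob_Y P y * L01 (y * (x - dot d t z)) \<partial>P)"

definition unique_risk_minimizer :: "nat \<Rightarrow> obs measure \<Rightarrow> (nat \<Rightarrow> real) \<Rightarrow> bool" where
  "unique_risk_minimizer d P t \<longleftrightarrow>
     is_arg_min (risk d P) (\<lambda>u. u \<in> vecs d) t \<and>
     (\<forall>u. is_arg_min (risk d P) (\<lambda>u. u \<in> vecs d) u \<longrightarrow> u = t)"


text \<open>The greatest integer \<^emph>\<open>strictly\<close> less than \<open>\<beta>\<close>, as a natural number (for \<open>\<beta> > 0\<close>).\<close>

definition strict_floor :: "real \<Rightarrow> nat" where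
  "strict_floor \<beta> = nat (\<lceil>\<beta>\<rceil> - 1)"

lemma strict_floor_greatest:
  assumes "\<beta> > 0"
  shows "real (strict_floor \<beta>) < \<beta>" and "real_of_int m < \<beta> \<Longrightarrow> m \<le> int (strict_floor \<beta>)"
  using assms unfolding strict_floor_def by linarith+

text \<open>
  The smoothness class. The sparsity level \<open>s'\<close> is real because it is used as \<open>C' * s\<close> with a real
  constant. Integrability is demanded explicitly: the Bochner integral of a non-integrable function
  is 0, which would make the bound vacuous.
\<close>

definition smooth_class :: "nat \<Rightarrow> real \<Rightarrow> real \<Rightarrow> real \<Rightarrow> obs measure set" where
  "smooth_class d \<beta> L s' = {P \<in> obs_laws d. \<exists>t f g.
     unique_risk_minimizer d P t \<and> cond_densities d P f g \<and>
     (let l = strict_floor \<beta> in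
       (\<forall>y\<in>{-1, 1}. \<forall>z\<in>vecs d. \<forall>k<l. \<forall>x. (deriv ^^ k) (f y z) differentiable at x) \<and>
       (\<forall>y\<in>{-1, 1}. \<forall>\<Delta>. \<forall>v\<in>vecs d. real (l0_norm d v) \<le> s' \<longrightarrow>
          (let h = (\<lambda>z. dot d v z *
                 ((deriv ^^ l) (f y z) (\<Delta> + dot d t z) - (deriv ^^ l) (f y z) (dot d t z)) * g y z)
           in integrable (lebesgue_vec d) h \<and>
              \<bar>\<integral>z. h z \<partial>lebesgue_vec d\<bar> \<le> L * lq_norm d 2 v * \<bar>\<Delta>\<bar> powr (\<beta> - real l))))}"

definition Theta ::
  "nat \<Rightarrow> nat \<Rightarrow> real \<Rightarrow> real \<Rightarrow> real \<Rightarrow> real \<Rightarrow> ((nat \<Rightarrow> real) \<times> obs measure) set" where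
  "Theta d s \<beta> L \<rho> C' = {(t, P). t \<in> vecs d \<and> l0_norm d t \<le> s \<and> P \<in> smooth_class d \<beta> L (C' * real s) \<and>
     unique_risk_minimizer d P t \<and>
     (\<exists>H. has_hessian d (risk d P) H t \<and> lambda_min H \<ge> \<rho>)}"


definition estimators :: "nat \<Rightarrow> nat \<Rightarrow> ((nat \<Rightarrow> obs) \<Rightarrow> (nat \<Rightarrow> real)) set" where
  "estimators n d = (\<Pi>\<^sub>M k\<in>{..<n}. obs_base d) \<rightarrow>\<^sub>M lebesgue_vec d"

text \<open>Probabilities are taken in \<^typ>\<open>ennreal\<close>, where the supremum of the empty set is 0.\<close>

definition minimax_prob ::
  "nat \<Rightarrow> nat \<Rightarrow> nat \<Rightarrow> ((nat \<Rightarrow> real) \<times> obs measure) set \<Rightarrow> real \<Rightarrow> ennreal" where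
  "minimax_prob n d q TP r = (INF T\<in>estimators n d. SUP (t, P)\<in>TP.
     emeasure (\<Pi>\<^sub>M k\<in>{..<n}. P)
       {\<omega> \<in> space (\<Pi>\<^sub>M k\<in>{..<n}. P). lq_norm d q (\<lambda>i. T \<omega> i - t i) \<ge> r})"

end

theory Submission
  imports Defs "HOL-Real_Asymp.Real_Asymp"
begin

text \<open>
  All labels and covariates are benign: \<open>Y\<close> is uniform on \<open>{-1, 1}\<close> and \<open>Z\<close> is uniform on a cube. The
  hypotheses differ only in \<open>f(\<cdot> | y, z)\<close>, which is a base density, quadratic times Gaussian with
  \<open>f(x | 1) - f(x | -1)\<close> proportional to \<open>x exp (- x\<^sup>2 / 2)\<close>, minus \<open>y t exp (- t\<^sup>2 / 2)\<close> times a bump of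
  width \<open>h\<close> centred at \<open>t = \<theta> \<bullet> z\<close>. The bump has integral zero and moves the unique sign change of
  \<open>f(x | 1, z) - f(x | -1, z)\<close> from \<open>0\<close> to \<open>t\<close>, so for every \<open>z\<close> the Bayes rule thresholds at \<open>\<theta> \<bullet> z\<close> and
  \<open>\<theta>\<close> minimises the risk. Because the bump has amplitude \<open>t\<close>, Cauchy-Schwarz over \<open>z\<close> turns the smoothness
  condition into \<open>\<parallel>\<theta>\<parallel>\<^sub>2 \<le> const h\<^sup>\<beta>\<close> without any loss in the dimension, and the chi-square distance to
  \<open>\<theta> = 0\<close> is of order \<open>h \<parallel>\<theta>\<parallel>\<^sub>2\<^sup>2\<close>. With \<open>h\<close> of order \<open>(s log (d/s) / n)\<^bsup>1/(2\<beta>+1)\<^esup>\<close> it is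
  \<open>s log (d/s) / n\<close>, which matches the entropy of the \<open>s\<close>-sparse block words from which \<open>\<theta>\<close> is drawn.
\<close>

section \<open>Polynomials times a Gaussian\<close>

text \<open>Translating the whole density by \<open>t\<close> would also move the sign change to
  \<open>t\<close>, but at an information cost of order \<open>t^2\<close>; a bump concentrated on
  width \<open>h\<close> costs only \<open>h t^2\<close>, and the price of its steepness is paid in
  the smoothness condition. Polynomials times a Gaussian are closed under differentiation, so one
  formula serves every order \<open>strict_floor \<beta>\<close>, and the Gaussian tail of the base
  can dominate the narrower bump on the whole line. The obstacle is that the bump must not create a
  second sign change. It competes with the slope of \<open>x exp (- x^2 / 2)\<close> through the
  ratio \<open>t / h\<close>, which forces the margins \<open>\<theta> . z\<close> below
  \<open>h / 10\<close> for almost every \<open>z\<close>. On a cube this is a bound on the 1-norm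
  of \<open>\<theta>\<close>, larger than the 2-norm by up to the factor \<open>sqrt s\<close>; the
  power of \<open>s\<close> in the sample size condition pays for exactly this. The bump is even
  about its centre, so the curvature of the risk at \<open>\<theta>\<close> does not degrade as
  \<open>h\<close> shrinks. It scales with the variance of the covariates, and the size of the cube
  remains free to meet any prescribed eigenvalue bound \<open>\<rho>\<close>.\<close>

definition gauss_poly :: "real poly \<Rightarrow> real \<Rightarrow> real" where
  "gauss_poly p x = poly p x * exp (- (x^2 / 2))"

text \<open>Since \<open>(p g)' = (p' - x p) g\<close> for \<open>g = exp (- (x^2 / 2))\<close>,
  this is, up to sign, the Hermite recursion; derivatives of every order stay in the class.\<close>

definition gauss_step :: "real poly \<Rightarrow> real poly" where
  "gauss_step p = pderiv p - [:0, 1:] * p"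

lemma has_derivative_gauss_poly [derivative_intros]:
  assumes "(f has_real_derivative f') (at x)"
  shows "((\<lambda>x. gauss_poly p (f x)) has_real_derivative gauss_poly (gauss_step p) (f x) * f') (at x)"
proof -
  have "(gauss_poly p has_real_derivative gauss_poly (gauss_step p) u) (at u)" for u
    unfolding gauss_poly_def gauss_step_def
    by (auto intro!: derivative_eq_intros simp: algebra_simps)
  from DERIV_chain2[OF this assms] show ?thesis .
qed

lemma continuous_gauss_poly [continuous_intros]:
  "continuous_on A f \<Longrightarrow> continuous_on A (\<lambda>x. gauss_poly p (f x))"
  unfolding gauss_poly_def by (auto intro!: continuous_intros)

lemma borel_measurable_gauss_poly [measurable]: "gauss_poly p \<in> borel_measurable borel"
  using continuous_gauss_poly[of UNIV "\<lambda>x. x" p]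
  by (auto intro!: borel_measurable_continuous_onI)

text \<open>The rate \<open>a\<close> is arbitrary so that the induction can halve it: one half pays
  for the extra factor \<open>x\<close> in \<open>pCons\<close>, the other half for the remaining
  polynomial.\<close>

lemma poly_exp_bound:
  fixes p :: "real poly"
  assumes "a > 0"
  shows "\<exists>M>0. \<forall>x. \<bar>poly p x\<bar> \<le> M * exp (a * x^2)"
  using assms
proof (induction p arbitrary: a)
  case 0
  then show ?case by (intro exI[of _ 1]) auto
next
  case (pCons c p)
  from pCons.IH[of "a/2"] pCons.prems obtain M where M: "M > 0" "\<And>x. \<bar>poly p x\<bar> \<le> M * exp (a/2 * x^2)" 
    by auto
  have lin: "\<bar>x\<bar> \<le> (1 + 2/a) * exp (a/2 * x^2)" for x
  proof -
    have "0 \<le> (\<bar>x\<bar> - 1)^2 + \<bar>x\<bar>" by simp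
    then have "\<bar>x\<bar> \<le> 1 + x^2" by (simp add: power2_diff)
    also have "\<dots> \<le> (1 + 2/a) * (1 + a/2 * x^2)"
      using pCons.prems by (simp add: field_simps)
    also have "\<dots> \<le> (1 + 2/a) * exp (a/2 * x^2)"
      using pCons.prems by (intro mult_left_mono exp_ge_add_one_self) auto
    finally show ?thesis .
  qed
  have "\<bar>poly (pCons c p) x\<bar> \<le> (\<bar>c\<bar> + (1 + 2/a) * M) * exp (a * x^2)" for x
  proof -
    have "\<bar>poly (pCons c p) x\<bar> \<le> \<bar>c\<bar> + \<bar>x\<bar> * \<bar>poly p x\<bar>"
      by (simp add: abs_mult[symmetric])
    also have "\<bar>x\<bar> * \<bar>poly p x\<bar> \<le> ((1 + 2/a) * exp (a/2 * x^2)) * (M * exp (a/2 * x^2))"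
      using M lin pCons.prems by (intro mult_mono) (auto intro!: mult_nonneg_nonneg add_nonneg_nonneg)
    also have "\<dots> = (1 + 2/a) * M * exp (a * x^2)"
      by (simp add: exp_add[symmetric] field_simps)
    also have "\<bar>c\<bar> \<le> \<bar>c\<bar> * exp (a * x^2)" using pCons.prems by (simp add: mult_le_cancel_left1)
    finally show ?thesis by (simp add: algebra_simps)
  qed
  moreover have "0 < (1 + 2/a) * M" using M pCons.prems by (intro mult_pos_pos add_pos_pos) auto
  then have "0 < \<bar>c\<bar> + (1 + 2/a) * M" by linarith
  ultimately show ?case by blast
qed

lemma gauss_poly_bounded: "\<exists>M>0. \<forall>x. \<bar>gauss_poly p x\<bar> \<le> M"
proof -
  obtain M where M: "M > 0" "\<And>x. \<bar>poly p x\<bar> \<le> M * exp (1/2 * x^2)"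
    using poly_exp_bound[of "1/2" p] by auto
  have "\<bar>gauss_poly p x\<bar> \<le> M" for x
  proof -
    have "\<bar>gauss_poly p x\<bar> \<le> (M * exp (1/2 * x^2)) * exp (- (x^2 / 2))"
      unfolding gauss_poly_def abs_mult using M(2)[of x] by (intro mult_mono) auto
    also have "\<dots> = M" by (simp add: mult.assoc exp_add[symmetric])
    finally show ?thesis .
  qed
  with M show ?thesis by auto
qed

lemma gauss_poly_lipschitz: "\<exists>M>0. \<forall>x y. \<bar>gauss_poly p x - gauss_poly p y\<bar> \<le> M * \<bar>x - y\<bar>"
proof -
  obtain M where M: "M > 0" "\<And>x. \<bar>gauss_poly (gauss_step p) x\<bar> \<le> M"
    using gauss_poly_bounded[of "gauss_step p"] by auto
  have "norm (gauss_poly p x - gauss_poly p y) \<le> M * norm (x - y)" for x y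
    using M by (intro field_differentiable_bound[of UNIV _ "gauss_poly (gauss_step p)"])
      (auto intro!: derivative_eq_intros)
  with M show ?thesis by auto
qed

text \<open>Interpolation: up to distance 1 the Lipschitz bound is stronger than the power
  \<open>r\<close>, and beyond distance 1 the uniform bound suffices.\<close>

lemma gauss_poly_holder:
  assumes "0 < r" "r \<le> 1"
  shows "\<exists>M>0. \<forall>x y. \<bar>gauss_poly p x - gauss_poly p y\<bar> \<le> M * \<bar>x - y\<bar> powr r"
proof -
  obtain M where M: "M > 0" "\<And>x. \<bar>gauss_poly p x\<bar> \<le> M" using gauss_poly_bounded[of p] by auto
  obtain N where N: "N > 0" "\<And>x y. \<bar>gauss_poly p x - gauss_poly p y\<bar> \<le> N * \<bar>x - y\<bar>"
    using gauss_poly_lipschitz[of p] by auto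
  have "\<bar>gauss_poly p x - gauss_poly p y\<bar> \<le> (2 * M + N) * \<bar>x - y\<bar> powr r" for x y
  proof (cases "\<bar>x - y\<bar> \<le> 1")
    case True
    have "\<bar>x - y\<bar> \<le> \<bar>x - y\<bar> powr r"
      using powr_mono'[of r 1 "\<bar>x - y\<bar>"] True assms by (cases "x = y") auto
    then show ?thesis using N(2)[of x y] N(1) M(1)
      by (smt (verit) mult_mono powr_ge_zero)
  next
    case False
    then have "1 \<le> \<bar>x - y\<bar> powr r" using assms by (simp add: ge_one_powr_ge_zero)
    then have "2 * M \<le> (2 * M + N) * \<bar>x - y\<bar> powr r" using M(1) N(1)
      by (smt (verit) mult_le_cancel_left1)
    then show ?thesis using M(2)[of x] M(2)[of y] by linarith
  qed
  then show ?thesis using M N by (intro exI[of _ "2 * M + N"]) auto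
qed

text \<open>The smoothness class speaks of iterates of \<open>deriv\<close>; this identifies them
  with an explicit family of closed forms.\<close>

lemma deriv_iterate_eq:
  assumes "\<And>k x. (F k has_real_derivative F (Suc k) x) (at x)"
  shows "(deriv ^^ k) (F 0) = F k"
proof (induction k)
  case (Suc k)
  have "deriv (F k) = F (Suc k)" using DERIV_imp_deriv[OF assms] by auto
  then show ?case using Suc by simp
qed simp

lemma gauss_moments:
  "has_bochner_integral lborel (\<lambda>x. exp (- (x^2 / 2))) (sqrt (2 * pi))"
  "has_bochner_integral lborel (\<lambda>x::real. x * exp (- (x^2 / 2))) 0"
  "has_bochner_integral lborel (\<lambda>x. x^2 * exp (- (x^2 / 2))) (sqrt (2 * pi))"
proof -
  have eq: "std_normal_density x = exp (- (x^2 / 2)) / sqrt (2 * pi)" for x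
    by (simp add: std_normal_density_def)
  have nz: "sqrt (2 * pi) \<noteq> 0" by simp
  show "has_bochner_integral lborel (\<lambda>x. exp (- (x^2 / 2))) (sqrt (2 * pi))"
    using has_bochner_integral_mult_right[OF std_normal_moment_even[of 0], of "sqrt (2 * pi)"] nz
    by (simp add: eq)
  show "has_bochner_integral lborel (\<lambda>x::real. x * exp (- (x^2 / 2))) 0"
    using has_bochner_integral_mult_right[OF std_normal_moment_odd[of 0], of "sqrt (2 * pi)"] nz
    by (simp add: eq mult.commute)
  show "has_bochner_integral lborel (\<lambda>x. x^2 * exp (- (x^2 / 2))) (sqrt (2 * pi))"
    using has_bochner_integral_mult_right[OF std_normal_moment_even[of 1], of "sqrt (2 * pi)"] nz
    by (simp add: eq mult.commute fact_numeral)
qed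

lemma exp_sub_one_abs_le:
  fixes x :: real
  shows "\<bar>exp x - 1\<bar> \<le> \<bar>x\<bar> * max 1 (exp x)"
proof (cases "x \<ge> 0")
  case True
  have "1 - x \<le> exp (-x)" using exp_ge_add_one_self[of "-x"] by simp
  then have "exp x * (1 - x) \<le> 1" by (simp add: exp_minus field_simps)
  then show ?thesis using True by (simp add: algebra_simps)
next
  case False
  then have "exp x < 1" by simp
  moreover have "1 + x \<le> exp x" by (rule exp_ge_add_one_self)
  ultimately have "\<bar>exp x - 1\<bar> \<le> \<bar>x\<bar>" using False by linarith
  with \<open>exp x < 1\<close> show ?thesis by (simp add: max_def)
qed

section \<open>The perturbed conditional density\<close>

abbreviation gauss :: "real \<Rightarrow> real" where "gauss x \<equiv> exp (- (x^2 / 2))"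

text \<open>The derivative of \<open>v * gauss v\<close>. Hence its integral is zero, its
  antiderivative is elementary, and, as \<open>bump 0 = 1\<close>, subtracting
  \<open>t * gauss t * bump ((x - t) / h)\<close> from \<open>x * gauss x\<close> gives exactly 0 at
  \<open>x = t\<close>.\<close>

definition bump :: "real \<Rightarrow> real" where "bump = gauss_poly [:1, 0, -1:]"

lemma bump_eq: "bump v = (1 - v^2) * gauss v"
  by (simp add: bump_def gauss_poly_def power2_eq_square algebra_simps)

lemma bump_0 [simp]: "bump 0 = 1" by (simp add: bump_eq)

lemma borel_measurable_bump [measurable]: "bump \<in> borel_measurable borel"
  by (simp add: bump_def)

lemma abs_le_exp_quarter: "\<bar>v\<bar> \<le> exp (v^2/4)" for v :: real
proof -
  have "0 \<le> (\<bar>v\<bar>/2 - 1)^2" by simp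
  then have "\<bar>v\<bar> \<le> 1 + v^2/4" by (simp add: power2_diff power_divide)
  also have "\<dots> \<le> exp (v^2/4)" by (rule exp_ge_add_one_self)
  finally show ?thesis .
qed

lemma bump_abs_le: "\<bar>bump v\<bar> \<le> 4 * exp (- (v^2 / 4))"
proof -
  have "\<bar>1 - v^2\<bar> \<le> 4 * (1 + v^2/4)" by (simp add: abs_if)
  also have "\<dots> \<le> 4 * exp (v^2/4)" using exp_ge_add_one_self[of "v^2/4"] by (intro mult_left_mono) auto
  finally have "\<bar>bump v\<bar> \<le> (4 * exp (v^2/4)) * gauss v"
    unfolding bump_eq abs_mult by (intro mult_mono) auto
  also have "\<dots> = 4 * exp (v^2/4 + - (v^2 / 2))" by (simp only: exp_add mult.assoc)
  also have "v^2/4 + - (v^2 / 2) = - (v^2 / 4)" by simp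
  finally show ?thesis .
qed

lemma bump_integral: "has_bochner_integral lborel bump 0"
proof -
  have "has_bochner_integral lborel (\<lambda>x. gauss x - x^2 * gauss x) (sqrt (2 * pi) - sqrt (2 * pi))"
    by (intro has_bochner_integral_diff gauss_moments)
  then show ?thesis by (simp add: bump_eq[abs_def] algebra_simps)
qed

lemma has_bochner_integral_affine:
  fixes f :: "real \<Rightarrow> real"
  assumes "has_bochner_integral lborel f I" and "h > 0"
  shows "has_bochner_integral lborel (\<lambda>x. f ((x - t) / h)) (h * I)"
proof -
  have "has_bochner_integral lborel (\<lambda>x. f (- t/h + (1/h) * x)) (I /\<^sub>R \<bar>1/h\<bar>)"
    using assms by (intro lborel_has_bochner_integral_real_affine_iff[THEN iffD1]) auto
  moreover have "- t/h + (1/h) * x = (x - t) / h" for x by (simp add: diff_divide_distrib)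
  ultimately show ?thesis using assms(2) by simp
qed

context
  fixes h t :: real
  assumes h: "0 < h" "h \<le> 1/2" and t: "\<bar>t\<bar> \<le> h/10"
begin

lemma shift_le_one: "\<bar>t\<bar> \<le> 1/20" using h t by linarith

lemma gauss_shift_ge: "gauss t \<ge> 1/2"
proof -
  have "t^2 \<le> (1/20)^2" using shift_le_one by (metis abs_ge_zero power2_abs power_mono)
  then show ?thesis using exp_ge_add_one_self[of "- (t^2)/2"] by (simp add: power2_eq_square)
qed

text \<open>Writing \<open>x = t + h v\<close>, the bump decays like \<open>exp (- v\<^sup>2 / 4)\<close>, hence faster than the base Gaussian.\<close>

lemma bump_le_gauss: "\<bar>bump ((x - t) / h)\<bar> \<le> 8 * gauss x"
proof -
  define v where "v = (x - t) / h"
  have x: "x = t + h * v" using h by (simp add: v_def)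
  have "0 \<le> (t - h * v)^2" by simp
  then have "x^2 / 2 \<le> t^2 + h^2 * v^2" by (simp add: x power2_sum power2_diff power_mult_distrib)
  also have "h^2 * v^2 \<le> (1/2)^2 * v^2" using h by (intro mult_right_mono power_mono) auto
  finally have le: "x^2 / 2 \<le> t^2 + v^2 / 4" by (simp add: power2_eq_square)
  have "\<bar>bump v\<bar> \<le> 4 * exp (- (v^2 / 4))" by (rule bump_abs_le)
  also have "4 * exp (- (v^2 / 4)) \<le> 8 * (exp (- (t^2)) * exp (- (v^2 / 4)))"
  proof -
    have "t^2 \<le> (1/20)^2" using shift_le_one by (metis abs_ge_zero power2_abs power_mono)
    then have "2 * exp (- (t^2)) \<ge> 1"
      using exp_ge_add_one_self[of "- (t^2)"] by (simp add: power2_eq_square)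
    then have "1 * exp (- (v^2 / 4)) \<le> 2 * exp (- (t^2)) * exp (- (v^2 / 4))"
      by (intro mult_right_mono) auto
    then show ?thesis by simp
  qed
  also have "\<dots> = 8 * exp (- (t^2) + - (v^2 / 4))" by (simp only: exp_add mult.assoc)
  also have "\<dots> \<le> 8 * gauss x" using le by simp
  finally show ?thesis by (simp only: v_def)
qed

text \<open>The quotient is the bump measured against the base Gaussian, the form in which it enters
  \<open>margin_sign\<close>. With \<open>v = (x - t) / h\<close> it equals
  \<open>(1 - v^2) * exp E\<close>, where \<open>E = 0\<close> at \<open>v = 0\<close> and
  \<open>exp E <= 2 * exp (- (v^2 / 4))\<close>. The error splits into \<open>exp E - 1\<close>, at
  most \<open>3 * |v|\<close>, and \<open>v^2 * exp E\<close>, at most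
  \<open>2 * |v|\<close>.\<close>

lemma tilted_bump_lipschitz_at_0:
  "\<bar>gauss t / gauss x * bump ((x - t) / h) - 1\<bar> \<le> 5 * \<bar>(x - t) / h\<bar>"
proof -
  define v where "v = (x - t) / h"
  define E where "E = t * h * v + h^2 * v^2 / 2 - v^2 / 2"
  have x: "x = t + h * v" using h by (simp add: v_def)
  have E: "gauss t / gauss x * gauss v = exp E"
  proof -
    have "gauss t / gauss x * gauss v = exp (- (t^2 / 2) - - (x^2 / 2) + - (v^2 / 2))"
      by (simp only: exp_diff exp_add)
    also have "- (t^2 / 2) - - (x^2 / 2) + - (v^2 / 2) = E"
      by (simp add: x E_def power2_sum power_mult_distrib add_divide_distrib)
    finally show ?thesis .
  qed
  have "h * h \<le> (1/2) * (1/2)" using h by (intro mult_mono) auto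
  then have h2: "h^2 \<le> 1/4" by (simp add: power2_eq_square)
  have th: "\<bar>t * h\<bar> \<le> 1/8"
  proof -
    have "\<bar>t * h\<bar> \<le> 1/20 * (1/2)" unfolding abs_mult using shift_le_one h by (intro mult_mono) auto
    then show ?thesis by simp
  qed
  have "t * h * v \<le> 1/8 * \<bar>v\<bar>"
  proof -
    have "t * h * v \<le> \<bar>t * h\<bar> * \<bar>v\<bar>" by (metis abs_ge_self abs_mult)
    also have "\<dots> \<le> 1/8 * \<bar>v\<bar>" using th by (intro mult_right_mono) auto
    finally show ?thesis .
  qed
  moreover have "h^2 * v^2 \<le> 1/4 * v^2" using h2 by (intro mult_right_mono) auto
  ultimately have E1: "E \<le> \<bar>v\<bar> / 8 - 3 * v^2 / 8" by (simp add: E_def)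
  have "0 \<le> (\<bar>v\<bar> - 1/2)^2" by simp
  then have "\<bar>v\<bar> \<le> v^2 + 1/4" by (simp add: power2_diff power_divide)
  then have E2: "E \<le> 1/2 - v^2 / 4" using E1 by linarith
  have exp_half: "exp (1/2 :: real) \<le> 2"
    using exp_bound_half[of "1/2 :: real"] by simp
  have eE: "exp E \<le> 2 * exp (- (v^2 / 4))"
  proof -
    have "exp E \<le> exp (1/2) * exp (- (v^2 / 4))" using E2 by (simp add: exp_add[symmetric])
    also have "\<dots> \<le> 2 * exp (- (v^2 / 4))" using exp_half by (intro mult_right_mono) auto
    finally show ?thesis .
  qed
  have eE2: "exp E \<le> 2" 
  proof -
    have "exp (- (v^2 / 4)) \<le> 1" by simp
    then show ?thesis using eE by linarith
  qed
  have "v^2 * exp E \<le> 2 * \<bar>v\<bar>"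
  proof -
    have "v^2 * exp E \<le> v^2 * (2 * exp (- (v^2 / 4)))" by (intro mult_left_mono eE) auto
    also have "\<dots> = \<bar>v\<bar> * \<bar>v\<bar> * (2 * exp (- (v^2 / 4)))" by (simp add: power2_eq_square)
    also have "\<dots> \<le> \<bar>v\<bar> * exp (v^2/4) * (2 * exp (- (v^2 / 4)))"
      using abs_le_exp_quarter[of v] by (intro mult_right_mono mult_left_mono) auto
    also have "\<dots> = 2 * \<bar>v\<bar>" by (simp add: exp_minus)
    finally show ?thesis .
  qed
  moreover have "\<bar>exp E - 1\<bar> \<le> 3 * \<bar>v\<bar>"
  proof (cases "\<bar>v\<bar> \<le> 1")
    case True
    have "\<bar>v\<bar> * \<bar>v\<bar> \<le> \<bar>v\<bar> * 1" using True by (intro mult_left_mono) auto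
    then have "v^2 \<le> \<bar>v\<bar>" by (simp add: power2_eq_square)
    moreover have "\<bar>t * h * v\<bar> \<le> 1/8 * \<bar>v\<bar>" unfolding abs_mult[of "t * h" v] using th by (intro mult_right_mono) auto
    moreover have "0 \<le> h^2 * v^2" by simp
    moreover have "h^2 * v^2 \<le> 1/4 * v^2" using h2 by (intro mult_right_mono) auto
    ultimately have "\<bar>E\<bar> \<le> \<bar>v\<bar>" unfolding E_def by linarith
    moreover have "\<bar>exp E - 1\<bar> \<le> \<bar>E\<bar> * max 1 (exp E)" by (rule exp_sub_one_abs_le)
    moreover have "\<bar>E\<bar> * max 1 (exp E) \<le> \<bar>E\<bar> * 2" using eE2 by (intro mult_left_mono) auto
    ultimately show ?thesis by linarith
  next
    case False
    moreover have "0 < exp E" by simp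
    ultimately show ?thesis using eE2 by linarith
  qed
  moreover have "gauss t / gauss x * bump v = exp E - v^2 * exp E"
  proof -
    have "gauss t / gauss x * bump v = (1 - v^2) * (gauss t / gauss x * gauss v)"
      by (simp add: bump_eq)
    also have "\<dots> = exp E - v^2 * exp E" unfolding E by (simp only: left_diff_distrib mult_1_left)
    finally show ?thesis .
  qed
  moreover have "0 \<le> v^2 * exp E" by simp
  ultimately show ?thesis unfolding v_def[symmetric] abs_le_iff by linarith
qed

text \<open>Divided by \<open>gauss x\<close>, the second factor is
  \<open>(x - t) - t * (W - 1)\<close>. The constant in \<open>|t| <= h/10\<close> is made for the
  Lipschitz constant 5: \<open>|t * (W - 1)|\<close> is at most
  \<open>(h/10) * 5 * |x - t| / h\<close>, so half of the slope survives and \<open>t\<close> is the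
  only sign change.\<close>

lemma margin_sign:
  "(x - t) * (x * gauss x - t * gauss t * bump ((x - t) / h)) \<ge> (x - t)^2 * gauss x / 2"
proof -
  define W where "W = gauss t / gauss x * bump ((x - t) / h)"
  have W: "gauss t * bump ((x - t) / h) = gauss x * W" by (simp add: W_def)
  have "\<bar>t * (x - t) * (W - 1)\<bar> \<le> (h/10) * \<bar>x - t\<bar> * (5 * \<bar>(x - t) / h\<bar>)"
    unfolding abs_mult using t tilted_bump_lipschitz_at_0[of x] h
    by (intro mult_mono) (auto simp: W_def)
  also have "\<dots> = (x - t)^2 / 2" using h by (simp add: abs_mult_self_eq power2_eq_square field_simps)
  finally have "(x - t)^2 - t * (x - t) * (W - 1) \<ge> (x - t)^2 / 2" by (simp add: abs_le_iff)
  then have "((x - t)^2 - t * (x - t) * (W - 1)) * gauss x \<ge> (x - t)^2 / 2 * gauss x"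
    by (intro mult_right_mono) auto
  moreover have "((x - t)^2 - t * (x - t) * (W - 1)) * gauss x
      = (x - t) * (x * gauss x - t * (gauss x * W))"
    by (simp add: algebra_simps power2_eq_square)
  ultimately have "(x - t)^2 / 2 * gauss x \<le> (x - t) * (x * gauss x - t * (gauss t * bump ((x - t) / h)))"
    by (simp only: W)
  then show ?thesis by (simp add: mult.assoc)
qed

end

section \<open>Closed forms for the conditional density and its label difference\<close>

definition gauss_const :: real ("c\<^sub>0") where "c\<^sub>0 = 1 / (2 * sqrt (2 * pi))"

lemma gauss_const_pos: "0 < c\<^sub>0" and gauss_const_le: "c\<^sub>0 \<le> 1"
proof -
  have "sqrt (2 * pi) \<ge> 1" using pi_gt3 by (intro real_le_rsqrt) auto
  then have "2 * sqrt (2 * pi) \<ge> 1" by linarith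
  then show "0 < c\<^sub>0" "c\<^sub>0 \<le> 1" by (auto simp: gauss_const_def simp del: real_sqrt_mult)
qed

text \<open>The even part \<open>1 + x^2\<close> cancels between the two labels and only provides
  positivity: it exceeds \<open>|x|\<close> by at least 3/4, which leaves room for the bump. The
  constant \<open>c\<^sub>0\<close> normalises, since \<open>1\<close> and \<open>x^2\<close> each
  contribute \<open>sqrt (2 * pi)\<close> and the odd term and the bump contribute 0.\<close>

definition cond_dens :: "real \<Rightarrow> real \<Rightarrow> real \<Rightarrow> real \<Rightarrow> real" where
  "cond_dens h y t x = c\<^sub>0 * ((1 + x^2 + y * x) * gauss x - y * (t * gauss t * bump ((x - t) / h)))"

definition cond_dens_deriv :: "nat \<Rightarrow> real \<Rightarrow> real \<Rightarrow> real \<Rightarrow> real \<Rightarrow> real" where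
  "cond_dens_deriv k h y t x = c\<^sub>0 * (gauss_poly ((gauss_step ^^ k) [:1, y, 1:]) x
     - y * (t * gauss t / h ^ k * gauss_poly ((gauss_step ^^ k) [:1, 0, -1:]) ((x - t) / h)))"

text \<open>\<open>cdf_gap 0 h t c\<close> is \<open>F(c | 1) - F(c | -1)\<close>, up to which the risk is determined.\<close>

definition cdf_gap :: "nat \<Rightarrow> real \<Rightarrow> real \<Rightarrow> real \<Rightarrow> real" where
  "cdf_gap k h t x = 2 * c\<^sub>0 * (- gauss_poly ((gauss_step ^^ k) [:1:]) x
     - t * gauss t * (h / h ^ k) * gauss_poly ((gauss_step ^^ k) [:0, 1:]) ((x - t) / h))"

lemma cond_dens_deriv_0: "cond_dens_deriv 0 h y t = cond_dens h y t"
  by (auto simp: cond_dens_deriv_def cond_dens_def bump_def gauss_poly_def algebra_simps power2_eq_square)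

lemma cond_dens_deriv_Suc:
  assumes "h > 0"
  shows "(cond_dens_deriv k h y t has_real_derivative cond_dens_deriv (Suc k) h y t x) (at x)"
  unfolding cond_dens_deriv_def
  using assms by (auto intro!: derivative_eq_intros simp: field_simps)

lemma deriv_cond_dens: "h > 0 \<Longrightarrow> (deriv ^^ k) (cond_dens h y t) = cond_dens_deriv k h y t"
  using deriv_iterate_eq[of "\<lambda>k. cond_dens_deriv k h y t" k] cond_dens_deriv_Suc
  by (simp add: cond_dens_deriv_0)

lemma cdf_gap_Suc:
  assumes "h > 0"
  shows "(cdf_gap k h t has_real_derivative cdf_gap (Suc k) h t x) (at x)"
  unfolding cdf_gap_def
  using assms by (auto intro!: derivative_eq_intros simp: field_simps)

lemma gauss_step_simps:
  "gauss_step [:1:] = [:0, -1:]" "gauss_step [:0, 1:] = [:1, 0, -1:]"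
  "gauss_step [:0, -1:] = [:-1, 0, 1:]" "gauss_step [:1, 0, -1:] = [:0, -3, 0, 1:]"
  by (simp_all add: gauss_step_def pderiv_pCons)

lemma cdf_gap_0: "h > 0 \<Longrightarrow> cdf_gap 0 h t x = 2 * c\<^sub>0 * (- gauss x - t * gauss t * (x - t) * gauss ((x - t) / h))"
  by (simp add: cdf_gap_def gauss_poly_def)

lemma cdf_gap_1: "h > 0 \<Longrightarrow> cdf_gap 1 h t x = 2 * c\<^sub>0 * (x * gauss x - t * gauss t * bump ((x - t) / h))"
  unfolding cdf_gap_def One_nat_def by (simp add: gauss_step_simps bump_def) (simp add: gauss_poly_def)

lemma cdf_gap_1_eq: "h > 0 \<Longrightarrow> cdf_gap 1 h t x = cond_dens h 1 t x - cond_dens h (-1) t x"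
  by (simp only: cdf_gap_1) (simp add: cond_dens_def algebra_simps)

text \<open>The bump is even, so its derivative vanishes at its centre and only the base density
  contributes. The curvature at the threshold is therefore free of \<open>h\<close>, however narrow
  the bump is.\<close>

lemma cdf_gap_2_center: "h > 0 \<Longrightarrow> cdf_gap 2 h t t = 2 * c\<^sub>0 * ((1 - t^2) * gauss t)"
  by (simp add: cdf_gap_def numeral_2_eq_2 gauss_step_simps)
     (simp add: gauss_poly_def power2_eq_square algebra_simps)

text \<open>The bound may depend on \<open>h\<close> and \<open>k\<close> in any way: it serves
  integrability and differentiation under the integral in one fixed model and never enters the
  constants of the theorem. Uniformity in \<open>t\<close> is essential, because \<open>t\<close>
  varies with \<open>z\<close>.\<close>

lemma cdf_gap_bounded:
  assumes "h > 0"
  shows "\<exists>M>0. \<forall>t x. \<bar>t\<bar> \<le> 1 \<longrightarrow> \<bar>cdf_gap k h t x\<bar> \<le> M"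
proof -
  obtain M where M: "M > 0" "\<And>x. \<bar>gauss_poly ((gauss_step ^^ k) [:1:]) x\<bar> \<le> M"
    using gauss_poly_bounded by blast
  obtain N where N: "N > 0" "\<And>x. \<bar>gauss_poly ((gauss_step ^^ k) [:0, 1:]) x\<bar> \<le> N"
    using gauss_poly_bounded by blast
  have "\<bar>cdf_gap k h t x\<bar> \<le> 2 * c\<^sub>0 * (M + h / h ^ k * N)" if "\<bar>t\<bar> \<le> 1" for t x
  proof -
    have "\<bar>t * gauss t * (h / h ^ k) * gauss_poly ((gauss_step ^^ k) [:0, 1:]) ((x - t) / h)\<bar>
      \<le> 1 * 1 * (h / h ^ k) * N"
      unfolding abs_mult using that N assms by (intro mult_mono) auto
    then have "\<bar>- gauss_poly ((gauss_step ^^ k) [:1:]) x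
       - t * gauss t * (h / h ^ k) * gauss_poly ((gauss_step ^^ k) [:0, 1:]) ((x - t) / h)\<bar> \<le> M + h / h ^ k * N"
      using M(2)[of x] by linarith
    then show ?thesis unfolding cdf_gap_def abs_mult using gauss_const_pos
      by (intro mult_mono) auto
  qed
  moreover have "0 < 2 * c\<^sub>0 * (M + h / h ^ k * N)"
    using assms M N gauss_const_pos by (intro mult_pos_pos add_pos_pos) auto
  ultimately show ?thesis by blast
qed

lemma taylor_remainder_bound:
  fixes f g :: "real \<Rightarrow> real"
  assumes f: "\<And>x. (f has_real_derivative g x) (at x)"
    and g: "\<And>x. (g has_real_derivative g' x) (at x)" and M: "\<And>x. \<bar>g' x\<bar> \<le> M"
  shows "\<bar>f b - f a - g a * (b - a)\<bar> \<le> M * (b - a)^2"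
proof -
  have lip: "\<bar>g x - g y\<bar> \<le> M * \<bar>x - y\<bar>" for x y
    using field_differentiable_bound[of UNIV g g' M x y] g M
    by (auto simp: norm_minus_commute)
  have "((\<lambda>x. f x - g a * x) has_real_derivative g x - g a) (at x within S)" for x S
    by (rule derivative_eq_intros f[THEN DERIV_subset] refl)+ auto
  then have "norm ((f b - g a * b) - (f a - g a * a)) \<le> (M * \<bar>b - a\<bar>) * norm (b - a)"
  proof (intro field_differentiable_bound[of "closed_segment a b" _ "\<lambda>x. g x - g a"], goal_cases)
    case (3 z)
    then have "\<bar>z - a\<bar> \<le> \<bar>b - a\<bar>" by (auto simp: closed_segment_eq_real_ivl split: if_splits)
    then show ?case using lip[of z a] M[of 0] by (simp) (smt (verit) mult_left_mono)
  qed auto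
  then show ?thesis by (simp add: algebra_simps power2_eq_square abs_mult_self_eq)
qed

lemma cond_dens_measurable [measurable]:
  assumes [measurable]: "f \<in> borel_measurable M" "u \<in> borel_measurable M" "y \<in> borel_measurable M"
  shows "(\<lambda>w. cond_dens h (y w) (u w) (f w)) \<in> borel_measurable M"
  unfolding cond_dens_def by measurable

lemma cdf_gap_measurable [measurable]:
  assumes [measurable]: "f \<in> borel_measurable M" "u \<in> borel_measurable M"
  shows "(\<lambda>w. cdf_gap k h (u w) (f w)) \<in> borel_measurable M"
  unfolding cdf_gap_def by measurable

lemma cond_dens_deriv_measurable [measurable]:
  assumes [measurable]: "f \<in> borel_measurable M" "u \<in> borel_measurable M"
  shows "(\<lambda>w. cond_dens_deriv k h y (u w) (f w)) \<in> borel_measurable M"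
  unfolding cond_dens_deriv_def by measurable

lemma quadratic_ge: "y \<in> {-1, 1} \<Longrightarrow> 1 + x^2 + y * x \<ge> (3/4 :: real)"
proof -
  assume "y \<in> {-1, 1}"
  then have "y^2 = 1" by auto
  moreover have "0 \<le> (x + y/2)^2" by simp
  ultimately show ?thesis by (simp add: power2_sum power_divide algebra_simps)
qed

lemma cond_dens_0: "cond_dens h y 0 x = c\<^sub>0 * ((1 + x^2 + y * x) * gauss x)"
  by (simp add: cond_dens_def)

lemma cond_dens_0_ge: "y \<in> {-1, 1} \<Longrightarrow> cond_dens h y 0 x \<ge> c\<^sub>0 * (3/4 * gauss x)"
  unfolding cond_dens_0 using gauss_const_pos quadratic_ge[of y x]
  by (intro mult_left_mono mult_right_mono) auto

lemma bump_integrable: "integrable lborel bump"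
  using bump_integral by (simp add: has_bochner_integral_iff)

lemma cond_dens_integral:
  assumes "h > 0"
  shows "has_bochner_integral lborel (cond_dens h y t) 1"
proof -
  have "has_bochner_integral lborel (\<lambda>x. c\<^sub>0 * ((gauss x + x^2 * gauss x + y * (x * gauss x))
      - y * (t * gauss t * bump ((x - t) / h))))
      (c\<^sub>0 * ((sqrt (2 * pi) + sqrt (2 * pi) + y * 0) - y * (t * gauss t * (h * 0))))"
    by (intro has_bochner_integral_mult_right has_bochner_integral_add has_bochner_integral_diff
          gauss_moments has_bochner_integral_affine[OF bump_integral assms])
  moreover have "c\<^sub>0 * (sqrt (2 * pi) + sqrt (2 * pi)) = 1"
    by (simp add: gauss_const_def)
  ultimately show ?thesis
    unfolding cond_dens_def by (simp add: algebra_simps)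
qed

section \<open>Positivity, chi-square distance and error probability at a fixed centre\<close>

context
  fixes h t :: real
  assumes h: "0 < h" "h \<le> 1/2" and t: "\<bar>t\<bar> \<le> h/10"
begin

text \<open>From \<open>|t| <= 1/20\<close> and \<open>|bump| <= 8 * gauss x\<close> the
  perturbation is at most \<open>2/5 * gauss x\<close>, below the reserve
  \<open>3/4 * gauss x\<close> of the base.\<close>

lemma cond_dens_nonneg:
  assumes "y \<in> {-1, 1}"
  shows "0 \<le> cond_dens h y t x"
proof -
  have "\<bar>y * (t * gauss t * bump ((x - t) / h))\<bar> \<le> 1 * (1/20 * 1 * (8 * gauss x))"
    unfolding abs_mult
    using shift_le_one[OF h t] bump_le_gauss[OF h t] assms by (intro mult_mono) auto
  then have "y * (t * gauss t * bump ((x - t) / h)) \<le> 3/4 * gauss x"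
    using abs_ge_self[of "y * (t * gauss t * bump ((x - t) / h))"] exp_gt_zero[of "- (x^2 / 2)"] by linarith
  also have "\<dots> \<le> (1 + x^2 + y * x) * gauss x"
    using quadratic_ge[OF assms] by (intro mult_right_mono) auto
  finally show ?thesis unfolding cond_dens_def using gauss_const_pos by simp
qed

lemma cond_dens_nn_integral: "y \<in> {-1, 1} \<Longrightarrow> (\<integral>\<^sup>+x. ennreal (cond_dens h y t x) \<partial>lborel) = 1"
  using cond_dens_integral[OF h(1)] cond_dens_nonneg
  by (subst nn_integral_eq_integral) (auto simp: has_bochner_integral_iff)

text \<open>Of the two factors \<open>|bump|\<close> in the square, one is traded for
  \<open>8 * gauss x\<close>, which cancels against the denominator \<open>3/4 * gauss x\<close>
  (whence \<open>32/3 <= 11\<close>). The other is integrated, and rescaling to width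
  \<open>h\<close> yields the factor \<open>h\<close>.\<close>

lemma cond_dens_chi2:
  assumes "y \<in> {-1, 1}"
  shows "(\<integral>\<^sup>+x. ennreal ((cond_dens h y t x - cond_dens h y 0 x)^2 / cond_dens h y 0 x) \<partial>lborel)
    \<le> ennreal (11 * (\<integral>x. \<bar>bump x\<bar> \<partial>lborel) * h * t^2)"
proof -
  have pt: "(cond_dens h y t x - cond_dens h y 0 x)^2 / cond_dens h y 0 x
      \<le> 11 * t^2 * \<bar>bump ((x - t) / h)\<bar>" for x
  proof -
    let ?b = "bump ((x - t) / h)"
    have pos: "0 < c\<^sub>0 * (3/4 * gauss x)" using gauss_const_pos by simp
    have "(cond_dens h y t x - cond_dens h y 0 x)^2 = (c\<^sub>0 * (y * (t * gauss t * ?b)))^2"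
      by (simp add: cond_dens_def algebra_simps)
    also have "\<dots> = c\<^sub>0 * c\<^sub>0 * (y^2 * t^2 * (gauss t)^2 * (\<bar>?b\<bar> * \<bar>?b\<bar>))"
      by (simp add: power_mult_distrib power2_eq_square abs_mult_self_eq)
    also have "\<dots> \<le> c\<^sub>0 * 1 * (1 * t^2 * 1 * (\<bar>?b\<bar> * (8 * gauss x)))"
      using gauss_const_pos gauss_const_le assms bump_le_gauss[OF h t, of x]
      by (intro mult_mono mult_nonneg_nonneg) (auto simp: power_le_one)
    finally have "(cond_dens h y t x - cond_dens h y 0 x)^2 / cond_dens h y 0 x
        \<le> (c\<^sub>0 * (t^2 * (\<bar>?b\<bar> * (8 * gauss x)))) / (c\<^sub>0 * (3/4 * gauss x))"
      using cond_dens_0_ge[OF assms, of x h] pos gauss_const_pos by (intro frac_le) auto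
    also have "\<dots> = 32/3 * t^2 * \<bar>?b\<bar>" using gauss_const_pos by (simp add: field_simps)
    also have "\<dots> \<le> 11 * t^2 * \<bar>?b\<bar>" by (intro mult_right_mono) auto
    finally show ?thesis .
  qed
  have "has_bochner_integral lborel (\<lambda>x. \<bar>bump x\<bar>) (\<integral>x. \<bar>bump x\<bar> \<partial>lborel)"
    using bump_integrable by (simp add: has_bochner_integral_iff)
  from has_bochner_integral_affine[OF this h(1), of t]
  have hb: "has_bochner_integral lborel (\<lambda>x. 11 * t^2 * \<bar>bump ((x - t) / h)\<bar>)
     (11 * t^2 * (h * (\<integral>x. \<bar>bump x\<bar> \<partial>lborel)))"
    by (intro has_bochner_integral_mult_right)
  have "(\<integral>\<^sup>+x. ennreal ((cond_dens h y t x - cond_dens h y 0 x)^2 / cond_dens h y 0 x) \<partial>lborel)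
    \<le> (\<integral>\<^sup>+x. ennreal (11 * t^2 * \<bar>bump ((x - t) / h)\<bar>) \<partial>lborel)"
    by (intro nn_integral_mono ennreal_leI pt)
  also have "\<dots> = ennreal (11 * t^2 * (h * (\<integral>x. \<bar>bump x\<bar> \<partial>lborel)))"
    using hb by (subst nn_integral_eq_integral) (auto simp: has_bochner_integral_iff)
  finally show ?thesis by (simp add: mult_ac)
qed

text \<open>By \<open>margin_sign\<close> the derivative \<open>cdf_gap 1\<close> has the sign of
  \<open>x - t\<close>; the mean value theorem does the rest. This is optimality of the threshold
  \<open>t\<close> for a single \<open>z\<close>.\<close>

lemma cdf_gap_minimum:
  assumes "c \<noteq> t"
  shows "cdf_gap 0 h t t < cdf_gap 0 h t c"
proof -
  have pos: "(x - t) * cdf_gap 1 h t x > 0" if "x \<noteq> t" for x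
  proof -
    define Z where "Z = (x - t) * (x * gauss x - t * gauss t * bump ((x - t) / h))"
    have "0 < (x - t)^2 * gauss x / 2" using that by simp
    also have "\<dots> \<le> Z" unfolding Z_def by (rule margin_sign[OF h t])
    finally have "0 < 2 * c\<^sub>0 * Z" using gauss_const_pos by simp
    then show ?thesis unfolding cdf_gap_1[OF h(1)] Z_def by (simp only: mult_ac)
  qed
  have d: "(cdf_gap 0 h t has_real_derivative cdf_gap 1 h t x) (at x)" for x
    using cdf_gap_Suc[OF h(1), of 0 t x] by simp
  show ?thesis
  proof (cases "t < c")
    case True
    from MVT2[OF this, of "cdf_gap 0 h t" "cdf_gap 1 h t"] d
    obtain z where z: "t < z" "z < c" "cdf_gap 0 h t c - cdf_gap 0 h t t = (c - t) * cdf_gap 1 h t z" by auto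
    then have "0 < cdf_gap 1 h t z" using pos[of z] by (auto simp: zero_less_mult_iff)
    then have "0 < (c - t) * cdf_gap 1 h t z" using True by (intro mult_pos_pos) auto
    then show ?thesis using z by linarith
  next
    case False
    then have "c < t" using assms by simp
    from MVT2[OF this, of "cdf_gap 0 h t" "cdf_gap 1 h t"] d
    obtain z where z: "c < z" "z < t" "cdf_gap 0 h t t - cdf_gap 0 h t c = (t - c) * cdf_gap 1 h t z" by auto
    then have "cdf_gap 1 h t z < 0" using pos[of z] by (auto simp: zero_less_mult_iff)
    then have "(t - c) * cdf_gap 1 h t z < 0" using \<open>c < t\<close> by (simp add: mult_pos_neg)
    then show ?thesis using z by linarith
  qed
qed

lemma cdf_gap_2_center_ge: "cdf_gap 2 h t t \<ge> c\<^sub>0 / 2"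
proof -
  have "t^2 \<le> (1/20)^2" using shift_le_one[OF h t] by (metis abs_ge_zero power2_abs power_mono)
  then have "1 - t^2 \<ge> 1/2" by (simp add: power2_eq_square)
  then have "(1 - t^2) * gauss t \<ge> 1/2 * (1/2)" using gauss_shift_ge[OF h t] by (intro mult_mono) auto
  then show ?thesis unfolding cdf_gap_2_center[OF h(1)] using gauss_const_pos by simp
qed

text \<open>Because \<open>L01 (- u) = 1 - L01 u\<close>, the two errors add up to 1 plus the
  integral of \<open>L01 (x - c)\<close> against the difference \<open>cdf_gap 1\<close> of the
  densities. Up to the null set \<open>x = c\<close> this is the integral over the half-line below
  \<open>c\<close>, evaluated by the antiderivative \<open>cdf_gap 0\<close>, which vanishes at
  minus infinity.\<close>

lemma misclassification_nn_integral:
  shows "(\<integral>\<^sup>+x. ennreal (L01 (x - c) * cond_dens h 1 t x) \<partial>lborel)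
   + (\<integral>\<^sup>+x. ennreal (L01 (- (x - c)) * cond_dens h (-1) t x) \<partial>lborel) = ennreal (1 + cdf_gap 0 h t c)"
    and "0 \<le> 1 + cdf_gap 0 h t c"
proof -
  have L: "L01 u \<ge> 0" "L01 u \<le> 1" "L01 (- u) = 1 - L01 u" for u by (auto simp: L01_def sgn_real_def)
  have [measurable]: "L01 \<in> borel_measurable borel" unfolding L01_def[abs_def] by measurable
  have int: "integrable lborel (cond_dens h y t)" for y
    using cond_dens_integral[OF h(1)] by (auto simp: has_bochner_integral_iff)
  have int1: "integrable lborel (\<lambda>x. L01 (x - c) * cond_dens h y t x)" for y
    by (rule Bochner_Integration.integrable_bound[OF int[of y]])
       (auto simp: abs_mult L intro!: mult_left_le_one_le)
  have gap_int: "integrable lborel (cdf_gap 1 h t)"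
    unfolding cdf_gap_1_eq[OF h(1), abs_def] by (intro Bochner_Integration.integrable_diff int)
  have "(\<integral>x. L01 (x - c) * cdf_gap 1 h t x \<partial>lborel) = (\<integral>x. indicator {..<c} x *\<^sub>R cdf_gap 1 h t x \<partial>lborel)"
  proof (rule integral_cong_AE)
    show "AE x in lborel. L01 (x - c) * cdf_gap 1 h t x = indicator {..<c} x *\<^sub>R cdf_gap 1 h t x"
      using AE_lborel_singleton[of c] by eventually_elim (auto simp: L01_def sgn_real_def indicator_def)
  qed (measurable)
  also have "\<dots> = (LBINT x=-\<infinity>..ereal c. cdf_gap 1 h t x)"
    by (simp add: interval_lebesgue_integral_def set_lebesgue_integral_def einterval_def greaterThan_def lessThan_def)
  also have "\<dots> = cdf_gap 0 h t c - 0"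
  proof (rule interval_integral_FTC_integrable)
    show "(cdf_gap 0 h t has_vector_derivative cdf_gap 1 h t x) (at x)" for x
      using cdf_gap_Suc[OF h(1), of 0 t x] by (simp add: has_real_derivative_iff_has_vector_derivative)
    show "isCont (cdf_gap 1 h t) x" for x
      by (rule DERIV_isCont[OF cdf_gap_Suc[OF h(1)]])
    show "set_integrable lborel (einterval (- \<infinity>) (ereal c)) (cdf_gap 1 h t)"
      unfolding set_integrable_def using gap_int by (intro integrable_mult_indicator) auto
    have "((\<lambda>x. gauss x) \<longlongrightarrow> 0) at_bot" by real_asymp
    moreover have "((\<lambda>x. (x - t) * gauss ((x - t) / h)) \<longlongrightarrow> 0) at_bot" using h by real_asymp
    ultimately have "((\<lambda>x. 2 * c\<^sub>0 * (- gauss x - t * gauss t * ((x - t) * gauss ((x - t) / h)))) \<longlongrightarrow>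
        2 * c\<^sub>0 * (- 0 - t * gauss t * 0)) at_bot"
      by (intro tendsto_intros)
    then have "(cdf_gap 0 h t \<longlongrightarrow> 0) at_bot"
      unfolding cdf_gap_0[OF h(1), abs_def] by (simp add: mult.assoc)
    then show "((cdf_gap 0 h t \<circ> real_of_ereal) \<longlongrightarrow> 0) (at_right (- \<infinity>))"
      by (simp add: ereal_tendsto_simps)
    show "((cdf_gap 0 h t \<circ> real_of_ereal) \<longlongrightarrow> cdf_gap 0 h t c) (at_left (ereal c))"
      using DERIV_isCont[OF cdf_gap_Suc[OF h(1), of 0 t c]]
      by (auto simp: ereal_tendsto_simps isCont_def intro: tendsto_within_subset)
  qed auto
  finally have FTC: "(\<integral>x. L01 (x - c) * cdf_gap 1 h t x \<partial>lborel) = cdf_gap 0 h t c" by simp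
  have 1: "(\<integral>\<^sup>+x. ennreal (L01 (x - c) * cond_dens h 1 t x) \<partial>lborel)
      = ennreal (\<integral>x. L01 (x - c) * cond_dens h 1 t x \<partial>lborel)"
    using int1 L cond_dens_nonneg by (intro nn_integral_eq_integral) auto
  have 2: "(\<integral>\<^sup>+x. ennreal (L01 (- (x - c)) * cond_dens h (-1) t x) \<partial>lborel)
      = ennreal (\<integral>x. cond_dens h (-1) t x - L01 (x - c) * cond_dens h (-1) t x \<partial>lborel)"
    using int int1 L cond_dens_nonneg
    by (subst nn_integral_eq_integral[symmetric]) (auto simp: L(3)[of "x - c" for x, simplified] algebra_simps mult_left_le_one_le)
  have 3: "(\<integral>x. L01 (x - c) * cond_dens h 1 t x \<partial>lborel) +
     (\<integral>x. cond_dens h (-1) t x - L01 (x - c) * cond_dens h (-1) t x \<partial>lborel) =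
     1 + (\<integral>x. L01 (x - c) * cdf_gap 1 h t x \<partial>lborel)"
    using int int1 cond_dens_integral[OF h(1), of "-1" t]
    unfolding cdf_gap_1_eq[OF h(1)]
    by (simp add: right_diff_distrib Bochner_Integration.integral_diff has_bochner_integral_iff del: One_nat_def)
  have nn1: "0 \<le> (\<integral>x. L01 (x - c) * cond_dens h 1 t x \<partial>lborel)"
    using L cond_dens_nonneg by (intro integral_nonneg_AE) auto
  have nn2: "0 \<le> (\<integral>x. cond_dens h (-1) t x - L01 (x - c) * cond_dens h (-1) t x \<partial>lborel)"
    using L cond_dens_nonneg by (intro integral_nonneg_AE AE_I2) (auto intro!: mult_left_le_one_le)
  show "0 \<le> 1 + cdf_gap 0 h t c" using nn1 nn2 3 FTC by linarith
  show "(\<integral>\<^sup>+x. ennreal (L01 (x - c) * cond_dens h 1 t x) \<partial>lborel)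
   + (\<integral>\<^sup>+x. ennreal (L01 (- (x - c)) * cond_dens h (-1) t x) \<partial>lborel) = ennreal (1 + cdf_gap 0 h t c)"
    unfolding 1 2 using nn1 nn2 3 FTC by (simp flip: ennreal_plus)
qed

end

text \<open>The double difference is what produces the factor \<open>|t|\<close>. For the bump part
  it comes from the amplitude, \<open>l\<close> derivatives cost \<open>h ^ l\<close>, and the
  Holder bound at scale \<open>h\<close> costs another \<open>h powr r\<close>. For the base part it
  comes from the mean value theorem applied to \<open>A (\<Delta> + x) - A x\<close>, and the power
  of \<open>h\<close> is inserted for free, being at least 1. With \<open>r = \<beta> - l\<close>
  the total is \<open>h powr (- \<beta>)\<close>, and \<open>K\<close> depends on neither
  \<open>h\<close> nor \<open>t\<close>.\<close>

lemma cond_dens_deriv_holder: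
  assumes "0 < r" "r \<le> 1"
  shows "\<exists>K>0. \<forall>h t y \<Delta>. 0 < h \<longrightarrow> h \<le> 1 \<longrightarrow> y \<in> {-1, 1} \<longrightarrow>
    \<bar>(cond_dens_deriv l h y t (\<Delta> + t) - cond_dens_deriv l h y t t)
      - (cond_dens_deriv l h y 0 \<Delta> - cond_dens_deriv l h y 0 0)\<bar>
    \<le> K * \<bar>t\<bar> * h powr (- (r + real l)) * \<bar>\<Delta>\<bar> powr r"
proof -
  define P where "P y = (gauss_step ^^ l) [:1, y, 1:]" for y :: real
  define Q where "Q = (gauss_step ^^ l) [:1, 0, -1:]"
  have "\<exists>M>0. \<forall>u v. \<bar>gauss_poly (gauss_step (P y)) u - gauss_poly (gauss_step (P y)) v\<bar> \<le> M * \<bar>u - v\<bar> powr r" for y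
    by (rule gauss_poly_holder[OF assms])
  then obtain M where M: "\<And>y. M y > 0"
    "\<And>y u v. \<bar>gauss_poly (gauss_step (P y)) u - gauss_poly (gauss_step (P y)) v\<bar> \<le> M y * \<bar>u - v\<bar> powr r"
    by metis
  obtain N where N: "N > 0" "\<And>u v. \<bar>gauss_poly Q u - gauss_poly Q v\<bar> \<le> N * \<bar>u - v\<bar> powr r"
    using gauss_poly_holder[OF assms, of Q] by auto
  define K where "K = M 1 + M (-1) + N"
  have K: "K > 0" "\<And>y. y \<in> {-1, 1} \<Longrightarrow> M y + N \<le> K"
    using M(1)[of 1] M(1)[of "-1"] N by (auto simp: K_def)
  show ?thesis
  proof (intro exI[of _ K] conjI allI impI K(1))
    fix h t y \<Delta> :: real assume h: "0 < h" "h \<le> 1" and y: "y \<in> {-1, 1}"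
    define A where "A = gauss_poly (P y)"
    define A' where "A' = gauss_poly (gauss_step (P y))"
    have "norm ((A (\<Delta> + t) - A t) - (A (\<Delta> + 0) - A 0)) \<le> (M y * \<bar>\<Delta>\<bar> powr r) * norm (t - 0)"
    proof (rule field_differentiable_bound[of UNIV _ "\<lambda>x. A' (\<Delta> + x) - A' x"])
      show "((\<lambda>x. A (\<Delta> + x) - A x) has_real_derivative A' (\<Delta> + x) - A' x) (at x within UNIV)" for x
        unfolding A_def A'_def by (auto intro!: derivative_eq_intros)
      show "norm (A' (\<Delta> + x) - A' x) \<le> M y * \<bar>\<Delta>\<bar> powr r" for x
        using M(2)[of y "\<Delta> + x" x] by (simp add: A'_def)
    qed auto
    then have 1: "\<bar>(A (\<Delta> + t) - A t) - (A \<Delta> - A 0)\<bar> \<le> M y * \<bar>\<Delta>\<bar> powr r * \<bar>t\<bar>" by simp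
    have hp: "1 \<le> h powr (- (r + real l))" 
    proof -
      have "h powr (r + real l) \<le> 1" using h assms by (intro powr_le1) auto
      moreover have "0 < h powr (r + real l)" using h by simp
      ultimately show ?thesis unfolding powr_minus by (simp only: one_le_inverse_iff)
    qed
    have 2: "\<bar>y * (t * gauss t / h ^ l * gauss_poly Q (\<Delta> / h)) - y * (t * gauss t / h ^ l * gauss_poly Q 0)\<bar>
       \<le> N * \<bar>t\<bar> * h powr (- (r + real l)) * \<bar>\<Delta>\<bar> powr r"
    proof -
      have "\<bar>y * (t * gauss t / h ^ l * gauss_poly Q (\<Delta> / h)) - y * (t * gauss t / h ^ l * gauss_poly Q 0)\<bar>
        = \<bar>y\<bar> * (\<bar>t\<bar> * gauss t / h ^ l * \<bar>gauss_poly Q (\<Delta> / h) - gauss_poly Q 0\<bar>)"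
      proof -
        have "y * (t * gauss t / h ^ l * gauss_poly Q (\<Delta> / h)) - y * (t * gauss t / h ^ l * gauss_poly Q 0)
          = y * (t * gauss t / h ^ l * (gauss_poly Q (\<Delta> / h) - gauss_poly Q 0))"
          by (simp only: right_diff_distrib)
        then show ?thesis using h by (simp only: abs_mult abs_divide) simp
      qed
      also have "\<dots> \<le> 1 * (\<bar>t\<bar> * 1 / h ^ l * (N * \<bar>\<Delta> / h\<bar> powr r))"
        using y h N(2)[of "\<Delta> / h" 0] by (intro mult_mono divide_right_mono) auto
      also have "\<dots> = N * \<bar>t\<bar> * h powr (- (r + real l)) * \<bar>\<Delta>\<bar> powr r"
      proof -
        have "\<bar>\<Delta> / h\<bar> = \<bar>\<Delta>\<bar> / h" using h by simp
        then have 1: "\<bar>\<Delta> / h\<bar> powr r = \<bar>\<Delta>\<bar> powr r * h powr (- r)"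
          using h by (simp add: powr_divide powr_minus_divide)
        have "h powr (- (r + real l)) = h powr (- r) * h powr (- real l)"
          by (simp flip: powr_add)
        also have "h powr (- real l) = 1 / h ^ l" using h by (simp add: powr_minus_divide powr_realpow)
        finally have 2: "h powr (- (r + real l)) = h powr (- r) * (1 / h ^ l)" .
        show ?thesis unfolding 1 2 by simp
      qed
      finally show ?thesis .
    qed
    have "(cond_dens_deriv l h y t (\<Delta> + t) - cond_dens_deriv l h y t t)
      - (cond_dens_deriv l h y 0 \<Delta> - cond_dens_deriv l h y 0 0) =
      c\<^sub>0 * (((A (\<Delta> + t) - A t) - (A \<Delta> - A 0))
        - (y * (t * gauss t / h ^ l * gauss_poly Q (\<Delta> / h)) - y * (t * gauss t / h ^ l * gauss_poly Q 0)))"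
      by (simp add: cond_dens_deriv_def A_def P_def Q_def algebra_simps)
    also have "\<bar>\<dots>\<bar> \<le> 1 * (M y * \<bar>\<Delta>\<bar> powr r * \<bar>t\<bar> + N * \<bar>t\<bar> * h powr (- (r + real l)) * \<bar>\<Delta>\<bar> powr r)"
      unfolding abs_mult using 1 2 gauss_const_pos gauss_const_le by (intro mult_mono) linarith+
    also have "M y * \<bar>\<Delta>\<bar> powr r * \<bar>t\<bar> \<le> M y * \<bar>\<Delta>\<bar> powr r * \<bar>t\<bar> * h powr (- (r + real l))"
    proof -
      have "M y * \<bar>\<Delta>\<bar> powr r * \<bar>t\<bar> * 1 \<le> M y * \<bar>\<Delta>\<bar> powr r * \<bar>t\<bar> * h powr (- (r + real l))"
        using M(1)[of y] by (intro mult_left_mono hp) auto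
      then show ?thesis by (simp only: mult_1_right)
    qed
    also have "1 * (M y * \<bar>\<Delta>\<bar> powr r * \<bar>t\<bar> * h powr (- (r + real l)) + N * \<bar>t\<bar> * h powr (- (r + real l)) * \<bar>\<Delta>\<bar> powr r)
      = (M y + N) * (\<bar>t\<bar> * h powr (- (r + real l)) * \<bar>\<Delta>\<bar> powr r)" by (simp add: algebra_simps)
    also have "\<dots> \<le> K * (\<bar>t\<bar> * h powr (- (r + real l)) * \<bar>\<Delta>\<bar> powr r)"
      using K(2)[OF y] by (intro mult_right_mono) auto
    finally show "\<bar>(cond_dens_deriv l h y t (\<Delta> + t) - cond_dens_deriv l h y t t)
      - (cond_dens_deriv l h y 0 \<Delta> - cond_dens_deriv l h y 0 0)\<bar>
      \<le> K * \<bar>t\<bar> * h powr (- (r + real l)) * \<bar>\<Delta>\<bar> powr r" by (simp add: mult.assoc)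
  qed
qed

section \<open>Smallest eigenvalues and product measures\<close>

text \<open>Guarantees that the \<open>Min\<close> in \<open>lambda_min\<close> is taken over a
  nonempty set. A complex eigenvector \<open>a + i b\<close> exists; symmetry makes the bilinear
  form agree on \<open>(b, a)\<close> and \<open>(a, b)\<close>, which forces \<open>Im k\<close>
  times the squared length to vanish. Then whichever of \<open>a\<close>, \<open>b\<close> is
  nonzero is a real eigenvector.\<close>

lemma real_symmetric_eigenvalue_exists:
  fixes A :: "real mat"
  assumes A: "A \<in> carrier_mat n n" and n: "n > 0"
    and sym: "\<And>i j. i < n \<Longrightarrow> j < n \<Longrightarrow> A $$ (i, j) = A $$ (j, i)"
  shows "spectrum A \<noteq> {}"
proof -
  let ?A = "map_mat complex_of_real A"
  have cA: "?A \<in> carrier_mat n n" using A by simp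
  obtain k where "k \<in> spectrum ?A" using spectrum_non_empty[OF cA n] by auto
  then obtain v where v: "v \<in> carrier_vec n" "v \<noteq> 0\<^sub>v n" "?A *\<^sub>v v = k \<cdot>\<^sub>v v"
    using cA by (auto simp: spectrum_def eigenvalue_def eigenvector_def)
  define a b where "a i = Re (v $ i)" and "b i = Im (v $ i)" for i
  have row: "(\<Sum>j<n. complex_of_real (A $$ (i, j)) * v $ j) = k * v $ i" if "i < n" for i
  proof -
    have "(?A *\<^sub>v v) $ i = (\<Sum>j<n. complex_of_real (A $$ (i, j)) * v $ j)"
      using that A v(1) by (simp add: scalar_prod_def atLeast0LessThan)
    then show ?thesis using v that by simp
  qed
  have re: "(\<Sum>j<n. A $$ (i, j) * a j) = Re k * a i - Im k * b i" if "i < n" for i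
    using arg_cong[OF row[OF that], of Re] by (simp add: a_def b_def)
  have im: "(\<Sum>j<n. A $$ (i, j) * b j) = Re k * b i + Im k * a i" if "i < n" for i
    using arg_cong[OF row[OF that], of Im] by (simp add: a_def b_def)
  have "(\<Sum>i<n. \<Sum>j<n. b i * (A $$ (i, j) * a j)) = (\<Sum>i<n. \<Sum>j<n. a i * (A $$ (i, j) * b j))"
    by (subst sum.swap) (auto intro!: sum.cong simp: sym mult_ac)
  then have "(\<Sum>i<n. b i * (Re k * a i - Im k * b i)) = (\<Sum>i<n. a i * (Re k * b i + Im k * a i))"
    by (simp add: re im flip: sum_distrib_left)
  then have "Im k * (\<Sum>i<n. a i ^ 2 + b i ^ 2) = 0"
    by (simp add: algebra_simps sum.distrib sum_subtractf sum_distrib_left power2_eq_square)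
  moreover obtain i where i: "i < n" "v $ i \<noteq> 0"
    using v(1,2) by (metis eq_vecI carrier_vecD index_zero_vec)
  then have pos: "0 < a i ^ 2 + b i ^ 2"
    by (auto simp: a_def b_def complex_eq_iff sum_power2_gt_zero_iff)
  then have "0 < (\<Sum>i<n. a i ^ 2 + b i ^ 2)"
    using i by (intro sum_pos2[of _ i]) auto
  ultimately have "Im k = 0" by simp
  have eig: "Re k \<in> spectrum A" if "u i \<noteq> 0" "\<And>i. i < n \<Longrightarrow> (\<Sum>j<n. A $$ (i, j) * u j) = Re k * u i" for u
  proof -
    have "A *\<^sub>v vec n u = Re k \<cdot>\<^sub>v vec n u"
      using A that(2) by (intro eq_vecI) (auto simp: scalar_prod_def atLeast0LessThan)
    moreover have "vec n u \<noteq> 0\<^sub>v n" using that(1) i by (metis index_vec index_zero_vec(1))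
    ultimately show ?thesis using A
      by (auto simp: spectrum_def eigenvalue_def eigenvector_def intro!: exI[of _ "vec n u"])
  qed
  from pos have "a i \<noteq> 0 \<or> b i \<noteq> 0" by auto
  then show ?thesis using eig[of a] eig[of b] re im \<open>Im k = 0\<close> by auto
qed

text \<open>The minimum is attained at an actual eigenvector, where the quadratic form equals
  \<open>lambda_min A\<close> times the squared length.\<close>

lemma lambda_min_ge:
  fixes A :: "real mat"
  assumes A: "A \<in> carrier_mat n n" and n: "n > 0"
    and sym: "\<And>i j. i < n \<Longrightarrow> j < n \<Longrightarrow> A $$ (i, j) = A $$ (j, i)"
    and quad: "\<And>v. r * (\<Sum>i<n. (v i)^2) \<le> (\<Sum>i<n. \<Sum>j<n. v i * v j * A $$ (i, j))"
  shows "r \<le> lambda_min A"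
proof -
  have "lambda_min A \<in> spectrum A"
    unfolding lambda_min_def
    using card_finite_spectrum(1)[OF A] real_symmetric_eigenvalue_exists[OF A n sym] by (rule Min_in)
  then obtain v where v: "v \<in> carrier_vec n" "v \<noteq> 0\<^sub>v n" "A *\<^sub>v v = lambda_min A \<cdot>\<^sub>v v"
    using A by (auto simp: spectrum_def eigenvalue_def eigenvector_def)
  have row: "(\<Sum>j<n. A $$ (i, j) * v $ j) = lambda_min A * v $ i" if "i < n" for i
  proof -
    have "(A *\<^sub>v v) $ i = (\<Sum>j<n. A $$ (i, j) * v $ j)"
      using that A v(1) by (simp add: scalar_prod_def atLeast0LessThan)
    then show ?thesis using v that by simp
  qed
  have "(\<Sum>i<n. \<Sum>j<n. v $ i * v $ j * A $$ (i, j)) = (\<Sum>i<n. v $ i * (\<Sum>j<n. A $$ (i, j) * v $ j))"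
    by (simp add: sum_distrib_left mult_ac)
  then have "r * (\<Sum>i<n. (v $ i)^2) \<le> (\<Sum>i<n. v $ i * (\<Sum>j<n. A $$ (i, j) * v $ j))"
    using quad[of "\<lambda>i. v $ i"] by simp
  also have "\<dots> = lambda_min A * (\<Sum>i<n. (v $ i)^2)"
    unfolding sum_distrib_left by (intro sum.cong refl) (simp add: row power2_eq_square flip: sum_distrib_left)
  finally have le: "r * (\<Sum>i<n. (v $ i)^2) \<le> lambda_min A * (\<Sum>i<n. (v $ i)^2)" .
  obtain i where i: "i < n" "v $ i \<noteq> 0"
    using v(1,2) by (metis eq_vecI carrier_vecD index_zero_vec)
  then have "0 < (\<Sum>i<n. (v $ i)^2)" by (intro sum_pos2[of _ i]) auto
  with le show ?thesis by simp
qed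

section \<open>Product measures and bounded i.i.d. coordinates\<close>

lemma density_PiM:
  assumes I: "finite I" and M: "sigma_finite_measure M" and D: "sigma_finite_measure (density M f)"
    and [measurable]: "f \<in> borel_measurable M"
  shows "density (PiM I (\<lambda>_. M)) (\<lambda>x. \<Prod>i\<in>I. f (x i)) = PiM I (\<lambda>_. density M f)"
proof -
  interpret M: product_sigma_finite "\<lambda>_. M" by (simp add: product_sigma_finite_def M)
  interpret D: product_sigma_finite "\<lambda>_. density M f" by (simp add: product_sigma_finite_def D)
  show ?thesis
  proof (rule D.PiM_eqI[OF I])
    show "sets (density (PiM I (\<lambda>_. M)) (\<lambda>x. \<Prod>i\<in>I. f (x i))) = sets (PiM I (\<lambda>_. density M f))"
      by (simp cong: sets_PiM_cong)
    fix A assume "\<And>i. i \<in> I \<Longrightarrow> A i \<in> sets (density M f)"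
    then have A [measurable]: "A i \<in> sets M" if "i \<in> I" for i using that by auto
    have "Pi\<^sub>E I A \<in> sets (PiM I (\<lambda>_. M))" using A I by (intro sets_PiM_I_finite) auto
    then have "emeasure (density (PiM I (\<lambda>_. M)) (\<lambda>x. \<Prod>i\<in>I. f (x i))) (Pi\<^sub>E I A)
      = (\<integral>\<^sup>+x. (\<Prod>i\<in>I. f (x i)) * indicator (Pi\<^sub>E I A) x \<partial>PiM I (\<lambda>_. M))"
      by (intro emeasure_density) auto
    also have "\<dots> = (\<integral>\<^sup>+x. (\<Prod>i\<in>I. f (x i) * indicator (A i) (x i)) \<partial>PiM I (\<lambda>_. M))"
    proof (intro nn_integral_cong)
      fix x assume "x \<in> space (PiM I (\<lambda>_. M))"
      then have "indicator (Pi\<^sub>E I A) x = (\<Prod>i\<in>I. indicator (A i) (x i) :: ennreal)"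
        using I by (auto simp: indicator_def space_PiM PiE_iff prod_zero_iff)
      then show "(\<Prod>i\<in>I. f (x i)) * indicator (Pi\<^sub>E I A) x = (\<Prod>i\<in>I. f (x i) * indicator (A i) (x i))"
        by (simp add: prod.distrib)
    qed
    also have "\<dots> = (\<Prod>i\<in>I. \<integral>\<^sup>+x. f x * indicator (A i) x \<partial>M)"
      using I A by (intro M.product_nn_integral_prod) auto
    also have "\<dots> = (\<Prod>i\<in>I. emeasure (density M f) (A i))"
      using A by (intro prod.cong) (auto simp: emeasure_density)
    finally show "emeasure (density (PiM I (\<lambda>_. M)) (\<lambda>x. \<Prod>i\<in>I. f (x i))) (Pi\<^sub>E I A)
      = (\<Prod>i\<in>I. emeasure (density M f) (A i))" .
  qed
qed

text \<open>The only features of the covariate law that matter: boundedness gives integrability and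
  an almost sure bound on \<open>dot\<close>, mean zero removes terms linear in \<open>z\<close>,
  and the variance turns second moments of \<open>dot\<close> into squared 2-norms.\<close>

locale iid_coordinates =
  fixes U :: "real measure" and B \<sigma>2 :: real
  assumes prob_U: "prob_space U" and sets_U [measurable_cong, simp]: "sets U = sets borel"
    and bounded_U: "AE x in U. \<bar>x\<bar> \<le> B"
    and mean_U: "(\<integral>x. x \<partial>U) = 0" and var_U: "(\<integral>x. x^2 \<partial>U) = \<sigma>2"
begin

sublocale U: prob_space U by (rule prob_U)
sublocale product_prob_space "\<lambda>_::nat. U" by standard

abbreviation \<mu> :: "nat \<Rightarrow> (nat \<Rightarrow> real) measure" where "\<mu> d \<equiv> PiM {..<d} (\<lambda>_. U)"

lemma prob_space_iid: "prob_space (\<mu> d)" by (intro prob_space_PiM prob_U)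

lemma B_nonneg: "0 \<le> B"
proof (rule ccontr)
  assume "\<not> 0 \<le> B"
  have "AE x in U. False" using bounded_U by eventually_elim (use \<open>\<not> 0 \<le> B\<close> in auto)
  then show False by simp
qed

lemma iid_bounded: "AE z in \<mu> d. \<forall>i<d. \<bar>z i\<bar> \<le> B"
proof -
  have "AE z in \<mu> d. \<bar>z i\<bar> \<le> B" if "i < d" for i
    using that bounded_U by (intro AE_PiM_component[where P="\<lambda>x. \<bar>x\<bar> \<le> B"] prob_U) auto
  then have "AE z in \<mu> d. \<forall>i\<in>{..<d}. \<bar>z i\<bar> \<le> B" by (intro AE_finite_allI) auto
  then show ?thesis by (simp add: Ball_def)
qed

lemma integrable_bounded_iid:
  fixes f :: "(nat \<Rightarrow> real) \<Rightarrow> real"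
  assumes "f \<in> borel_measurable (\<mu> d)" "AE z in \<mu> d. \<bar>f z\<bar> \<le> K"
  shows "integrable (\<mu> d) f"
proof -
  interpret prob_space "\<mu> d" by (rule prob_space_iid)
  show ?thesis using assms by (intro integrable_const_bound[of _ K]) auto
qed

lemma integrable_pow_U: "integrable U (\<lambda>x. x ^ k)"
proof (rule U.integrable_const_bound)
  show "AE x in U. norm (x ^ k) \<le> B ^ k"
    using bounded_U by eventually_elim (auto simp: power_abs intro: power_mono)
qed measurable

text \<open>A single coordinate is written as a product over all coordinates with factor 1
  elsewhere, so that the product formula for integrals applies; the covariance below is treated in
  the same way.\<close>

lemma iid_component_mean:
  assumes "i < d"
  shows "(\<integral>z. z i \<partial>\<mu> d) = 0"
proof -
  have "integrable U (\<lambda>x. if j = i then x else 1)" for j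
    using integrable_pow_U[of 1] by (cases "j = i") auto
  then have "(\<integral>z. (\<Prod>j<d. if j = i then z j else 1) \<partial>\<mu> d) = (\<Prod>j<d. \<integral>x. (if j = i then x else 1) \<partial>U)"
    by (intro product_integral_prod) auto
  also have "\<dots> = 0" using assms mean_U by (intro prod_zero) (auto intro!: bexI[of _ i])
  finally show ?thesis using assms by (simp add: prod.delta)
qed

lemma iid_component_cov:
  assumes "i < d" "k < d"
  shows "(\<integral>z. z i * z k \<partial>\<mu> d) = (if i = k then \<sigma>2 else 0)"
proof -
  define F where "F j x = (if j = i then x else 1) * (if j = k then x else 1)" for j and x :: real
  have "integrable U (F j)" for j
    using integrable_pow_U[of 2] integrable_pow_U[of 1]
    by (cases "j = i"; cases "j = k") (auto simp: F_def[abs_def] power2_eq_square)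
  then have "(\<integral>z. (\<Prod>j<d. F j (z j)) \<partial>\<mu> d) = (\<Prod>j<d. \<integral>x. F j x \<partial>U)"
    by (intro product_integral_prod) auto
  moreover have "(\<Prod>j<d. F j (z j)) = z i * z k" for z
    using assms by (simp add: F_def prod.distrib prod.delta)
  moreover have "(\<Prod>j<d. \<integral>x. F j x \<partial>U) = (if i = k then \<sigma>2 else 0)"
  proof (cases "i = k")
    case True
    have "(\<Prod>j<d. \<integral>x. F j x \<partial>U) = (\<Prod>j<d. if j = i then \<sigma>2 else 1)"
      using True var_U U.prob_space by (intro prod.cong) (auto simp: F_def power2_eq_square)
    then show ?thesis using True assms by (simp add: prod.delta)
  next
    case False
    then show ?thesis using assms mean_U by (auto simp: F_def intro!: prod_zero bexI[of _ i])
  qed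
  ultimately show ?thesis by simp
qed

lemma dot_measurable [measurable]: "(\<lambda>z. dot d v z) \<in> borel_measurable (\<mu> d)"
  unfolding dot_def by measurable

lemma iid_dot_bound: "AE z in \<mu> d. \<bar>dot d v z\<bar> \<le> B * (\<Sum>i<d. \<bar>v i\<bar>)"
  using iid_bounded[of d]
proof eventually_elim
  case (elim z)
  have "\<bar>dot d v z\<bar> \<le> (\<Sum>i<d. \<bar>v i\<bar> * \<bar>z i\<bar>)"
    unfolding dot_def by (rule order_trans[OF sum_abs]) (simp add: abs_mult)
  also have "\<dots> \<le> (\<Sum>i<d. \<bar>v i\<bar> * B)" using elim by (intro sum_mono mult_left_mono) auto
  finally show ?case by (simp add: sum_distrib_left mult.commute)
qed

lemma iid_dot_integrable: "integrable (\<mu> d) (\<lambda>z. dot d v z)"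
  by (rule integrable_bounded_iid[OF _ iid_dot_bound]) measurable

lemma iid_component_integrable:
  assumes "i < d"
  shows "integrable (\<mu> d) (\<lambda>z. z i)"
proof (rule integrable_bounded_iid)
  show "AE z in \<mu> d. \<bar>z i\<bar> \<le> B" using iid_bounded[of d] by eventually_elim (use assms in auto)
  have "i \<in> {..<d}" using assms by simp
  then show "(\<lambda>z. z i) \<in> borel_measurable (\<mu> d)" by measurable
qed

lemma iid_dot_mean: "(\<integral>z. dot d v z \<partial>\<mu> d) = 0"
  unfolding dot_def using iid_component_integrable
  by (subst Bochner_Integration.integral_sum) (auto simp: iid_component_mean)

lemma iid_dot_sq_integrable: "integrable (\<mu> d) (\<lambda>z. dot d v z * dot d u z)"
proof (rule integrable_bounded_iid)
  show "AE z in \<mu> d. \<bar>dot d v z * dot d u z\<bar> \<le> (B * (\<Sum>i<d. \<bar>v i\<bar>)) * (B * (\<Sum>i<d. \<bar>u i\<bar>))"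
    using iid_dot_bound[of d v] iid_dot_bound[of d u]
    by eventually_elim (auto simp: abs_mult intro!: mult_mono mult_nonneg_nonneg B_nonneg sum_nonneg)
qed measurable

lemma iid_dot_second_moment: "(\<integral>z. (dot d v z)^2 \<partial>\<mu> d) = \<sigma>2 * (\<Sum>i<d. (v i)^2)"
proof -
  have int: "integrable (\<mu> d) (\<lambda>z. z i * z k)" if "i < d" "k < d" for i k
  proof (rule integrable_bounded_iid)
    show "AE z in \<mu> d. \<bar>z i * z k\<bar> \<le> B * B"
      using iid_bounded[of d] by eventually_elim (use that B_nonneg in \<open>auto simp: abs_mult intro!: mult_mono\<close>)
    show "(\<lambda>z. z i * z k) \<in> borel_measurable (\<mu> d)"
      using that[THEN iid_component_integrable] by auto
  qed
  have "(\<integral>z. (dot d v z)^2 \<partial>\<mu> d) = (\<integral>z. (\<Sum>i<d. \<Sum>k<d. (v i * v k) * (z i * z k)) \<partial>\<mu> d)"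
    by (simp add: dot_def power2_eq_square sum_product mult_ac)
  also have "\<dots> = (\<Sum>i<d. \<Sum>k<d. (v i * v k) * (\<integral>z. z i * z k \<partial>\<mu> d))"
  proof -
    have "(\<integral>z. (\<Sum>i<d. \<Sum>k<d. (v i * v k) * (z i * z k)) \<partial>\<mu> d)
      = (\<Sum>i<d. (\<integral>z. (\<Sum>k<d. (v i * v k) * (z i * z k)) \<partial>\<mu> d))"
      using int by (intro Bochner_Integration.integral_sum Bochner_Integration.integrable_sum integrable_mult_right) auto
    also have "\<dots> = (\<Sum>i<d. \<Sum>k<d. (\<integral>z. (v i * v k) * (z i * z k) \<partial>\<mu> d))"
      using int by (intro sum.cong refl Bochner_Integration.integral_sum integrable_mult_right) auto
    finally show ?thesis by simp
  qed
  also have "\<dots> = (\<Sum>i<d. \<Sum>k<d. if i = k then \<sigma>2 * (v i)^2 else 0)"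
    by (intro sum.cong refl) (auto simp: iid_component_cov power2_eq_square)
  also have "\<dots> = \<sigma>2 * (\<Sum>i<d. (v i)^2)" by (simp add: sum.delta sum_distrib_left)
  finally show ?thesis .
qed

lemma var_nonneg: "0 \<le> \<sigma>2" 
proof -
  have "0 \<le> (\<integral>x. x^2 \<partial>U)" by (intro integral_nonneg_AE) auto
  then show ?thesis by (simp add: var_U)
qed

text \<open>Cauchy-Schwarz for the covariate law, whose isotropy leaves only 2-norms. It is obtained
  by integrating AM-GM with the norms themselves as weights \<open>a\<close>, \<open>b\<close>,
  which equalises the two terms; a zero norm is treated separately because the weights are cancelled
  at the end.\<close>

lemma iid_abs_dot_product: "(\<integral>z. \<bar>dot d v z\<bar> * \<bar>dot d u z\<bar> \<partial>\<mu> d) \<le> \<sigma>2 * lq_norm d 2 v * lq_norm d 2 u"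
proof -
  have sq: "(lq_norm d 2 w)^2 = (\<Sum>i<d. (w i)^2)" for w
    unfolding lq_norm_2 L2_set_def by (simp add: sum_nonneg)
  have nn: "lq_norm d 2 w \<ge> 0" for w by (simp add: lq_norm_2)
  have int: "integrable (\<mu> d) (\<lambda>z. \<bar>dot d v z\<bar> * \<bar>dot d u z\<bar>)"
    using integrable_abs[OF iid_dot_sq_integrable[of d v u]] by (simp add: abs_mult)
  have main: "2 * (a * b * (\<integral>z. \<bar>dot d v z\<bar> * \<bar>dot d u z\<bar> \<partial>\<mu> d))
      \<le> b^2 * (\<sigma>2 * (lq_norm d 2 v)^2) + a^2 * (\<sigma>2 * (lq_norm d 2 u)^2)" for a b
  proof -
    have "(\<integral>z. 2 * (a * b * (\<bar>dot d v z\<bar> * \<bar>dot d u z\<bar>)) \<partial>\<mu> d) \<le>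
       (\<integral>z. b^2 * (dot d v z)^2 + a^2 * (dot d u z)^2 \<partial>\<mu> d)"
    proof (rule integral_mono)
      show "integrable (\<mu> d) (\<lambda>z. b^2 * (dot d v z)^2 + a^2 * (dot d u z)^2)"
        using iid_dot_sq_integrable[of d v v] iid_dot_sq_integrable[of d u u] by (auto simp: power2_eq_square)
      show "2 * (a * b * (\<bar>dot d v z\<bar> * \<bar>dot d u z\<bar>)) \<le> b^2 * (dot d v z)^2 + a^2 * (dot d u z)^2" for z
        using zero_le_power2[of "b * \<bar>dot d v z\<bar> - a * \<bar>dot d u z\<bar>"]
        by (simp add: power2_diff power_mult_distrib mult_ac)
    qed (use int in auto)
    also have "\<dots> = b^2 * (\<integral>z. (dot d v z)^2 \<partial>\<mu> d) + a^2 * (\<integral>z. (dot d u z)^2 \<partial>\<mu> d)"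
      using iid_dot_sq_integrable[of d v v] iid_dot_sq_integrable[of d u u] by (simp add: power2_eq_square)
    finally show ?thesis by (simp add: iid_dot_second_moment sq)
  qed
  define a b where "a = lq_norm d 2 v" and "b = lq_norm d 2 u"
  show ?thesis
  proof (cases "a = 0 \<or> b = 0")
    case True
    have zero: "(\<integral>z. \<bar>dot d v z\<bar> * \<bar>dot d u z\<bar> \<partial>\<mu> d) = 0"
    proof -
      have "dot d w z = 0" if "lq_norm d 2 w = 0" for w z
      proof -
        have "(\<Sum>i<d. (w i)^2) = 0" using sq[of w] that by simp
        then have "\<forall>i<d. w i = 0" by (subst (asm) sum_nonneg_eq_0_iff) auto
        then show ?thesis by (simp add: dot_def)
      qed
      then show ?thesis using True by (auto simp: a_def b_def)
    qed
    then show ?thesis using nn[of v] nn[of u] var_nonneg by simp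
  next
    case False
    then have ab: "0 < a * b" using nn[of v] nn[of u] by (auto simp: a_def b_def)
    have "2 * (a * b) * (\<integral>z. \<bar>dot d v z\<bar> * \<bar>dot d u z\<bar> \<partial>\<mu> d) \<le> 2 * (a * b) * (\<sigma>2 * a * b)"
      using main[of a b] by (simp add: a_def[symmetric] b_def[symmetric] power2_eq_square mult_ac)
    moreover from ab have pos: "0 < 2 * (a * b)" by simp
    ultimately show ?thesis unfolding a_def[symmetric] b_def[symmetric] mult_le_cancel_left_pos[OF pos] by blast
  qed
qed

end

definition unif_dens :: "real \<Rightarrow> real \<Rightarrow> real" where
  "unif_dens B x = indicator {-B..B} x / (2 * B)"

lemma unif_dens_measurable [measurable]: "unif_dens B \<in> borel_measurable borel"
  unfolding unif_dens_def by measurable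

lemma iid_coordinates_uniform:
  assumes B: "0 < B"
  shows "iid_coordinates (density lborel (\<lambda>x. ennreal (unif_dens B x))) B (B^2 / 3)"
proof (rule iid_coordinates.intro)
  have nn: "0 \<le> unif_dens B x" for x using B by (simp add: unif_dens_def)
  have int: "has_bochner_integral lborel (\<lambda>x. x ^ k * unif_dens B x) ((B ^ Suc k / Suc k - (- B) ^ Suc k / Suc k) / (2 * B))" for k
  proof -
    have F: "((\<lambda>x. x ^ Suc k / Suc k) has_real_derivative x ^ k) (at x)" for x :: real
      using DERIV_cdivide[OF DERIV_pow[of "Suc k" x], of "real (Suc k)"]
      by (simp del: power_Suc of_nat_Suc)
    have "has_bochner_integral lborel (\<lambda>x. x ^ k * indicator {-B..B} x) (B ^ Suc k / Suc k - (- B) ^ Suc k / Suc k)"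
      using B by (intro has_bochner_integral_FTC_Icc_real[where F="\<lambda>x. x ^ Suc k / Suc k"])
        (use F in \<open>auto intro!: continuous_intros simp del: power_Suc of_nat_Suc\<close>)
    from has_bochner_integral_divide_zero[OF this, of "2 * B"] show ?thesis
      unfolding unif_dens_def times_divide_eq_right .
  qed
  show "prob_space (density lborel (\<lambda>x. ennreal (unif_dens B x)))"
  proof (rule prob_spaceI)
    have "(\<integral>\<^sup>+x. ennreal (unif_dens B x) \<partial>lborel) = ennreal 1"
      using int[of 0] nn B by (subst nn_integral_eq_integral) (auto simp: has_bochner_integral_iff)
    then show "emeasure (density lborel (\<lambda>x. ennreal (unif_dens B x))) (space (density lborel (\<lambda>x. ennreal (unif_dens B x)))) = 1"
      by (simp add: emeasure_density)
  qed
  show "AE x in density lborel (\<lambda>x. ennreal (unif_dens B x)). \<bar>x\<bar> \<le> B"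
    by (subst AE_density) (auto simp: unif_dens_def indicator_def)
  have mom: "(\<integral>x. x ^ k \<partial>density lborel (\<lambda>x. ennreal (unif_dens B x))) = (B ^ Suc k / Suc k - (- B) ^ Suc k / Suc k) / (2 * B)" for k
    using int[of k] nn by (subst integral_real_density) (auto simp: has_bochner_integral_iff mult.commute)
  show "(\<integral>x. x \<partial>density lborel (\<lambda>x. ennreal (unif_dens B x))) = 0"
    using mom[of 1] by simp
  show "(\<integral>x. x^2 \<partial>density lborel (\<lambda>x. ennreal (unif_dens B x))) = B^2 / 3"
    unfolding mom[of 2] using B by (simp add: field_simps power2_eq_square power3_eq_cube)
qed simp

section \<open>The observation law\<close>

abbreviation unif_law :: "real \<Rightarrow> real measure" where
  "unif_law B \<equiv> density lborel (\<lambda>x. ennreal (unif_dens B x))"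

abbreviation z_law :: "nat \<Rightarrow> real \<Rightarrow> (nat \<Rightarrow> real) measure" where
  "z_law d B \<equiv> PiM {..<d} (\<lambda>_. unif_law B)"

definition z_dens :: "nat \<Rightarrow> real \<Rightarrow> (nat \<Rightarrow> real) \<Rightarrow> real" where
  "z_dens d B z = (\<Prod>i<d. unif_dens B (z i))"

text \<open>The cut-off only matters off the support of \<open>z\<close>, where the conditional density must still be one.\<close>

definition clipped_dot :: "nat \<Rightarrow> real \<Rightarrow> (nat \<Rightarrow> real) \<Rightarrow> (nat \<Rightarrow> real) \<Rightarrow> real" where
  "clipped_dot d h \<theta> z = (if \<bar>dot d \<theta> z\<bar> \<le> h / 10 then dot d \<theta> z else 0)"

definition obs_law :: "nat \<Rightarrow> real \<Rightarrow> real \<Rightarrow> (nat \<Rightarrow> real) \<Rightarrow> obs measure" where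
  "obs_law d h B \<theta> = density (obs_base d)
     (\<lambda>(x, y, z). ennreal (1/2 * z_dens d B z * cond_dens h y (clipped_dot d h \<theta> z) x))"

lemma sets_lebesgue_vec [measurable_cong]: "sets (lebesgue_vec d) = sets (PiM {..<d} (\<lambda>_. borel))"
  unfolding lebesgue_vec_def by (intro sets_PiM_cong) auto

lemma space_lebesgue_vec: "space (lebesgue_vec d) = vecs d"
  by (simp add: lebesgue_vec_def vecs_def space_PiM)

lemma dot_measurable_vec [measurable]: "(\<lambda>z. dot d v z) \<in> borel_measurable (lebesgue_vec d)"
  unfolding dot_def by measurable

lemma clipped_dot_measurable [measurable]: "(\<lambda>z. clipped_dot d h \<theta> z) \<in> borel_measurable (lebesgue_vec d)"
  unfolding clipped_dot_def by measurable

lemma z_dens_measurable [measurable]: "z_dens d B \<in> borel_measurable (lebesgue_vec d)"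
  unfolding z_dens_def by measurable

lemma obs_y_measurable [measurable]: "(\<lambda>\<omega>. fst (snd \<omega>)) \<in> borel_measurable (obs_base d)"
proof -
  have "(\<lambda>y. y) \<in> borel_measurable (count_space {-1, 1 :: real})" by simp
  moreover have "(\<lambda>\<omega>. fst (snd \<omega>)) \<in> obs_base d \<rightarrow>\<^sub>M count_space {-1, 1}"
    unfolding obs_base_def by measurable
  ultimately show ?thesis by (rule measurable_compose[rotated])
qed

lemma obs_x_measurable [measurable]: "fst \<in> borel_measurable (obs_base d)"
  unfolding obs_base_def by measurable

lemma obs_z_measurable [measurable]: "(\<lambda>\<omega>. snd (snd \<omega>)) \<in> obs_base d \<rightarrow>\<^sub>M lebesgue_vec d"
  unfolding obs_base_def by measurable

lemma sigma_finite_lebesgue_vec: "sigma_finite_measure (lebesgue_vec d)"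
proof -
  interpret product_sigma_finite "\<lambda>_::nat. lborel :: real measure" by standard
  show ?thesis unfolding lebesgue_vec_def by (intro sigma_finite) auto
qed

lemma nn_integral_obs_base:
  assumes F [measurable]: "F \<in> borel_measurable (obs_base d)"
  shows "(\<integral>\<^sup>+\<omega>. F \<omega> \<partial>obs_base d) = (\<Sum>y\<in>{-1, 1}. \<integral>\<^sup>+z. \<integral>\<^sup>+x. F (x, y, z) \<partial>lborel \<partial>lebesgue_vec d)"
proof -
  interpret Z: sigma_finite_measure "lebesgue_vec d" by (rule sigma_finite_lebesgue_vec)
  interpret YZ: pair_sigma_finite "count_space {-1, 1 :: real}" "lebesgue_vec d"
    by (intro pair_sigma_finite.intro sigma_finite_measure_count_space_finite sigma_finite_lebesgue_vec) simp
  interpret XYZ: pair_sigma_finite "lborel :: real measure" "count_space {-1, 1 :: real} \<Otimes>\<^sub>M lebesgue_vec d"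
    by (intro pair_sigma_finite.intro lborel.sigma_finite_measure_axioms YZ.P.sigma_finite_measure_axioms)
  have F' [measurable]: "F \<in> borel_measurable (lborel \<Otimes>\<^sub>M (count_space {-1, 1} \<Otimes>\<^sub>M lebesgue_vec d))"
    using F by (simp add: obs_base_def)
  have "(\<integral>\<^sup>+\<omega>. F \<omega> \<partial>obs_base d) = (\<integral>\<^sup>+w. \<integral>\<^sup>+x. F (x, w) \<partial>lborel \<partial>(count_space {-1, 1} \<Otimes>\<^sub>M lebesgue_vec d))"
    unfolding obs_base_def by (intro XYZ.nn_integral_snd[symmetric] F')
  also have "\<dots> = (\<integral>\<^sup>+y. \<integral>\<^sup>+z. \<integral>\<^sup>+x. F (x, y, z) \<partial>lborel \<partial>lebesgue_vec d \<partial>count_space {-1, 1})"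
    by (intro Z.nn_integral_fst[symmetric]) measurable
  also have "\<dots> = (\<Sum>y\<in>{-1, 1}. \<integral>\<^sup>+z. \<integral>\<^sup>+x. F (x, y, z) \<partial>lborel \<partial>lebesgue_vec d)"
    by (intro nn_integral_count_space_finite) simp
  finally show ?thesis .
qed

text \<open>The bound on the 1-norm is the worst case of \<open>|\<theta> . z|\<close> over the
  cube: it makes the cut-off in \<open>clipped_dot\<close> inactive almost surely and puts every
  margin in the range where \<open>margin_sign\<close> holds.\<close>

locale threshold_model =
  fixes d :: nat and h B :: real and \<theta> :: "nat \<Rightarrow> real"
  assumes h: "0 < h" "h \<le> 1/2" and B: "0 < B" and \<theta>_small: "B * (\<Sum>i<d. \<bar>\<theta> i\<bar>) \<le> h / 10"
begin

sublocale iid_coordinates "unif_law B" B "B^2 / 3"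
  by (rule iid_coordinates_uniform[OF B])

lemma unif_dens_nonneg: "0 \<le> unif_dens B x" using B by (simp add: unif_dens_def)

lemma z_dens_nonneg: "0 \<le> z_dens d B z"
  unfolding z_dens_def by (intro prod_nonneg ballI unif_dens_nonneg)

lemma density_z_dens: "density (lebesgue_vec d) (\<lambda>z. ennreal (z_dens d B z)) = z_law d B"
proof -
  have "density (lebesgue_vec d) (\<lambda>z. \<Prod>i<d. ennreal (unif_dens B (z i))) = z_law d B"
    unfolding lebesgue_vec_def
    by (intro density_PiM) (auto intro: lborel.sigma_finite_measure_axioms U.sigma_finite_measure_axioms)
  then show ?thesis by (simp add: z_dens_def prod_ennreal unif_dens_nonneg)
qed

lemma clipped_small: "\<bar>clipped_dot d h u z\<bar> \<le> h / 10" using h by (simp add: clipped_dot_def)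

lemma clipped_le_1: "\<bar>clipped_dot d h u z\<bar> \<le> 1" using clipped_small[of u z] h by linarith

lemma clipped_eq: "AE z in z_law d B. clipped_dot d h \<theta> z = dot d \<theta> z"
  using iid_dot_bound[of d \<theta>] by eventually_elim (use \<theta>_small in \<open>auto simp: clipped_dot_def\<close>)

lemma cond_dens_clipped_nonneg: "y \<in> {-1, 1} \<Longrightarrow> 0 \<le> cond_dens h y (clipped_dot d h \<theta> z) x"
  by (rule cond_dens_nonneg[OF h clipped_small])

lemma cond_dens_obs_measurable [measurable]:
  "(\<lambda>(x, y, z). cond_dens h y (clipped_dot d h u z) x) \<in> borel_measurable (obs_base d)"
proof -
  have "(\<lambda>\<omega>. cond_dens h (fst (snd \<omega>)) (clipped_dot d h u (snd (snd \<omega>))) (fst \<omega>)) \<in> borel_measurable (obs_base d)"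
    by measurable
  then show ?thesis by (simp add: case_prod_beta)
qed

lemma obs_dens_measurable [measurable]:
  "(\<lambda>(x, y, z). ennreal (1/2 * z_dens d B z * cond_dens h y (clipped_dot d h u z) x)) \<in> borel_measurable (obs_base d)"
proof -
  have "(\<lambda>\<omega>. ennreal (1/2 * z_dens d B (snd (snd \<omega>)) * cond_dens h (fst (snd \<omega>)) (clipped_dot d h u (snd (snd \<omega>))) (fst \<omega>))) \<in> borel_measurable (obs_base d)"
    by measurable
  then show ?thesis by (simp add: case_prod_beta)
qed

lemma sets_obs_law [measurable_cong]: "sets (obs_law d h B u) = sets (obs_base d)"
  by (simp add: obs_law_def)

lemma space_obs_law: "space (obs_law d h B u) = UNIV \<times> {-1, 1} \<times> vecs d"
  by (simp add: obs_law_def obs_base_def space_pair_measure space_lebesgue_vec)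

text \<open>Stated for nonnegative integrands so that one formula, without integrability conditions
  on \<open>H\<close>, serves the total mass, the label probabilities, the risk and the second
  moment of the likelihood ratio.\<close>

lemma nn_integral_obs_law:
  assumes H [measurable]: "H \<in> borel_measurable (obs_base d)"
  shows "(\<integral>\<^sup>+\<omega>. H \<omega> \<partial>obs_law d h B \<theta>) = (\<Sum>y\<in>{-1, 1}. \<integral>\<^sup>+z. ennreal (1/2) *
    (\<integral>\<^sup>+x. ennreal (cond_dens h y (clipped_dot d h \<theta> z) x) * H (x, y, z) \<partial>lborel) \<partial>z_law d B)"
proof -
  define c where "c y z x = cond_dens h y (clipped_dot d h \<theta> z) x" for y z x
  have "(\<integral>\<^sup>+\<omega>. H \<omega> \<partial>obs_law d h B \<theta>) = (\<integral>\<^sup>+\<omega>. (\<lambda>(x, y, z). ennreal (1/2 * z_dens d B z * c y z x)) \<omega> * H \<omega> \<partial>obs_base d)"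
    unfolding obs_law_def c_def by (intro nn_integral_density) measurable
  also have "\<dots> = (\<Sum>y\<in>{-1, 1}. \<integral>\<^sup>+z. \<integral>\<^sup>+x. ennreal (1/2 * z_dens d B z * c y z x) * H (x, y, z) \<partial>lborel \<partial>lebesgue_vec d)"
    by (subst nn_integral_obs_base) (auto simp: c_def)
  also have "\<dots> = (\<Sum>y\<in>{-1, 1}. \<integral>\<^sup>+z. ennreal (1/2) * (\<integral>\<^sup>+x. ennreal (c y z x) * H (x, y, z) \<partial>lborel) \<partial>z_law d B)"
  proof (intro sum.cong refl)
    fix y :: real assume y: "y \<in> {-1, 1}"
    have [measurable]: "(\<lambda>(z, x). H (x, y, z)) \<in> borel_measurable (lebesgue_vec d \<Otimes>\<^sub>M lborel)"
    proof -
      have "(\<lambda>(z, x). (x, y, z)) \<in> lebesgue_vec d \<Otimes>\<^sub>M lborel \<rightarrow>\<^sub>M obs_base d"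
        unfolding obs_base_def case_prod_beta
        by (intro measurable_Pair measurable_snd measurable_fst measurable_const) (use y in simp)
      from measurable_compose[OF this H] show ?thesis by (simp add: case_prod_beta)
    qed
    have [measurable]: "(\<lambda>(z, x). c y z x) \<in> borel_measurable (lebesgue_vec d \<Otimes>\<^sub>M lborel)"
      unfolding c_def by measurable
    have G: "(\<lambda>z. ennreal (1/2) * (\<integral>\<^sup>+x. ennreal (c y z x) * H (x, y, z) \<partial>lborel)) \<in> borel_measurable (lebesgue_vec d)"
      by measurable
    have Hx: "(\<lambda>x. H (x, y, z)) \<in> borel_measurable lborel" if "z \<in> space (lebesgue_vec d)" for z
    proof -
      have "(\<lambda>x. (z, x)) \<in> lborel \<rightarrow>\<^sub>M lebesgue_vec d \<Otimes>\<^sub>M (lborel :: real measure)" using that by measurable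
      from measurable_compose[OF this, of "\<lambda>(z, x). H (x, y, z)" borel] show ?thesis by simp
    qed
    have cx: "(\<lambda>x. c y z x) \<in> borel_measurable lborel" for z unfolding c_def by measurable
    have "(\<integral>\<^sup>+z. \<integral>\<^sup>+x. ennreal (1/2 * z_dens d B z * c y z x) * H (x, y, z) \<partial>lborel \<partial>lebesgue_vec d)
      = (\<integral>\<^sup>+z. ennreal (z_dens d B z) * (ennreal (1/2) * (\<integral>\<^sup>+x. ennreal (c y z x) * H (x, y, z) \<partial>lborel)) \<partial>lebesgue_vec d)"
    proof (intro nn_integral_cong)
      fix z assume z: "z \<in> space (lebesgue_vec d)"
      note [measurable] = Hx[OF z] cx
      have "(\<integral>\<^sup>+x. ennreal (1/2 * z_dens d B z * c y z x) * H (x, y, z) \<partial>lborel)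
        = (\<integral>\<^sup>+x. (ennreal (z_dens d B z) * ennreal (1/2)) * (ennreal (c y z x) * H (x, y, z)) \<partial>lborel)"
      proof (intro nn_integral_cong)
        fix x
        have "ennreal (1/2 * z_dens d B z * c y z x) = ennreal ((z_dens d B z * (1/2)) * c y z x)"
          by (simp only: mult.commute)
        also have "\<dots> = ennreal (z_dens d B z * (1/2)) * ennreal (c y z x)"
          using cond_dens_clipped_nonneg[OF y, of z x] by (intro ennreal_mult'') (simp add: c_def)
        also have "ennreal (z_dens d B z * (1/2)) = ennreal (z_dens d B z) * ennreal (1/2)"
          by (intro ennreal_mult'') simp
        finally show "ennreal (1/2 * z_dens d B z * c y z x) * H (x, y, z)
          = (ennreal (z_dens d B z) * ennreal (1/2)) * (ennreal (c y z x) * H (x, y, z))"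
          by (simp only: mult.assoc)
      qed
      then show "(\<integral>\<^sup>+x. ennreal (1/2 * z_dens d B z * c y z x) * H (x, y, z) \<partial>lborel)
        = ennreal (z_dens d B z) * (ennreal (1/2) * (\<integral>\<^sup>+x. ennreal (c y z x) * H (x, y, z) \<partial>lborel))"
        by (subst (asm) nn_integral_cmult) (auto simp: mult.assoc)
    qed
    also have "\<dots> = (\<integral>\<^sup>+z. ennreal (1/2) * (\<integral>\<^sup>+x. ennreal (c y z x) * H (x, y, z) \<partial>lborel) \<partial>z_law d B)"
      unfolding density_z_dens[symmetric] using G by (intro nn_integral_density[symmetric]) auto
    finally show "(\<integral>\<^sup>+z. \<integral>\<^sup>+x. ennreal (1/2 * z_dens d B z * c y z x) * H (x, y, z) \<partial>lborel \<partial>lebesgue_vec d)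
      = (\<integral>\<^sup>+z. ennreal (1/2) * (\<integral>\<^sup>+x. ennreal (c y z x) * H (x, y, z) \<partial>lborel) \<partial>z_law d B)" .
  qed
  finally show ?thesis by (simp add: c_def)
qed

sublocale Z: prob_space "z_law d B" by (rule prob_space_iid)

lemma prob_space_obs_law: "prob_space (obs_law d h B \<theta>)"
proof (rule prob_spaceI)
  have "emeasure (obs_law d h B \<theta>) (space (obs_law d h B \<theta>)) = (\<integral>\<^sup>+\<omega>. 1 \<partial>obs_law d h B \<theta>)" by simp
  also have "\<dots> = (\<Sum>y\<in>{-1, 1 :: real}. ennreal (1/2))"
    by (subst nn_integral_obs_law, measurable, intro sum.cong refl)
       (simp add: cond_dens_nn_integral[OF h clipped_small] Z.emeasure_space_1)
  also have "\<dots> = ennreal (\<Sum>y\<in>{-1, 1 :: real}. 1/2)" by (intro sum_ennreal) auto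
  also have "\<dots> = 1" by simp
  finally show "emeasure (obs_law d h B \<theta>) (space (obs_law d h B \<theta>)) = 1" .
qed

lemma prob_Y_obs_law:
  assumes "y \<in> {-1, 1}"
  shows "prob_Y (obs_law d h B \<theta>) y = 1/2"
proof -
  let ?A = "{\<omega> \<in> space (obs_law d h B \<theta>). fst (snd \<omega>) = y}"
  have A: "?A \<in> sets (obs_law d h B \<theta>)" by measurable
  have "emeasure (obs_law d h B \<theta>) ?A = (\<integral>\<^sup>+\<omega>. indicator {y} (fst (snd \<omega>)) \<partial>obs_law d h B \<theta>)"
    unfolding nn_integral_indicator[OF A, symmetric]
    by (intro nn_integral_cong) (auto split: split_indicator)
  also have "\<dots> = (\<Sum>y'\<in>{-1, 1}. \<integral>\<^sup>+z. ennreal (1/2) * indicator {y} y' \<partial>z_law d B)"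
    by (subst nn_integral_obs_law, measurable)
       (intro sum.cong refl, simp add: nn_integral_multc cond_dens_nn_integral[OF h clipped_small])
  also have "\<dots> = (\<Sum>y'\<in>{-1, 1}. if y' = y then ennreal (1/2) else 0)"
    by (intro sum.cong refl) (simp add: Z.emeasure_space_1 indicator_def)
  also have "\<dots> = ennreal (1/2)"
    using assms by (subst sum.delta) auto
  finally have e: "emeasure (obs_law d h B \<theta>) ?A = ennreal (1/2)" .
  show ?thesis unfolding prob_Y_def measure_def e by (rule enn2real_ennreal) simp
qed

lemma cond_densities_obs_law:
  "cond_densities d (obs_law d h B \<theta>) (\<lambda>y z. cond_dens h y (clipped_dot d h \<theta> z)) (\<lambda>_. z_dens d B)"
proof -
  have "(\<integral>\<^sup>+z. ennreal (z_dens d B z) \<partial>lebesgue_vec d) = emeasure (z_law d B) (space (z_law d B))"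
    unfolding density_z_dens[symmetric] by (subst emeasure_density) (auto intro!: nn_integral_cong)
  also have "\<dots> = 1" using prob_space.emeasure_space_1[OF prob_space_iid] .
  finally have z: "(\<integral>\<^sup>+z. ennreal (z_dens d B z) \<partial>lebesgue_vec d) = 1" .
  note obs_law_def[of d h B \<theta>]
  also have "density (obs_base d) (\<lambda>(x, y, z). ennreal (1/2 * z_dens d B z * cond_dens h y (clipped_dot d h \<theta> z) x))
    = density (obs_base d) (\<lambda>(x, y, z). ennreal (prob_Y (obs_law d h B \<theta>) y * z_dens d B z * cond_dens h y (clipped_dot d h \<theta> z) x))"
  \<comment> \<open>The required density mentions \<open>prob_Y\<close> of the law itself. Its value
    1/2 is known only at the two labels, so the replacement is made on points of the base
    space.\<close>
  proof (rule density_cong)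
    show "AE \<omega> in obs_base d. (case \<omega> of (x, y, z) \<Rightarrow> ennreal (1/2 * z_dens d B z * cond_dens h y (clipped_dot d h \<theta> z) x)) =
      (case \<omega> of (x, y, z) \<Rightarrow> ennreal (prob_Y (obs_law d h B \<theta>) y * z_dens d B z * cond_dens h y (clipped_dot d h \<theta> z) x))"
    proof (rule AE_I2)
      fix \<omega> :: obs assume "\<omega> \<in> space (obs_base d)"
      then have "fst (snd \<omega>) \<in> {-1, 1}" by (auto simp: obs_base_def space_pair_measure)
      then show "(case \<omega> of (x, y, z) \<Rightarrow> ennreal (1/2 * z_dens d B z * cond_dens h y (clipped_dot d h \<theta> z) x)) =
        (case \<omega> of (x, y, z) \<Rightarrow> ennreal (prob_Y (obs_law d h B \<theta>) y * z_dens d B z * cond_dens h y (clipped_dot d h \<theta> z) x))"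
        by (simp only: case_prod_beta prob_Y_obs_law)
    qed
    have [measurable]: "(\<lambda>\<omega>. prob_Y P (fst (snd \<omega>))) \<in> borel_measurable (obs_base d)" for P :: "obs measure"
    proof -
      have "(\<lambda>y. prob_Y P y) \<in> borel_measurable (count_space {-1, 1 :: real})" by simp
      moreover have "(\<lambda>\<omega>. fst (snd \<omega>)) \<in> obs_base d \<rightarrow>\<^sub>M count_space {-1, 1}"
        unfolding obs_base_def by measurable
      ultimately show ?thesis by (rule measurable_compose[rotated])
    qed
    have "(\<lambda>\<omega>. ennreal (prob_Y P (fst (snd \<omega>)) * z_dens d B (snd (snd \<omega>)) * cond_dens h (fst (snd \<omega>)) (clipped_dot d h \<theta> (snd (snd \<omega>))) (fst \<omega>))) \<in> borel_measurable (obs_base d)" for P :: "obs measure"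
      by measurable
    then show "(\<lambda>(x, y, z). ennreal (prob_Y (obs_law d h B \<theta>) y * z_dens d B z * cond_dens h y (clipped_dot d h \<theta> z) x)) \<in> borel_measurable (obs_base d)"
      by (simp add: case_prod_beta)
  qed measurable
  finally show ?thesis unfolding cond_densities_def
    using z cond_dens_clipped_nonneg z_dens_nonneg cond_dens_nn_integral[OF h clipped_small] by auto
qed

lemma obs_law_mem: "obs_law d h B \<theta> \<in> obs_laws d"
  unfolding obs_laws_def using prob_space_obs_law sets_obs_law by (simp add: prob_Y_obs_law)

end

section \<open>Risk, gradient and Hessian\<close>

lemma lq_norm_2_sq: "(lq_norm d 2 w)^2 = (\<Sum>i<d. (w i)^2)"
  unfolding lq_norm_2 L2_set_def by (simp add: sum_nonneg)

lemma lq_norm_2_nonneg: "0 \<le> lq_norm d 2 w" by (simp add: lq_norm_2)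

lemma has_gradientI_quadratic:
  assumes "\<And>u. u \<in> vecs d \<Longrightarrow>
    \<bar>F u - F t - dot d g (\<lambda>i. u i - t i)\<bar> \<le> K * (lq_norm d 2 (\<lambda>i. u i - t i))^2"
  shows "has_gradient d F g t"
  unfolding has_gradient_def
proof (intro allI impI)
  fix e :: real assume e: "e > 0"
  show "\<exists>\<delta>>0. \<forall>u\<in>vecs d. lq_norm d 2 (\<lambda>i. u i - t i) < \<delta> \<longrightarrow>
        \<bar>F u - F t - dot d g (\<lambda>i. u i - t i)\<bar> \<le> e * lq_norm d 2 (\<lambda>i. u i - t i)"
  proof (intro exI[of _ "e / (\<bar>K\<bar> + 1)"] conjI ballI impI)
    show "0 < e / (\<bar>K\<bar> + 1)" using e by simp
    fix u assume u: "u \<in> vecs d" and lt: "lq_norm d 2 (\<lambda>i. u i - t i) < e / (\<bar>K\<bar> + 1)"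
    define n where "n = lq_norm d 2 (\<lambda>i. u i - t i)"
    have n: "0 \<le> n" by (simp add: n_def lq_norm_2_nonneg)
    have "\<bar>F u - F t - dot d g (\<lambda>i. u i - t i)\<bar> \<le> K * n^2" using assms[OF u] by (simp add: n_def)
    also have "\<dots> \<le> (\<bar>K\<bar> + 1) * n^2" by (intro mult_right_mono) auto
    also have "\<dots> = ((\<bar>K\<bar> + 1) * n) * n" by (simp add: power2_eq_square)
    also have "\<dots> \<le> e * n" using lt n by (intro mult_right_mono) (simp_all add: n_def field_simps)
    finally show "\<bar>F u - F t - dot d g (\<lambda>i. u i - t i)\<bar> \<le> e * lq_norm d 2 (\<lambda>i. u i - t i)"
      by (simp add: n_def)
  qed
qed

lemma L01_measurable [measurable]: "L01 \<in> borel_measurable borel"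
  unfolding L01_def[abs_def] by measurable

context threshold_model
begin

lemma dot_measurable_z_law [measurable]: "(\<lambda>z. dot d v z) \<in> borel_measurable (z_law d B)"
  by (rule dot_measurable)

lemma clipped_dot_measurable_z_law [measurable]: "(\<lambda>z. clipped_dot d h u z) \<in> borel_measurable (z_law d B)"
  unfolding clipped_dot_def by measurable

lemma component_measurable_z_law: "i < d \<Longrightarrow> (\<lambda>z. z i) \<in> borel_measurable (z_law d B)"
  using iid_component_integrable by (rule borel_measurable_integrable)

lemma gap_integrable:
  assumes "a \<in> borel_measurable (z_law d B)" and "AE z in z_law d B. \<bar>a z\<bar> \<le> A"
  shows "integrable (z_law d B) (\<lambda>z. a z * cdf_gap k h (clipped_dot d h \<theta> z) (dot d u z))"
proof -
  note [measurable] = assms(1)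
  obtain M where M: "M > 0" "\<And>t x. \<bar>t\<bar> \<le> 1 \<Longrightarrow> \<bar>cdf_gap k h t x\<bar> \<le> M"
    using cdf_gap_bounded[OF h(1)] by blast
  show ?thesis
  proof (rule integrable_bounded_iid)
    show "AE z in z_law d B. \<bar>a z * cdf_gap k h (clipped_dot d h \<theta> z) (dot d u z)\<bar> \<le> A * M"
      using assms(2)
    proof eventually_elim
      case (elim z)
      then show ?case unfolding abs_mult using M(2)[OF clipped_le_1] by (intro mult_mono) auto
    qed
  qed measurable
qed

lemma gap_integrable1:
  "integrable (z_law d B) (\<lambda>z. cdf_gap k h (clipped_dot d h \<theta> z) (dot d u z))"
  using gap_integrable[of "\<lambda>_. 1" 1 k u] by simp

text \<open>The weight \<open>1 / prob_Y\<close> is 2 and cancels the label probability 1/2, so each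
  \<open>z\<close> contributes the unweighted sum of its two conditional error probabilities, which
  is \<open>misclassification_nn_integral\<close> at threshold \<open>u . z\<close>.\<close>

lemma risk_obs_law:
  "risk d (obs_law d h B \<theta>) u = 1 + (\<integral>z. cdf_gap 0 h (clipped_dot d h \<theta> z) (dot d u z) \<partial>z_law d B)"
proof -
  let ?H = "\<lambda>\<omega>. 2 * L01 (fst (snd \<omega>) * (fst \<omega> - dot d u (snd (snd \<omega>))))"
  have L: "0 \<le> L01 v" for v by (simp add: L01_def sgn_real_def)
  have [measurable]: "?H \<in> borel_measurable (obs_base d)" by measurable
  have Y: "fst (snd \<omega>) \<in> {-1, 1}" if "\<omega> \<in> space (obs_law d h B \<theta>)" for \<omega>
    using that by (auto simp: space_obs_law)
  have "risk d (obs_law d h B \<theta>) u = (\<integral>\<omega>. ?H \<omega> \<partial>obs_law d h B \<theta>)"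
    unfolding risk_def case_prod_beta
    using Y by (intro Bochner_Integration.integral_cong refl) (simp add: prob_Y_obs_law)
  also have "\<dots> = enn2real (\<integral>\<^sup>+\<omega>. ennreal (?H \<omega>) \<partial>obs_law d h B \<theta>)"
    using L by (intro integral_eq_nn_integral) auto
  also have "(\<integral>\<^sup>+\<omega>. ennreal (?H \<omega>) \<partial>obs_law d h B \<theta>) = (\<Sum>y\<in>{-1, 1}. \<integral>\<^sup>+z. (\<integral>\<^sup>+x. ennreal (L01 (y * (x - dot d u z)) * cond_dens h y (clipped_dot d h \<theta> z) x) \<partial>lborel) \<partial>z_law d B)"
  proof (subst nn_integral_obs_law, measurable, intro sum.cong refl nn_integral_cong)
    fix y :: real and z assume y: "y \<in> {-1, 1}"
    have "(\<integral>\<^sup>+x. ennreal (cond_dens h y (clipped_dot d h \<theta> z) x) * ennreal (?H (x, y, z)) \<partial>lborel)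
      = (\<integral>\<^sup>+x. ennreal 2 * ennreal (L01 (y * (x - dot d u z)) * cond_dens h y (clipped_dot d h \<theta> z) x) \<partial>lborel)"
    proof (intro nn_integral_cong)
      fix x
      have c: "0 \<le> cond_dens h y (clipped_dot d h \<theta> z) x" by (rule cond_dens_clipped_nonneg[OF y])
      have "ennreal (cond_dens h y (clipped_dot d h \<theta> z) x) * ennreal (?H (x, y, z))
        = ennreal (cond_dens h y (clipped_dot d h \<theta> z) x * ?H (x, y, z))"
        using L by (intro ennreal_mult''[symmetric]) simp
      also have "cond_dens h y (clipped_dot d h \<theta> z) x * ?H (x, y, z) = 2 * (L01 (y * (x - dot d u z)) * cond_dens h y (clipped_dot d h \<theta> z) x)"
        by simp
      also have "ennreal \<dots> = ennreal 2 * ennreal (L01 (y * (x - dot d u z)) * cond_dens h y (clipped_dot d h \<theta> z) x)"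
        using L c by (intro ennreal_mult'') simp
      finally show "ennreal (cond_dens h y (clipped_dot d h \<theta> z) x) * ennreal (?H (x, y, z)) = \<dots>" .
    qed
    also have "\<dots> = ennreal 2 * (\<integral>\<^sup>+x. ennreal (L01 (y * (x - dot d u z)) * cond_dens h y (clipped_dot d h \<theta> z) x) \<partial>lborel)"
      by (intro nn_integral_cmult) measurable
    finally have "ennreal (1/2) * (\<integral>\<^sup>+x. ennreal (cond_dens h y (clipped_dot d h \<theta> z) x) * ennreal (?H (x, y, z)) \<partial>lborel)
      = (ennreal (1/2) * ennreal 2) * (\<integral>\<^sup>+x. ennreal (L01 (y * (x - dot d u z)) * cond_dens h y (clipped_dot d h \<theta> z) x) \<partial>lborel)"
      by (simp only: mult.assoc)
    moreover have "ennreal (1/2) * ennreal 2 = 1"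
      by (subst ennreal_mult''[symmetric]) auto
    ultimately show "ennreal (1/2) * (\<integral>\<^sup>+x. ennreal (cond_dens h y (clipped_dot d h \<theta> z) x) * ennreal (?H (x, y, z)) \<partial>lborel)
      = (\<integral>\<^sup>+x. ennreal (L01 (y * (x - dot d u z)) * cond_dens h y (clipped_dot d h \<theta> z) x) \<partial>lborel)"
      by (simp only: mult_1_left)
  qed
  also have "\<dots> = (\<integral>\<^sup>+z. (\<integral>\<^sup>+x. ennreal (L01 (x - dot d u z) * cond_dens h 1 (clipped_dot d h \<theta> z) x) \<partial>lborel)
      + (\<integral>\<^sup>+x. ennreal (L01 (- (x - dot d u z)) * cond_dens h (-1) (clipped_dot d h \<theta> z) x) \<partial>lborel) \<partial>z_law d B)"
    by (subst nn_integral_add) (simp_all add: add.commute, measurable)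
  also have "\<dots> = (\<integral>\<^sup>+z. ennreal (1 + cdf_gap 0 h (clipped_dot d h \<theta> z) (dot d u z)) \<partial>z_law d B)"
    by (intro nn_integral_cong misclassification_nn_integral(1)[OF h clipped_small])
  also have "\<dots> = ennreal (\<integral>z. 1 + cdf_gap 0 h (clipped_dot d h \<theta> z) (dot d u z) \<partial>z_law d B)"
    using gap_integrable1 misclassification_nn_integral(2)[OF h clipped_small]
    by (intro nn_integral_eq_integral Bochner_Integration.integrable_add Z.integrable_const AE_I2)
  also have "enn2real \<dots> = (\<integral>z. 1 + cdf_gap 0 h (clipped_dot d h \<theta> z) (dot d u z) \<partial>z_law d B)"
    using misclassification_nn_integral(2)[OF h clipped_small]
    by (intro enn2real_ennreal integral_nonneg_AE AE_I2)
  also have "\<dots> = 1 + (\<integral>z. cdf_gap 0 h (clipped_dot d h \<theta> z) (dot d u z) \<partial>z_law d B)"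
    using gap_integrable1 by (simp add: Z.prob_space)
  finally show ?thesis .
qed

text \<open>For almost every \<open>z\<close> the integrand is strictly smaller at
  \<open>\<theta>\<close> unless \<open>u . z = \<theta> . z\<close>. Equal risks would therefore
  make \<open>(u - \<theta>) . z\<close> vanish almost surely, but its second moment is
  \<open>B^2 / 3\<close> times the squared 2-norm of \<open>u - \<theta>\<close>.\<close>

lemma risk_less:
  assumes "u \<in> vecs d" "\<theta> \<in> vecs d" "u \<noteq> \<theta>"
  shows "risk d (obs_law d h B \<theta>) \<theta> < risk d (obs_law d h B \<theta>) u"
proof -
  let ?g = "\<lambda>u z. cdf_gap 0 h (clipped_dot d h \<theta> z) (dot d u z)"
  have int: "integrable (z_law d B) (\<lambda>z. ?g u z - ?g \<theta> z)"
    by (intro Bochner_Integration.integrable_diff gap_integrable1)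
  have eq: "risk d (obs_law d h B \<theta>) u - risk d (obs_law d h B \<theta>) \<theta> = (\<integral>z. ?g u z - ?g \<theta> z \<partial>z_law d B)"
    by (simp add: risk_obs_law gap_integrable1)
  have strict: "?g \<theta> z < ?g u z" if "clipped_dot d h \<theta> z = dot d \<theta> z" "dot d u z \<noteq> dot d \<theta> z" for z
    using cdf_gap_minimum[OF h clipped_small[of \<theta> z], of "dot d u z"] that by simp
  have nonneg: "AE z in z_law d B. 0 \<le> ?g u z - ?g \<theta> z"
    using clipped_eq
  proof eventually_elim
    case (elim z)
    then show ?case using strict[of z] by (cases "dot d u z = dot d \<theta> z") auto
  qed
  have "(\<integral>z. ?g u z - ?g \<theta> z \<partial>z_law d B) \<noteq> 0"
  proof
    assume "(\<integral>z. ?g u z - ?g \<theta> z \<partial>z_law d B) = 0"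
    then have "AE z in z_law d B. ?g u z - ?g \<theta> z = 0"
      using integral_nonneg_eq_0_iff_AE[OF int nonneg] by simp
    with clipped_eq have "AE z in z_law d B. (dot d (\<lambda>i. u i - \<theta> i) z)^2 = 0"
    proof eventually_elim
      case (elim z)
      then have "dot d u z = dot d \<theta> z" using strict[of z] by auto
      then show ?case by (simp add: dot_def left_diff_distrib sum_subtractf)
    qed
    then have "(\<integral>z. (dot d (\<lambda>i. u i - \<theta> i) z)^2 \<partial>z_law d B) = (\<integral>z. 0 \<partial>z_law d B)"
      by (intro integral_cong_AE) auto
    then have "B^2 / 3 * (\<Sum>i<d. (u i - \<theta> i)^2) = 0" by (simp add: iid_dot_second_moment)
    then have "(\<Sum>i<d. (u i - \<theta> i)^2) = 0" using B by simp
    then have "\<forall>i<d. u i = \<theta> i" by (subst (asm) sum_nonneg_eq_0_iff) auto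
    then have "u = \<theta>" using PiE_ext[of u "{..<d}" "\<lambda>_. UNIV" \<theta>] assms(1,2) by (auto simp: vecs_def)
    with assms(3) show False by simp
  qed
  moreover have "0 \<le> (\<integral>z. ?g u z - ?g \<theta> z \<partial>z_law d B)" by (rule integral_nonneg_AE[OF nonneg])
  ultimately show ?thesis using eq by linarith
qed

lemma unique_risk_minimizer_obs_law:
  assumes "\<theta> \<in> vecs d"
  shows "unique_risk_minimizer d (obs_law d h B \<theta>) \<theta>"
  unfolding unique_risk_minimizer_def is_arg_min_def
proof (intro conjI allI impI assms)
  show "\<not> (\<exists>y. y \<in> vecs d \<and> risk d (obs_law d h B \<theta>) y < risk d (obs_law d h B \<theta>) \<theta>)"
    using risk_less[OF _ assms] by (metis less_asym less_irrefl)
  show "u = \<theta>" if "u \<in> vecs d \<and> \<not> (\<exists>y. y \<in> vecs d \<and> risk d (obs_law d h B \<theta>) y < risk d (obs_law d h B \<theta>) u)" for u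
    using that risk_less[OF _ assms, of u] assms by blast
qed

text \<open>Differentiation under the integral sign, for the gradient (\<open>a = 1\<close>) and the Hessian (\<open>a = z\<^sub>i\<close>).\<close>

lemma gap_integral_has_gradient:
  assumes a: "a \<in> borel_measurable (z_law d B)" and A: "AE z in z_law d B. \<bar>a z\<bar> \<le> A"
  shows "has_gradient d (\<lambda>u. \<integral>z. a z * cdf_gap k h (clipped_dot d h \<theta> z) (dot d u z) \<partial>z_law d B)
    (\<lambda>i. \<integral>z. a z * z i * cdf_gap (Suc k) h (clipped_dot d h \<theta> z) (dot d u z) \<partial>z_law d B) u"
proof -
  note [measurable] = a
  obtain M where M: "M > 0" "\<And>t x. \<bar>t\<bar> \<le> 1 \<Longrightarrow> \<bar>cdf_gap (Suc (Suc k)) h t x\<bar> \<le> M"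
    using cdf_gap_bounded[OF h(1)] by blast
  have "\<not> \<not> (0 \<le> A)"
  proof
    assume n: "\<not> 0 \<le> A"
    have "AE z in z_law d B. False" using A by eventually_elim (use n in auto)
    then show False by simp
  qed
  then have A0: "0 \<le> A" by simp
  let ?c = "\<lambda>k u z. cdf_gap k h (clipped_dot d h \<theta> z) (dot d u z)"
  have ai: "AE z in z_law d B. \<bar>a z * z i\<bar> \<le> A * B" if "i < d" for i
    using A iid_bounded[of d] by eventually_elim (use that A0 in \<open>auto simp: abs_mult intro!: mult_mono\<close>)
  have aim: "(\<lambda>z. a z * z i) \<in> borel_measurable (z_law d B)" if "i < d" for i
    using a component_measurable_z_law[OF that] by measurable
  show ?thesis
  proof (rule has_gradientI_quadratic)
    fix v assume "v \<in> vecs d"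
    define w where "w = (\<lambda>i. v i - u i)"
    have lin: "(\<Sum>i<d. w i * (x * z i * y)) = x * dot d w z * y" for x y :: real and z
      by (simp add: dot_def sum_distrib_left sum_distrib_right mult_ac)
    have dw: "dot d v z - dot d u z = dot d w z" for z
      by (simp add: w_def dot_def left_diff_distrib sum_subtractf)
    have intS: "integrable (z_law d B) (\<lambda>z. a z * z i * ?c (Suc k) u z)" if "i < d" for i
      by (rule gap_integrable[OF aim[OF that] ai[OF that]])
    have int0: "integrable (z_law d B) (\<lambda>z. a z * ?c k u z)" for u by (rule gap_integrable[OF a A])
    have int1: "integrable (z_law d B) (\<lambda>z. a z * dot d w z * ?c (Suc k) u z)"
    proof -
      have "integrable (z_law d B) (\<lambda>z. \<Sum>i<d. w i * (a z * z i * ?c (Suc k) u z))"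
        using intS by (intro Bochner_Integration.integrable_sum integrable_mult_right) auto
      then show ?thesis by (simp only: lin)
    qed
    have int2: "integrable (z_law d B) (\<lambda>z. a z * ?c k v z - a z * ?c k u z - a z * dot d w z * ?c (Suc k) u z)"
      by (rule Bochner_Integration.integrable_diff[OF Bochner_Integration.integrable_diff[OF int0 int0] int1])
    have "dot d (\<lambda>i. \<integral>z. a z * z i * ?c (Suc k) u z \<partial>z_law d B) w
      = (\<Sum>i<d. \<integral>z. w i * (a z * z i * ?c (Suc k) u z) \<partial>z_law d B)"
      by (subst dot_def) (simp add: mult.commute)
    also have "\<dots> = (\<integral>z. (\<Sum>i<d. w i * (a z * z i * ?c (Suc k) u z)) \<partial>z_law d B)"
      using intS by (intro Bochner_Integration.integral_sum[symmetric] integrable_mult_right) auto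
    also have "\<dots> = (\<integral>z. a z * dot d w z * ?c (Suc k) u z \<partial>z_law d B)"
      by (simp only: lin)
    finally have grad: "dot d (\<lambda>i. \<integral>z. a z * z i * ?c (Suc k) u z \<partial>z_law d B) w
      = (\<integral>z. a z * dot d w z * ?c (Suc k) u z \<partial>z_law d B)" .
    define R where "R z = a z * ?c k v z - a z * ?c k u z - a z * dot d w z * ?c (Suc k) u z" for z
    have intR: "integrable (z_law d B) R" unfolding R_def by (rule int2)
    have R_le: "AE z in z_law d B. \<bar>R z\<bar> \<le> A * M * (dot d w z)^2"
      using A
    proof eventually_elim
      case (elim z)
      have eq: "R z = a z * (?c k v z - ?c k u z - ?c (Suc k) u z * (dot d v z - dot d u z))"
        unfolding R_def dw by (simp only: right_diff_distrib mult_ac)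
      have "\<bar>?c k v z - ?c k u z - ?c (Suc k) u z * (dot d v z - dot d u z)\<bar> \<le> M * (dot d v z - dot d u z)^2"
        by (rule taylor_remainder_bound[OF cdf_gap_Suc[OF h(1)] cdf_gap_Suc[OF h(1)] M(2)[OF clipped_le_1]])
      then have "\<bar>R z\<bar> \<le> A * (M * (dot d v z - dot d u z)^2)"
        unfolding eq abs_mult using elim A0 by (intro mult_mono) auto
      then show ?case by (simp add: dw mult.assoc)
    qed
    have "(\<integral>z. a z * ?c k v z \<partial>z_law d B) - (\<integral>z. a z * ?c k u z \<partial>z_law d B)
        - dot d (\<lambda>i. \<integral>z. a z * z i * ?c (Suc k) u z \<partial>z_law d B) w = (\<integral>z. R z \<partial>z_law d B)"
      unfolding grad R_def
      by (simp only: Bochner_Integration.integral_diff Bochner_Integration.integrable_diff int0 int1)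
    then have "\<bar>(\<integral>z. a z * ?c k v z \<partial>z_law d B) - (\<integral>z. a z * ?c k u z \<partial>z_law d B)
        - dot d (\<lambda>i. \<integral>z. a z * z i * ?c (Suc k) u z \<partial>z_law d B) w\<bar> \<le> (\<integral>z. \<bar>R z\<bar> \<partial>z_law d B)"
      using integral_abs_bound[of "z_law d B" R] by (simp only:)
    also have "\<dots> \<le> (\<integral>z. A * M * (dot d w z)^2 \<partial>z_law d B)"
    proof (rule integral_mono_AE[OF integrable_abs[OF intR] _ R_le])
      show "integrable (z_law d B) (\<lambda>z. A * M * (dot d w z)^2)"
        using iid_dot_sq_integrable[of d w w] by (simp add: power2_eq_square)
    qed
    also have "\<dots> = A * M * (B^2 / 3) * (lq_norm d 2 w)^2"
      by (simp add: iid_dot_second_moment lq_norm_2_sq)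
    finally show "\<bar>(\<integral>z. a z * ?c k v z \<partial>z_law d B) - (\<integral>z. a z * ?c k u z \<partial>z_law d B)
        - dot d (\<lambda>i. \<integral>z. a z * z i * ?c (Suc k) u z \<partial>z_law d B) (\<lambda>i. v i - u i)\<bar>
      \<le> A * M * (B^2 / 3) * (lq_norm d 2 (\<lambda>i. v i - u i))^2" by (simp add: w_def)
  qed
qed

definition risk_hessian :: "real mat" where
  "risk_hessian = mat d d (\<lambda>(i, j). \<integral>z. z i * z j * cdf_gap 2 h (clipped_dot d h \<theta> z) (dot d \<theta> z) \<partial>z_law d B)"

lemma has_gradient_cong:
  assumes "\<And>u. F u = c + G u" "\<And>i. i < d \<Longrightarrow> g i = g' i" "has_gradient d G g' t"
  shows "has_gradient d F g t"
proof -
  have "dot d g w = dot d g' w" for w unfolding dot_def using assms(2) by (intro sum.cong) auto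
  then show ?thesis using assms(3) by (simp add: has_gradient_def assms(1))
qed

lemma has_hessian_obs_law: "has_hessian d (risk d (obs_law d h B \<theta>)) risk_hessian \<theta>"
proof -
  define G where "G i u = (\<integral>z. z i * cdf_gap 1 h (clipped_dot d h \<theta> z) (dot d u z) \<partial>z_law d B)" for i u
  have "has_gradient d (risk d (obs_law d h B \<theta>)) (\<lambda>i. G i u) u" for u
    by (rule has_gradient_cong[OF _ _ gap_integral_has_gradient[of "\<lambda>_. 1" 1 0 u]])
       (simp_all add: risk_obs_law G_def)
  moreover have "has_gradient d (G i) (\<lambda>j. risk_hessian $$ (i, j)) \<theta>" if i: "i < d" for i
  proof (rule has_gradient_cong[OF _ _ gap_integral_has_gradient[of "\<lambda>z. z i" B 1 \<theta>]])
    show "G i u = 0 + (\<integral>z. z i * cdf_gap 1 h (clipped_dot d h \<theta> z) (dot d u z) \<partial>z_law d B)" for u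
      by (simp add: G_def)
    show "risk_hessian $$ (i, j) = (\<integral>z. z i * z j * cdf_gap (Suc 1) h (clipped_dot d h \<theta> z) (dot d \<theta> z) \<partial>z_law d B)" if "j < d" for j
      using i that by (simp add: risk_hessian_def numeral_2_eq_2)
    show "AE z in z_law d B. \<bar>z i\<bar> \<le> B" using iid_bounded[of d] by eventually_elim (use i in auto)
  qed (use component_measurable_z_law[OF i] in auto)
  moreover have "risk_hessian \<in> carrier_mat d d" by (simp add: risk_hessian_def)
  \<comment> \<open>The gradient exists at every point, so any radius serves as the neighbourhood
    required by \<open>has_hessian\<close>.\<close>
  moreover have "(0 :: real) < 1" by simp
  ultimately show ?thesis unfolding has_hessian_def by blast
qed

text \<open>The quadratic form is the mean of \<open>(v . z)^2\<close> times the curvature of the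
  gap at its centre, which is at least \<open>c\<^sub>0 / 2\<close> for almost every
  \<open>z\<close>. The bound depends on \<open>B\<close> alone, not on \<open>h\<close>,
  \<open>\<theta>\<close> or \<open>d\<close>.\<close>

lemma lambda_min_risk_hessian:
  assumes "0 < d"
  shows "c\<^sub>0 / 2 * (B^2 / 3) \<le> lambda_min risk_hessian"
proof (rule lambda_min_ge[OF _ assms])
  show "risk_hessian \<in> carrier_mat d d" by (simp add: risk_hessian_def)
  show "risk_hessian $$ (i, j) = risk_hessian $$ (j, i)" if "i < d" "j < d" for i j
    using that by (simp add: risk_hessian_def mult_ac)
  fix v :: "nat \<Rightarrow> real"
  let ?c = "\<lambda>z. cdf_gap 2 h (clipped_dot d h \<theta> z) (dot d \<theta> z)"
  have m: "(\<lambda>z. z i * z j) \<in> borel_measurable (z_law d B)" if "i < d" "j < d" for i j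
    using that[THEN component_measurable_z_law] by measurable
  have b: "AE z in z_law d B. \<bar>z i * z j\<bar> \<le> B * B" if "i < d" "j < d" for i j
    using iid_bounded[of d] by eventually_elim (use that B in \<open>auto simp: abs_mult intro!: mult_mono\<close>)
  have int: "integrable (z_law d B) (\<lambda>z. z i * z j * ?c z)" if "i < d" "j < d" for i j
    by (rule gap_integrable[OF m[OF that] b[OF that]])
  have expand: "(\<Sum>i<d. \<Sum>j<d. (v i * v j) * (z i * z j * c)) = (dot d v z)^2 * c" for z and c :: real
  proof -
    have "(dot d v z)^2 = (\<Sum>i<d. \<Sum>j<d. (v i * z i) * (v j * z j))"
      unfolding dot_def power2_eq_square by (rule sum_product)
    then show ?thesis by (simp only: sum_distrib_left mult_ac)
  qed
  have int2: "integrable (z_law d B) (\<lambda>z. (dot d v z)^2 * ?c z)"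
    unfolding expand[symmetric] using int
    by (intro Bochner_Integration.integrable_sum integrable_mult_right) auto
  have "c\<^sub>0 / 2 * (B^2 / 3) * (\<Sum>i<d. (v i)^2) = (\<integral>z. (dot d v z)^2 * (c\<^sub>0 / 2) \<partial>z_law d B)"
    by (simp add: iid_dot_second_moment)
  also have "\<dots> \<le> (\<integral>z. (dot d v z)^2 * ?c z \<partial>z_law d B)"
  proof (rule integral_mono_AE[OF _ int2])
    show "integrable (z_law d B) (\<lambda>z. (dot d v z)^2 * (c\<^sub>0 / 2))"
      using iid_dot_sq_integrable[of d v v] by (simp add: power2_eq_square)
    show "AE z in z_law d B. (dot d v z)^2 * (c\<^sub>0 / 2) \<le> (dot d v z)^2 * ?c z"
      using clipped_eq
    proof eventually_elim
      case (elim z)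
      then show ?case using cdf_gap_2_center_ge[OF h clipped_small[of \<theta> z]]
        by (intro mult_left_mono) auto
    qed
  qed
  also have "\<dots> = (\<integral>z. (\<Sum>i<d. \<Sum>j<d. (v i * v j) * (z i * z j * ?c z)) \<partial>z_law d B)"
    by (simp only: expand)
  also have "\<dots> = (\<Sum>i<d. \<integral>z. (\<Sum>j<d. (v i * v j) * (z i * z j * ?c z)) \<partial>z_law d B)"
    using int by (intro Bochner_Integration.integral_sum Bochner_Integration.integrable_sum integrable_mult_right) auto
  also have "\<dots> = (\<Sum>i<d. \<Sum>j<d. \<integral>z. (v i * v j) * (z i * z j * ?c z) \<partial>z_law d B)"
    using int by (intro sum.cong refl Bochner_Integration.integral_sum integrable_mult_right) auto
  also have "\<dots> = (\<Sum>i<d. \<Sum>j<d. v i * v j * risk_hessian $$ (i, j))"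
    by (intro sum.cong refl) (simp add: risk_hessian_def)
  finally show "c\<^sub>0 / 2 * (B^2 / 3) * (\<Sum>i<d. (v i)^2) \<le> (\<Sum>i<d. \<Sum>j<d. v i * v j * risk_hessian $$ (i, j))" .
qed

end

section \<open>Smoothness and likelihood ratios\<close>

context threshold_model
begin

text \<open>Since \<open>E (v \<bullet> Z) = 0\<close>, the unperturbed density at \<open>t = 0\<close> may be subtracted; what remains is of order \<open>t = \<theta> \<bullet> z\<close>.\<close>

lemma smoothness_integral:
  assumes y: "y \<in> {-1, 1}"
    and K: "\<And>t \<Delta>. \<bar>(cond_dens_deriv l h y t (\<Delta> + t) - cond_dens_deriv l h y t t)
      - (cond_dens_deriv l h y 0 \<Delta> - cond_dens_deriv l h y 0 0)\<bar> \<le> c * \<bar>t\<bar> * \<bar>\<Delta>\<bar> powr r" and c: "0 \<le> c"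
  defines "H \<equiv> \<lambda>v \<Delta> z. dot d v z * (cond_dens_deriv l h y (clipped_dot d h \<theta> z) (\<Delta> + dot d \<theta> z)
      - cond_dens_deriv l h y (clipped_dot d h \<theta> z) (dot d \<theta> z))"
  shows "integrable (z_law d B) (H v \<Delta>)"
    and "\<bar>\<integral>z. H v \<Delta> z \<partial>z_law d B\<bar> \<le> c * (B^2 / 3) * lq_norm d 2 \<theta> * lq_norm d 2 v * \<bar>\<Delta>\<bar> powr r"
proof -
  define q where "q = cond_dens_deriv l h y 0 \<Delta> - cond_dens_deriv l h y 0 0"
  define R where "R z = H v \<Delta> z - dot d v z * q" for z
  have [measurable]: "H v \<Delta> \<in> borel_measurable (z_law d B)" unfolding H_def by measurable
  have [measurable]: "R \<in> borel_measurable (z_law d B)" unfolding R_def by measurable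
  have R_le: "AE z in z_law d B. \<bar>R z\<bar> \<le> c * \<bar>\<Delta>\<bar> powr r * (\<bar>dot d v z\<bar> * \<bar>dot d \<theta> z\<bar>)"
    using clipped_eq
  proof eventually_elim
    case (elim z)
    have "R z = dot d v z * ((cond_dens_deriv l h y (dot d \<theta> z) (\<Delta> + dot d \<theta> z)
      - cond_dens_deriv l h y (dot d \<theta> z) (dot d \<theta> z)) - q)"
      unfolding R_def H_def elim by (simp only: right_diff_distrib)
    then have "\<bar>R z\<bar> = \<bar>dot d v z\<bar> * \<bar>(cond_dens_deriv l h y (dot d \<theta> z) (\<Delta> + dot d \<theta> z)
      - cond_dens_deriv l h y (dot d \<theta> z) (dot d \<theta> z)) - q\<bar>" by (simp only: abs_mult)
    also have "\<dots> \<le> \<bar>dot d v z\<bar> * (c * \<bar>dot d \<theta> z\<bar> * \<bar>\<Delta>\<bar> powr r)"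
      unfolding q_def by (intro mult_left_mono K) auto
    finally show ?case by (simp only: mult_ac)
  qed
  have int_dom: "integrable (z_law d B) (\<lambda>z. c * \<bar>\<Delta>\<bar> powr r * (\<bar>dot d v z\<bar> * \<bar>dot d \<theta> z\<bar>))"
    using integrable_abs[OF iid_dot_sq_integrable[of d v \<theta>]] by (intro integrable_mult_right) (simp add: abs_mult)
  have intR: "integrable (z_law d B) R"
    by (rule Bochner_Integration.integrable_bound[OF int_dom])
       (use R_le c in \<open>auto simp: abs_mult\<close>)
  have int_q: "integrable (z_law d B) (\<lambda>z. dot d v z * q)"
    by (intro integrable_mult_left iid_dot_integrable)
  have H: "H v \<Delta> z = R z + dot d v z * q" for z by (simp add: R_def)
  show "integrable (z_law d B) (H v \<Delta>)"
    unfolding H[abs_def] by (intro Bochner_Integration.integrable_add intR int_q)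
  have "(\<integral>z. H v \<Delta> z \<partial>z_law d B) = (\<integral>z. R z \<partial>z_law d B)"
    unfolding H using intR int_q by (simp add: iid_dot_mean)
  then have "\<bar>\<integral>z. H v \<Delta> z \<partial>z_law d B\<bar> \<le> (\<integral>z. \<bar>R z\<bar> \<partial>z_law d B)"
    using integral_abs_bound[of "z_law d B" R] by (simp only:)
  also have "\<dots> \<le> (\<integral>z. c * \<bar>\<Delta>\<bar> powr r * (\<bar>dot d v z\<bar> * \<bar>dot d \<theta> z\<bar>) \<partial>z_law d B)"
    by (rule integral_mono_AE[OF integrable_abs[OF intR] int_dom R_le])
  also have "\<dots> = c * \<bar>\<Delta>\<bar> powr r * (\<integral>z. \<bar>dot d v z\<bar> * \<bar>dot d \<theta> z\<bar> \<partial>z_law d B)" by simp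
  also have "\<dots> \<le> c * \<bar>\<Delta>\<bar> powr r * (B^2 / 3 * lq_norm d 2 v * lq_norm d 2 \<theta>)"
    using c by (intro mult_left_mono iid_abs_dot_product) auto
  finally show "\<bar>\<integral>z. H v \<Delta> z \<partial>z_law d B\<bar> \<le> c * (B^2 / 3) * lq_norm d 2 \<theta> * lq_norm d 2 v * \<bar>\<Delta>\<bar> powr r"
    by (simp only: mult_ac)
qed

lemma obs_law_in_smooth_class:
  assumes \<theta>: "\<theta> \<in> vecs d"
    and K: "\<And>y t \<Delta>. y \<in> {-1, 1} \<Longrightarrow>
      \<bar>(cond_dens_deriv (strict_floor \<beta>) h y t (\<Delta> + t) - cond_dens_deriv (strict_floor \<beta>) h y t t)
      - (cond_dens_deriv (strict_floor \<beta>) h y 0 \<Delta> - cond_dens_deriv (strict_floor \<beta>) h y 0 0)\<bar>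
      \<le> c * \<bar>t\<bar> * \<bar>\<Delta>\<bar> powr (\<beta> - real (strict_floor \<beta>))"
    and c: "0 \<le> c" and L: "c * (B^2 / 3) * lq_norm d 2 \<theta> \<le> L"
  shows "obs_law d h B \<theta> \<in> smooth_class d \<beta> L s'"
proof -
  define l where "l = strict_floor \<beta>"
  define f where "f y z = cond_dens h y (clipped_dot d h \<theta> z)" for y z
  have fk: "(deriv ^^ k) (f y z) = cond_dens_deriv k h y (clipped_dot d h \<theta> z)" for k y z
    unfolding f_def by (rule deriv_cond_dens[OF h(1)])
  have diff: "(deriv ^^ k) (f y z) differentiable at x" for k y z x
    unfolding fk real_differentiable_def by (rule exI, rule cond_dens_deriv_Suc[OF h(1)])
  have smooth: "integrable (lebesgue_vec d) (\<lambda>z. dot d v z *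
      ((deriv ^^ l) (f y z) (\<Delta> + dot d \<theta> z) - (deriv ^^ l) (f y z) (dot d \<theta> z)) * z_dens d B z)" (is "integrable _ ?h")
    and smooth': "\<bar>\<integral>z. dot d v z *
      ((deriv ^^ l) (f y z) (\<Delta> + dot d \<theta> z) - (deriv ^^ l) (f y z) (dot d \<theta> z)) * z_dens d B z \<partial>lebesgue_vec d\<bar>
      \<le> L * lq_norm d 2 v * \<bar>\<Delta>\<bar> powr (\<beta> - real l)"
    if y: "y \<in> {-1, 1}" for y v \<Delta>
  proof -
    define H where "H z = dot d v z * (cond_dens_deriv l h y (clipped_dot d h \<theta> z) (\<Delta> + dot d \<theta> z)
      - cond_dens_deriv l h y (clipped_dot d h \<theta> z) (dot d \<theta> z))" for z
    have [measurable]: "H \<in> borel_measurable (lebesgue_vec d)" unfolding H_def by measurable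
    have hH: "dot d v z * ((deriv ^^ l) (f y z) (\<Delta> + dot d \<theta> z) - (deriv ^^ l) (f y z) (dot d \<theta> z)) * z_dens d B z
      = z_dens d B z *\<^sub>R H z" for z
      by (simp add: fk H_def)
    note S = smoothness_integral[OF y K[OF y, folded l_def] c, of v \<Delta>, folded H_def]
    show "integrable (lebesgue_vec d) ?h"
      unfolding hH using S(1) unfolding density_z_dens[symmetric]
      by (subst (asm) integrable_density) (auto simp: z_dens_nonneg)
    have "(\<integral>z. z_dens d B z *\<^sub>R H z \<partial>lebesgue_vec d) = (\<integral>z. H z \<partial>z_law d B)"
      unfolding density_z_dens[symmetric] by (intro integral_density[symmetric]) (auto simp: z_dens_nonneg)
    moreover have "\<bar>\<integral>z. H z \<partial>z_law d B\<bar> \<le> L * (lq_norm d 2 v * \<bar>\<Delta>\<bar> powr (\<beta> - real l))"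
    proof -
      have "\<bar>\<integral>z. H z \<partial>z_law d B\<bar> \<le> (c * (B^2 / 3) * lq_norm d 2 \<theta>) * (lq_norm d 2 v * \<bar>\<Delta>\<bar> powr (\<beta> - real l))"
        using S(2) by (simp only: mult.assoc)
      also have "\<dots> \<le> L * (lq_norm d 2 v * \<bar>\<Delta>\<bar> powr (\<beta> - real l))"
        by (intro mult_right_mono L mult_nonneg_nonneg lq_norm_2_nonneg) auto
      finally show ?thesis .
    qed
    ultimately show "\<bar>\<integral>z. ?h z \<partial>lebesgue_vec d\<bar> \<le> L * lq_norm d 2 v * \<bar>\<Delta>\<bar> powr (\<beta> - real l)"
      unfolding hH by (simp only: mult.assoc)
  qed
  have "cond_densities d (obs_law d h B \<theta>) f (\<lambda>_. z_dens d B)"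
    unfolding f_def by (rule cond_densities_obs_law)
  then show ?thesis
    unfolding smooth_class_def Let_def l_def[symmetric]
    using obs_law_mem unique_risk_minimizer_obs_law[OF \<theta>] diff smooth smooth'
    by (intro CollectI conjI exI[of _ \<theta>] exI[of _ f] exI[of _ "\<lambda>_. z_dens d B"]) auto
qed

lemma obs_law_in_Theta:
  assumes \<theta>: "\<theta> \<in> vecs d" and d: "0 < d" and sparse: "l0_norm d \<theta> \<le> s"
    and P: "obs_law d h B \<theta> \<in> smooth_class d \<beta> L (C' * real s)" and \<rho>: "\<rho> \<le> c\<^sub>0 / 2 * (B^2 / 3)"
  shows "(\<theta>, obs_law d h B \<theta>) \<in> Theta d s \<beta> L \<rho> C'"
  unfolding Theta_def
  using assms unique_risk_minimizer_obs_law[OF \<theta>] has_hessian_obs_law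
    order_trans[OF \<rho> lambda_min_risk_hessian[OF d]] by blast

end

text \<open>The ratio to the law with \<open>\<theta> = 0\<close>; the label probability and the
  covariate density are common to both and cancel. The value 0 off the labels keeps it nonnegative
  on the whole type.\<close>

definition likelihood_ratio :: "nat \<Rightarrow> real \<Rightarrow> (nat \<Rightarrow> real) \<Rightarrow> obs \<Rightarrow> real" where
  "likelihood_ratio d h \<theta> = (\<lambda>(x, y, z). if y \<in> {-1, 1} then cond_dens h y (clipped_dot d h \<theta> z) x / cond_dens h y 0 x else 0)"

lemma clipped_dot_zero: "clipped_dot d h (\<lambda>i\<in>{..<d}. 0) z = 0"
  by (simp add: clipped_dot_def dot_def)

lemma threshold_model_zero: "0 < h \<Longrightarrow> h \<le> 1/2 \<Longrightarrow> 0 < B \<Longrightarrow> threshold_model d h B (\<lambda>i\<in>{..<d}. 0)"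
  by unfold_locales auto

lemma cond_dens_0_pos:
  assumes "y \<in> {-1, 1}"
  shows "0 < cond_dens h y 0 x"
proof -
  have "0 < c\<^sub>0 * (3/4 * gauss x)" using gauss_const_pos by simp
  then show ?thesis using cond_dens_0_ge[OF assms, of x h] by linarith
qed

lemma likelihood_ratio_measurable [measurable]: "likelihood_ratio d h \<theta> \<in> borel_measurable (obs_base d)"
proof -
  have "(\<lambda>\<omega>. if fst (snd \<omega>) \<in> {-1, 1} then cond_dens h (fst (snd \<omega>)) (clipped_dot d h \<theta> (snd (snd \<omega>))) (fst \<omega>)
     / cond_dens h (fst (snd \<omega>)) 0 (fst \<omega>) else 0) \<in> borel_measurable (obs_base d)"
    by measurable
  then show ?thesis by (simp add: likelihood_ratio_def case_prod_beta)
qed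

context threshold_model
begin

interpretation base: threshold_model d h B "\<lambda>i\<in>{..<d}. 0"
  using threshold_model_zero[OF h B] .

lemma likelihood_ratio_nonneg: "0 \<le> likelihood_ratio d h \<theta> \<omega>"
proof (cases \<omega>)
  case (fields x y z)
  have "0 \<le> cond_dens h y (clipped_dot d h \<theta> z) x / cond_dens h y 0 x" if "y \<in> {-1, 1}"
    using cond_dens_clipped_nonneg[OF that, of z x] cond_dens_0_pos[OF that, of h x] by simp
  then show ?thesis by (simp add: fields likelihood_ratio_def)
qed

lemma obs_law_density:
  "obs_law d h B \<theta> = density (obs_law d h B (\<lambda>i\<in>{..<d}. 0)) (\<lambda>\<omega>. ennreal (likelihood_ratio d h \<theta> \<omega>))"
proof -
  have "density (obs_law d h B (\<lambda>i\<in>{..<d}. 0)) (\<lambda>\<omega>. ennreal (likelihood_ratio d h \<theta> \<omega>))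
    = density (obs_base d) (\<lambda>\<omega>. (\<lambda>(x, y, z). ennreal (1/2 * z_dens d B z * cond_dens h y (clipped_dot d h (\<lambda>i\<in>{..<d}. 0) z) x)) \<omega>
        * ennreal (likelihood_ratio d h \<theta> \<omega>))"
    unfolding obs_law_def by (intro density_density_eq) measurable
  also have "\<dots> = density (obs_base d) (\<lambda>(x, y, z). ennreal (1/2 * z_dens d B z * cond_dens h y (clipped_dot d h \<theta> z) x))"
  proof (rule density_cong)
    show "AE \<omega> in obs_base d. (\<lambda>(x, y, z). ennreal (1/2 * z_dens d B z * cond_dens h y (clipped_dot d h (\<lambda>i\<in>{..<d}. 0) z) x)) \<omega>
        * ennreal (likelihood_ratio d h \<theta> \<omega>)
      = (\<lambda>(x, y, z). ennreal (1/2 * z_dens d B z * cond_dens h y (clipped_dot d h \<theta> z) x)) \<omega>"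
    proof (rule AE_I2)
      fix \<omega> assume \<omega>: "\<omega> \<in> space (obs_base d)"
      obtain x y z where xyz: "\<omega> = (x, y, z)" by (cases \<omega>)
      have y: "y \<in> {-1, 1}" using \<omega> by (auto simp: xyz obs_base_def space_pair_measure)
      have "ennreal (1/2 * z_dens d B z * cond_dens h y 0 x) * ennreal (likelihood_ratio d h \<theta> \<omega>)
        = ennreal (1/2 * z_dens d B z * cond_dens h y 0 x * likelihood_ratio d h \<theta> \<omega>)"
        by (rule ennreal_mult''[symmetric, OF likelihood_ratio_nonneg])
      also have "1/2 * z_dens d B z * cond_dens h y 0 x * likelihood_ratio d h \<theta> \<omega>
        = 1/2 * z_dens d B z * cond_dens h y (clipped_dot d h \<theta> z) x"
        using y cond_dens_0_pos[OF y, of h x] by (simp add: xyz likelihood_ratio_def)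
      finally show "(\<lambda>(x, y, z). ennreal (1/2 * z_dens d B z * cond_dens h y (clipped_dot d h (\<lambda>i\<in>{..<d}. 0) z) x)) \<omega>
        * ennreal (likelihood_ratio d h \<theta> \<omega>)
      = (\<lambda>(x, y, z). ennreal (1/2 * z_dens d B z * cond_dens h y (clipped_dot d h \<theta> z) x)) \<omega>"
        by (simp only: xyz prod.case clipped_dot_zero)
    qed
  qed measurable
  finally show ?thesis by (simp only: obs_law_def)
qed

text \<open>A second moment is 1 plus a chi-square distance. For fixed \<open>z\<close> the distance
  is at most \<open>\<kappa>\<close> times the squared margin, and averaging over \<open>z\<close>
  turns the margin into the 2-norm of \<open>\<theta>\<close>.\<close>

lemma likelihood_ratio_second_moment:
  defines "\<kappa> \<equiv> 11 * (\<integral>x. \<bar>bump x\<bar> \<partial>lborel) * h"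
  shows "(\<integral>\<^sup>+\<omega>. ennreal ((likelihood_ratio d h \<theta> \<omega>)^2) \<partial>obs_law d h B (\<lambda>i\<in>{..<d}. 0))
    \<le> ennreal (1 + \<kappa> * (B^2 / 3) * (lq_norm d 2 \<theta>)^2)"
proof -
  have \<kappa>: "0 \<le> \<kappa>" unfolding \<kappa>_def using h by (intro mult_nonneg_nonneg integral_nonneg_AE) auto
  let ?t = "clipped_dot d h \<theta>"
  have inner: "(\<integral>\<^sup>+x. ennreal (cond_dens h y 0 x) * ennreal ((likelihood_ratio d h \<theta> (x, y, z))^2) \<partial>lborel)
      \<le> ennreal (1 + \<kappa> * (?t z)^2)" if y: "y \<in> {-1, 1}" for y z
  proof -
    define a b where "a x = cond_dens h y (?t z) x" and "b x = cond_dens h y 0 x" for x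
    have a: "0 \<le> a x" for x unfolding a_def by (rule cond_dens_clipped_nonneg[OF y])
    have b: "0 < b x" for x unfolding b_def by (rule cond_dens_0_pos[OF y])
    have [measurable]: "a \<in> borel_measurable borel" "b \<in> borel_measurable borel"
      unfolding a_def[abs_def] b_def[abs_def] by measurable
    have ia: "(\<integral>\<^sup>+x. ennreal (a x) \<partial>lborel) = 1" unfolding a_def
      by (rule cond_dens_nn_integral[OF h clipped_small y])
    have ib: "(\<integral>\<^sup>+x. ennreal (b x) \<partial>lborel) = 1" unfolding b_def
      using cond_dens_nn_integral[OF h _ y, of 0] h by simp
    have chi: "(\<integral>\<^sup>+x. ennreal ((a x - b x)^2 / b x) \<partial>lborel) \<le> ennreal (\<kappa> * (?t z)^2)"
      unfolding a_def b_def \<kappa>_def by (rule cond_dens_chi2[OF h clipped_small y])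
    have "ennreal (b x) * ennreal ((likelihood_ratio d h \<theta> (x, y, z))^2) = ennreal ((a x)^2 / b x)" for x
    proof -
      have "ennreal (b x) * ennreal ((likelihood_ratio d h \<theta> (x, y, z))^2) = ennreal (b x * (likelihood_ratio d h \<theta> (x, y, z))^2)"
        by (intro ennreal_mult''[symmetric]) simp
      also have "b x * (likelihood_ratio d h \<theta> (x, y, z))^2 = (a x)^2 / b x"
        using y b[of x] by (simp add: likelihood_ratio_def flip: a_def b_def) (simp add: power2_eq_square)
      finally show ?thesis .
    qed
    then have eq: "(\<integral>\<^sup>+x. ennreal (b x) * ennreal ((likelihood_ratio d h \<theta> (x, y, z))^2) \<partial>lborel)
      = (\<integral>\<^sup>+x. ennreal ((a x)^2 / b x) \<partial>lborel)" by simp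
    \<comment> \<open>\<open>a\<^sup>2/b + b = 2a + (a - b)\<^sup>2/b\<close>, arranged so that every summand is nonnegative\<close>
    have "(\<integral>\<^sup>+x. ennreal ((a x)^2 / b x) \<partial>lborel) + 1 = (\<integral>\<^sup>+x. ennreal ((a x)^2 / b x) + ennreal (b x) \<partial>lborel)"
      unfolding ib[symmetric] by (intro nn_integral_add[symmetric]) auto
    also have "\<dots> = (\<integral>\<^sup>+x. (ennreal (a x) + ennreal (a x)) + ennreal ((a x - b x)^2 / b x) \<partial>lborel)"
    proof (intro nn_integral_cong)
      fix x
      have "(a x)^2 / b x + b x = (a x + a x) + (a x - b x)^2 / b x"
        using b[of x] by (simp add: field_simps power2_eq_square)
      moreover have "ennreal ((a x)^2 / b x) + ennreal (b x) = ennreal ((a x)^2 / b x + b x)"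
        using b[of x] by (intro ennreal_plus[symmetric]) auto
      moreover have "(ennreal (a x) + ennreal (a x)) + ennreal ((a x - b x)^2 / b x) = ennreal ((a x + a x) + (a x - b x)^2 / b x)"
        using a[of x] b[of x] by (subst ennreal_plus, simp, simp, subst ennreal_plus) auto
      ultimately show "ennreal ((a x)^2 / b x) + ennreal (b x) = (ennreal (a x) + ennreal (a x)) + ennreal ((a x - b x)^2 / b x)"
        by (simp only:)
    qed
    also have "\<dots> = (1 + 1) + (\<integral>\<^sup>+x. ennreal ((a x - b x)^2 / b x) \<partial>lborel)"
      by (subst nn_integral_add, simp, simp, subst nn_integral_add) (simp_all only: ia, auto)
    also have "\<dots> \<le> (1 + 1) + ennreal (\<kappa> * (?t z)^2)" by (intro add_left_mono chi)
    also have "\<dots> = ennreal (1 + \<kappa> * (?t z)^2) + 1"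
      using \<kappa> by (subst ennreal_plus) (auto simp: add_ac)
    finally have "(\<integral>\<^sup>+x. ennreal ((a x)^2 / b x) \<partial>lborel) \<le> ennreal (1 + \<kappa> * (?t z)^2)" by simp
    then have "(\<integral>\<^sup>+x. ennreal (b x) * ennreal ((likelihood_ratio d h \<theta> (x, y, z))^2) \<partial>lborel) \<le> ennreal (1 + \<kappa> * (?t z)^2)"
      unfolding eq .
    then show ?thesis by (simp only: b_def)
  qed
  have "(\<integral>\<^sup>+\<omega>. ennreal ((likelihood_ratio d h \<theta> \<omega>)^2) \<partial>obs_law d h B (\<lambda>i\<in>{..<d}. 0))
    = (\<Sum>y\<in>{-1, 1}. \<integral>\<^sup>+z. ennreal (1/2) * (\<integral>\<^sup>+x. ennreal (cond_dens h y 0 x) * ennreal ((likelihood_ratio d h \<theta> (x, y, z))^2) \<partial>lborel) \<partial>z_law d B)"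
    by (subst base.nn_integral_obs_law) (simp_all only: clipped_dot_zero, measurable)
  also have "\<dots> \<le> (\<Sum>y\<in>{-1, 1 :: real}. \<integral>\<^sup>+z. ennreal (1/2) * ennreal (1 + \<kappa> * (?t z)^2) \<partial>z_law d B)"
    by (intro sum_mono nn_integral_mono mult_left_mono inner) auto
  also have "\<dots> = (\<Sum>y\<in>{-1, 1 :: real}. \<integral>\<^sup>+z. ennreal (1/2 * (1 + \<kappa> * (dot d \<theta> z)^2)) \<partial>z_law d B)"
  proof (intro sum.cong refl nn_integral_cong_AE)
    show "AE z in z_law d B. ennreal (1/2) * ennreal (1 + \<kappa> * (?t z)^2) = ennreal (1/2 * (1 + \<kappa> * (dot d \<theta> z)^2))"
      using clipped_eq
    proof eventually_elim
      case (elim z)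
      show ?case unfolding elim using \<kappa> by (intro ennreal_mult''[symmetric]) simp
    qed
  qed
  also have "\<dots> = (\<Sum>y\<in>{-1, 1 :: real}. ennreal (1/2 * (1 + \<kappa> * (B^2 / 3 * (lq_norm d 2 \<theta>)^2))))"
  proof (intro sum.cong refl)
    have sq: "integrable (z_law d B) (\<lambda>z. (dot d \<theta> z)^2)"
      using iid_dot_sq_integrable[of d \<theta> \<theta>] by (simp add: power2_eq_square)
    have int: "integrable (z_law d B) (\<lambda>z. 1/2 * (1 + \<kappa> * (dot d \<theta> z)^2))"
      by (intro integrable_mult_right Bochner_Integration.integrable_add Z.integrable_const sq)
    have "(\<integral>\<^sup>+z. ennreal (1/2 * (1 + \<kappa> * (dot d \<theta> z)^2)) \<partial>z_law d B) = ennreal (\<integral>z. 1/2 * (1 + \<kappa> * (dot d \<theta> z)^2) \<partial>z_law d B)"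
      using \<kappa> by (intro nn_integral_eq_integral int) auto
    also have "(\<integral>z. 1/2 * (1 + \<kappa> * (dot d \<theta> z)^2) \<partial>z_law d B) = 1/2 * (1 + \<kappa> * (\<integral>z. (dot d \<theta> z)^2 \<partial>z_law d B))"
      using sq by (simp add: Z.prob_space)
    finally show "(\<integral>\<^sup>+z. ennreal (1/2 * (1 + \<kappa> * (dot d \<theta> z)^2)) \<partial>z_law d B) = ennreal (1/2 * (1 + \<kappa> * (B^2 / 3 * (lq_norm d 2 \<theta>)^2)))"
      by (simp only: iid_dot_second_moment lq_norm_2_sq)
  qed
  also have "\<dots> = ennreal (\<Sum>y\<in>{-1, 1 :: real}. 1/2 * (1 + \<kappa> * (B^2 / 3 * (lq_norm d 2 \<theta>)^2)))"
    using \<kappa> by (intro sum_ennreal) auto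
  also have "(\<Sum>y\<in>{-1, 1 :: real}. 1/2 * (1 + \<kappa> * (B^2 / 3 * (lq_norm d 2 \<theta>)^2))) = 1 + \<kappa> * (B^2 / 3) * (lq_norm d 2 \<theta>)^2"
    by simp
  finally show ?thesis .
qed

end

section \<open>Sparse words and testing\<close>

text \<open>Any exponent below 2 would make Hamming balls of a suitable radius exponentially small;
  7/4 is possible down to the binary alphabet, where the fourth power reads
  \<open>81 <= 128\<close>.\<close>

lemma two_q_minus_one_le: "q \<ge> 2 \<Longrightarrow> 2 * real q - 1 \<le> real q powr (7/4)"
proof -
  assume q: "q \<ge> 2"
  have "(2 * real q - 1)^4 \<le> real q ^ 7"
  proof (cases "q \<ge> 4")
    case True
    have "(2 * real q - 1)^4 \<le> (2 * real q)^4" using q by (intro power_mono) auto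
    also have "\<dots> = 4^2 * real q ^ 4" by (simp add: power_mult_distrib)
    also have "\<dots> \<le> real q ^ 2 * real q ^ 4" using True by (intro mult_right_mono power_mono) auto
    also have "\<dots> = real q ^ 6" by (simp add: power_add[symmetric])
    also have "\<dots> \<le> real q ^ 7" using q by (intro power_increasing) auto
    finally show ?thesis .
  next
    case False
    then have "q = 2 \<or> q = 3" using q by auto
    then show ?thesis by auto
  qed
  then have "((2 * real q - 1)^4) powr (1/4) \<le> (real q ^ 7) powr (1/4)"
    using q by (intro powr_mono2) auto
  moreover have "((2 * real q - 1)^4) powr (1/4) = 2 * real q - 1"
    using q by (simp add: powr_powr flip: powr_numeral)
  moreover have "(real q ^ 7) powr (1/4) = real q powr (7/4)"
    using q by (simp add: powr_powr flip: powr_numeral)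
  ultimately show ?thesis by simp
qed

text \<open>Words over \<open>q\<close> letters agreeing with \<open>w0\<close> in most places are few: weight each agreement by \<open>q\<close>.\<close>

lemma hamming_ball_card_le:
  assumes q: "q \<ge> 2" and w0: "w0 \<in> {..<s} \<rightarrow>\<^sub>E {..<q}"
  shows "real (card {w \<in> {..<s} \<rightarrow>\<^sub>E {..<q}. real (card {b \<in> {..<s}. w b \<noteq> w0 b}) \<le> real s / 8})
    \<le> real q powr (7/8 * real s)"
proof -
  define W where "W = ({..<s} \<rightarrow>\<^sub>E {..<q} :: (nat \<Rightarrow> nat) set)"
  define N where "N = {w \<in> W. real (card {b \<in> {..<s}. w b \<noteq> w0 b}) \<le> real s / 8}"
  define f where "f w = (\<Prod>b<s. if w b = w0 b then real q else 1)" for w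
  have fin: "finite W" by (auto simp: W_def intro: finite_PiE)
  have "(\<Sum>w\<in>W. f w) = (\<Prod>b<s. \<Sum>a<q. if a = w0 b then real q else 1)"
    unfolding W_def f_def by (subst prod_sum_PiE) auto
  \<comment> \<open>At each place one letter agrees with \<open>w0\<close> and weighs
    \<open>q\<close>, while the other \<open>q - 1\<close> letters weigh 1.\<close>
  also have "\<dots> = (\<Prod>b<s. 2 * real q - 1)"
  proof (intro prod.cong refl)
    fix b assume "b \<in> {..<s}"
    then have b: "w0 b \<in> {..<q}" using w0 by (auto simp: PiE_iff)
    have "(\<Sum>a<q. if a = w0 b then real q else 1) = (\<Sum>a<q. 1 + (if a = w0 b then real q - 1 else 0))"
      by (intro sum.cong) auto
    also have "\<dots> = 2 * real q - 1" using b by (simp add: sum.distrib)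
    finally show "(\<Sum>a<q. if a = w0 b then real q else 1) = 2 * real q - 1" .
  qed
  also have "\<dots> = (2 * real q - 1) ^ s" by simp
  also have "\<dots> \<le> (real q powr (7/4)) ^ s" using two_q_minus_one_le[OF q] q by (intro power_mono) auto
  also have "\<dots> = real q powr (7/4 * real s)" using q by (simp add: powr_powr flip: powr_realpow)
  finally have total: "(\<Sum>w\<in>W. f w) \<le> real q powr (7/4 * real s)" .
  have each: "real q powr (7/8 * real s) \<le> f w" if "w \<in> N" for w
  proof -
    have "card {b \<in> {..<s}. w b = w0 b} + card {b \<in> {..<s}. w b \<noteq> w0 b} = card ({b \<in> {..<s}. w b = w0 b} \<union> {b \<in> {..<s}. w b \<noteq> w0 b})"
      by (subst card_Un_disjoint) auto
    also have "{b \<in> {..<s}. w b = w0 b} \<union> {b \<in> {..<s}. w b \<noteq> w0 b} = {..<s}" by auto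
    finally have c: "card {b \<in> {..<s}. w b = w0 b} + card {b \<in> {..<s}. w b \<noteq> w0 b} = s" by simp
    have le: "7/8 * real s \<le> real (card {b \<in> {..<s}. w b = w0 b})"
      using that arg_cong[OF c, of real] unfolding N_def by simp
    have "f w = (\<Prod>b\<in>{b \<in> {..<s}. w b = w0 b}. real q)" unfolding f_def by (subst prod.inter_filter) auto
    also have "\<dots> = real q powr real (card {b \<in> {..<s}. w b = w0 b})" using q by (simp add: powr_realpow)
    finally show ?thesis using le q by (simp add: powr_mono)
  qed
  have "real (card N) * real q powr (7/8 * real s) = (\<Sum>w\<in>N. real q powr (7/8 * real s))" by simp
  also have "\<dots> \<le> (\<Sum>w\<in>N. f w)" by (intro sum_mono each)
  also have "\<dots> \<le> (\<Sum>w\<in>W. f w)"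
    using fin q by (intro sum_mono2) (auto simp: N_def f_def intro!: prod_nonneg)
  also note total
  also have "real q powr (7/4 * real s) = real q powr (7/8 * real s) * real q powr (7/8 * real s)"
    by (simp flip: powr_add)
  finally have "real (card N) \<le> real q powr (7/8 * real s)" using q by simp
  then show ?thesis by (simp add: N_def W_def)
qed

text \<open>Coordinate \<open>i\<close> is place \<open>i mod m\<close> of block \<open>i div m\<close>; the letter \<open>0\<close> leaves its block empty, so that
  \<open>m + 1 > d / s\<close> letters are available even when \<open>m = 1\<close>.\<close>

definition word_vec :: "nat \<Rightarrow> nat \<Rightarrow> real \<Rightarrow> nat \<Rightarrow> (nat \<Rightarrow> nat) \<Rightarrow> nat \<Rightarrow> real" where
  "word_vec d m a s w = (\<lambda>i\<in>{..<d}. if i < s * m \<and> w (i div m) = Suc (i mod m) then a else 0)"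

lemma word_vec_mem: "word_vec d m a s w \<in> vecs d"
  by (auto simp: word_vec_def vecs_def)

text \<open>Each block holds at most one nonzero entry: the letter of the block determines
  \<open>i mod m\<close>, so \<open>i div m\<close> is injective on the support.\<close>

lemma word_vec_support: "card {i. i < d \<and> i < s * m \<and> w (i div m) = Suc (i mod m)} \<le> s"
proof -
  let ?S = "{i. i < d \<and> i < s * m \<and> w (i div m) = Suc (i mod m)}"
  have "card ?S \<le> card {..<s}"
  proof (rule card_inj_on_le)
    show "inj_on (\<lambda>i. i div m) ?S"
    proof (rule inj_onI)
      fix i j assume "i \<in> ?S" "j \<in> ?S" "i div m = j div m"
      then have "i mod m = j mod m" by auto
      then show "i = j" using \<open>i div m = j div m\<close> by (metis div_mult_mod_eq)
    qed
    show "(\<lambda>i. i div m) ` ?S \<subseteq> {..<s}" by (auto simp: less_mult_imp_div_less)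
  qed simp
  then show ?thesis by simp
qed

lemma l0_norm_word_vec: "l0_norm d (word_vec d m a s w) \<le> s"
proof -
  have "l0_norm d (word_vec d m a s w) \<le> card {i. i < d \<and> i < s * m \<and> w (i div m) = Suc (i mod m)}"
    unfolding l0_norm_def word_vec_def by (intro card_mono) auto
  then show ?thesis using word_vec_support order_trans by blast
qed

lemma word_vec_sum_le:
  assumes "0 \<le> c" "F 0 = 0" "F a = c"
  shows "(\<Sum>i<d. F (word_vec d m a s w i)) \<le> real s * c"
proof -
  let ?S = "{i. i < d \<and> i < s * m \<and> w (i div m) = Suc (i mod m)}"
  have "(\<Sum>i<d. F (word_vec d m a s w i)) = (\<Sum>i\<in>?S. c)"
  proof (rule sum.mono_neutral_cong_right)
    show "\<forall>i\<in>{..<d} - ?S. F (word_vec d m a s w i) = 0" using assms by (auto simp: word_vec_def)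
  qed (use assms in \<open>auto simp: word_vec_def\<close>)
  also have "\<dots> \<le> real s * c" using word_vec_support[of d s m w] assms by (simp add: mult_right_mono)
  finally show ?thesis .
qed

text \<open>Every block in which the words differ contributes a coordinate where exactly one of the
  two vectors equals \<open>a\<close>: the place named by \<open>w\<close>, or by \<open>w'\<close>
  if \<open>w\<close> leaves the block empty. Both cannot be empty, since the letters
  differ.\<close>

lemma word_vec_separation:
  assumes sm: "s * m \<le> d" and w: "w \<in> {..<s} \<rightarrow>\<^sub>E {..<Suc m}" "w' \<in> {..<s} \<rightarrow>\<^sub>E {..<Suc m}" and p: "p > 0"
  shows "real (card {b \<in> {..<s}. w b \<noteq> w' b}) * \<bar>a\<bar> ^ p
    \<le> (\<Sum>i<d. \<bar>word_vec d m a s w i - word_vec d m a s w' i\<bar> ^ p)"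
proof -
  define D where "D = {b \<in> {..<s}. w b \<noteq> w' b}"
  define letter where "letter b = (if w b \<noteq> 0 then w b - 1 else w' b - 1)" for b
  define idx where "idx b = b * m + letter b" for b
  have lt: "letter b < m" if "b \<in> D" for b
  proof -
    have "w b < Suc m" "w' b < Suc m" "w b \<noteq> w' b" using that w by (auto simp: D_def PiE_iff)
    then show ?thesis by (auto simp: letter_def)
  qed
  have dm: "idx b div m = b" "idx b mod m = letter b" if "b \<in> D" for b
    using lt[OF that] by (auto simp: idx_def)
  have bound: "idx b < s * m" if "b \<in> D" for b
  proof -
    have "idx b < b * m + m" using lt[OF that] by (simp add: idx_def)
    also have "\<dots> = Suc b * m" by simp
    also have "\<dots> \<le> s * m" using that by (intro mult_right_mono) (auto simp: D_def)
    finally show ?thesis .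
  qed
  have inj: "inj_on idx D" by (rule inj_on_inverseI[of _ "\<lambda>i. i div m"]) (use dm in auto)
  have val: "\<bar>word_vec d m a s w (idx b) - word_vec d m a s w' (idx b)\<bar> = \<bar>a\<bar>" if "b \<in> D" for b
  proof -
    have ne: "w b \<noteq> w' b" using that by (simp add: D_def)
    have "idx b < d" using bound[OF that] sm by simp
    then have "word_vec d m a s u (idx b) = (if u b = Suc (letter b) then a else 0)" for u
      using bound[OF that] dm[OF that] by (simp add: word_vec_def)
    then show ?thesis using ne by (auto simp: letter_def)
  qed
  have "real (card D) * \<bar>a\<bar> ^ p = (\<Sum>b\<in>D. \<bar>word_vec d m a s w (idx b) - word_vec d m a s w' (idx b)\<bar> ^ p)"
    using val by simp
  also have "\<dots> = (\<Sum>i\<in>idx ` D. \<bar>word_vec d m a s w i - word_vec d m a s w' i\<bar> ^ p)"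
    using inj by (simp add: sum.reindex)
  also have "\<dots> \<le> (\<Sum>i<d. \<bar>word_vec d m a s w i - word_vec d m a s w' i\<bar> ^ p)"
    using bound sm by (intro sum_mono2) (auto, fastforce)
  finally show ?thesis by (simp add: D_def)
qed

section \<open>Reduction of the minimax probability to a test between many laws\<close>

text \<open>A Fano-type bound through second moments of the likelihood ratios \<open>lr w\<close>: in the average over \<open>W\<close>,
  \<open>P\<^sub>w (A w) = \<integral> lr w 1\<^bsub>A w\<^esub> \<partial>P\<^sub>0\<close> is split by AM-GM, and the sets \<open>A w\<close> overlap at most \<open>V\<close> times.\<close>

lemma exists_small_error_set:
  fixes P0 :: "'a measure" and lr :: "'w \<Rightarrow> 'a \<Rightarrow> real" and lam K V :: real
  assumes P0: "prob_space P0" and W: "finite W" "W \<noteq> {}" and lam: "0 < lam" and K: "0 \<le> K"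
    and l_meas: "\<And>w. w \<in> W \<Longrightarrow> lr w \<in> borel_measurable P0"
    and l_nn: "\<And>w x. w \<in> W \<Longrightarrow> 0 \<le> lr w x"
    and A: "\<And>w. w \<in> W \<Longrightarrow> A w \<in> sets P0"
    and second: "\<And>w. w \<in> W \<Longrightarrow> (\<integral>\<^sup>+x. ennreal ((lr w x)^2) \<partial>P0) \<le> ennreal K"
    and overlap: "\<And>x. x \<in> space P0 \<Longrightarrow> real (card {w \<in> W. x \<in> A w}) \<le> V"
  shows "\<exists>w\<in>W. emeasure (density P0 (\<lambda>x. ennreal (lr w x))) (A w) \<le> ennreal (K / (2 * lam) + lam * V / (2 * real (card W)))"
proof (rule ccontr)
  interpret P0: prob_space P0 by (rule P0)
  define \<epsilon> where "\<epsilon> = K / (2 * lam) + lam * V / (2 * real (card W))"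
  have cW: "0 < real (card W)" using W by (simp add: card_gt_0_iff)
  obtain x0 where "x0 \<in> space P0" using P0.not_empty by auto
  then have V: "0 \<le> V" using overlap[of x0] by (meson of_nat_0_le_iff order_trans)
  assume "\<not> (\<exists>w\<in>W. emeasure (density P0 (\<lambda>x. ennreal (lr w x))) (A w) \<le> ennreal (K / (2 * lam) + lam * V / (2 * real (card W))))"
  then have gt: "ennreal \<epsilon> < emeasure (density P0 (\<lambda>x. ennreal (lr w x))) (A w)" if "w \<in> W" for w
    using that by (auto simp: \<epsilon>_def not_le)
  have le: "emeasure (density P0 (\<lambda>x. ennreal (lr w x))) (A w) \<le> ennreal (K / (2 * lam)) + ennreal (lam / 2) * emeasure P0 (A w)"
    if w: "w \<in> W" for w
  proof -
    note [measurable] = l_meas[OF w] A[OF w]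
    have "emeasure (density P0 (\<lambda>x. ennreal (lr w x))) (A w) = (\<integral>\<^sup>+x. ennreal (lr w x) * indicator (A w) x \<partial>P0)"
      by (intro emeasure_density) auto
    also have "\<dots> \<le> (\<integral>\<^sup>+x. ennreal (1 / (2 * lam)) * ennreal ((lr w x)^2) + ennreal (lam / 2) * indicator (A w) x \<partial>P0)"
    proof (intro nn_integral_mono)
      fix x
      have "0 \<le> (lr w x - lam)^2" by simp
      then have "2 * lam * lr w x \<le> (lr w x)^2 + lam^2" by (simp add: power2_diff mult_ac)
      then have "lr w x \<le> 1 / (2 * lam) * (lr w x)^2 + lam / 2" using lam by (simp add: field_simps power2_eq_square)
      then have "ennreal (lr w x) \<le> ennreal (1 / (2 * lam) * (lr w x)^2 + lam / 2)" by (rule ennreal_leI)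
      also have "\<dots> = ennreal (1 / (2 * lam)) * ennreal ((lr w x)^2) + ennreal (lam / 2)"
        using lam by (subst ennreal_plus) (auto intro: ennreal_mult'' simp del: times_divide_eq_left)
      finally show "ennreal (lr w x) * indicator (A w) x \<le> ennreal (1 / (2 * lam)) * ennreal ((lr w x)^2) + ennreal (lam / 2) * indicator (A w) x"
        by (auto split: split_indicator)
    qed
    also have "\<dots> = ennreal (1 / (2 * lam)) * (\<integral>\<^sup>+x. ennreal ((lr w x)^2) \<partial>P0) + ennreal (lam / 2) * emeasure P0 (A w)"
      by (subst nn_integral_add) (auto simp: nn_integral_cmult)
    also have "ennreal (1 / (2 * lam)) * (\<integral>\<^sup>+x. ennreal ((lr w x)^2) \<partial>P0) \<le> ennreal (1 / (2 * lam)) * ennreal K"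
      by (intro mult_left_mono second w) auto
    also have "\<dots> = ennreal (K / (2 * lam))" using K lam by (simp flip: ennreal_mult'')
    finally show ?thesis by (simp add: add_right_mono)
  qed
  have "(\<Sum>w\<in>W. emeasure P0 (A w)) = (\<Sum>w\<in>W. \<integral>\<^sup>+x. indicator (A w) x \<partial>P0)"
    using A by (intro sum.cong refl) simp
  also have "\<dots> = (\<integral>\<^sup>+x. (\<Sum>w\<in>W. indicator (A w) x) \<partial>P0)"
    using A by (intro nn_integral_sum[symmetric]) auto
  also have "\<dots> \<le> (\<integral>\<^sup>+x. ennreal V \<partial>P0)"
  proof (intro nn_integral_mono)
    fix x assume "x \<in> space P0"
    have "(\<Sum>w\<in>W. indicator (A w) x :: ennreal) = of_nat (card {w \<in> W. x \<in> A w})"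
      using W by (simp add: indicator_def sum.If_cases Int_def)
    also have "\<dots> = ennreal (real (card {w \<in> W. x \<in> A w}))" by (simp add: ennreal_of_nat_eq_real_of_nat)
    also have "\<dots> \<le> ennreal V" using overlap[OF \<open>x \<in> space P0\<close>] by (rule ennreal_leI)
    finally show "(\<Sum>w\<in>W. indicator (A w) x) \<le> ennreal V" .
  qed
  also have "\<dots> = ennreal V" by (simp add: P0.emeasure_space_1)
  finally have sumA: "(\<Sum>w\<in>W. emeasure P0 (A w)) \<le> ennreal V" .
  obtain w1 where "w1 \<in> W" using W by auto
  have "(\<Sum>w\<in>W. ennreal \<epsilon>) < (\<Sum>w\<in>W. ennreal (K / (2 * lam)) + ennreal (lam / 2) * emeasure P0 (A w))"
  proof -
    have fin: "emeasure P0 (A w) < \<infinity>" for w using P0.emeasure_finite[of "A w"] by (simp add: less_top[symmetric])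
    define r where "r w = K / (2 * lam) + lam / 2 * P0.prob (A w)" for w
    have r: "ennreal (K / (2 * lam)) + ennreal (lam / 2) * emeasure P0 (A w) = ennreal (r w)" for w
      unfolding r_def P0.emeasure_eq_measure using K lam
      by (subst ennreal_mult''[symmetric], simp, subst ennreal_plus[symmetric]) auto
    have r0: "0 \<le> r w" for w using K lam by (simp add: r_def)
    have \<epsilon>0: "0 \<le> \<epsilon>" using K lam V by (simp add: \<epsilon>_def)
    have "\<epsilon> < r w" if "w \<in> W" for w
      using less_le_trans[OF gt[OF that] le[OF that]] \<epsilon>0 unfolding r by (simp add: ennreal_less_iff)
    then have "(\<Sum>w\<in>W. \<epsilon>) < (\<Sum>w\<in>W. r w)" using W by (intro sum_strict_mono) auto
    moreover have "(\<Sum>w\<in>W. ennreal \<epsilon>) = ennreal (\<Sum>w\<in>W. \<epsilon>)" using \<epsilon>0 by (intro sum_ennreal) auto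
    moreover have "(\<Sum>w\<in>W. ennreal (r w)) = ennreal (\<Sum>w\<in>W. r w)" using r0 by (intro sum_ennreal) auto
    ultimately show ?thesis unfolding r using \<epsilon>0 by (simp add: ennreal_less_iff sum_nonneg del: sum_constant)
  qed
  also have "\<dots> = ennreal (real (card W) * (K / (2 * lam))) + ennreal (lam / 2) * (\<Sum>w\<in>W. emeasure P0 (A w))"
  proof -
    have "ennreal (real (card W) * (K / (2 * lam))) = of_nat (card W) * ennreal (K / (2 * lam))"
      using K lam by (subst ennreal_mult'') (auto simp: ennreal_of_nat_eq_real_of_nat)
    then show ?thesis by (simp only: sum.distrib sum_distrib_left sum_constant)
  qed
  also have "\<dots> \<le> ennreal (real (card W) * (K / (2 * lam))) + ennreal (lam / 2) * ennreal V"
    using sumA by (intro add_left_mono mult_left_mono) auto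
  also have "\<dots> = ennreal (real (card W) * (K / (2 * lam)) + lam / 2 * V)"
    using K lam V by (subst ennreal_mult''[symmetric], simp, subst ennreal_plus[symmetric]) auto
  also have "real (card W) * (K / (2 * lam)) + lam / 2 * V = (\<Sum>w\<in>W. \<epsilon>)"
    using cW lam by (simp add: \<epsilon>_def field_simps)
  also have "ennreal \<dots> = (\<Sum>w\<in>W. ennreal \<epsilon>)"
    using K lam V by (intro sum_ennreal[symmetric]) (auto simp: \<epsilon>_def)
  finally show False by simp
qed

lemma root_measurable [measurable]: "root n \<in> borel_measurable borel"
  by (intro borel_measurable_continuous_onI continuous_on_real_root continuous_on_id)

lemma lq_norm_measurable [measurable]:
  assumes [measurable]: "\<And>i. i < d \<Longrightarrow> (\<lambda>x. f x i) \<in> borel_measurable M"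
  shows "(\<lambda>x. lq_norm d q (f x)) \<in> borel_measurable M"
proof -
  have "(\<lambda>x. \<Sum>i<d. \<bar>f x i\<bar> ^ q) \<in> borel_measurable M"
    using assms by (intro borel_measurable_sum) auto
  from measurable_compose[OF this root_measurable] show ?thesis by (simp add: lq_norm_def)
qed

text \<open>\<open>A w\<close> is the event that the estimator lands within \<open>r\<close> of
  \<open>\<theta> w\<close>. At a given sample the estimate is one point, so the overlap of these
  events is the number of parameters in a single ball, whatever the estimator is. Second moments of
  product likelihoods factorise over observations, hence the power \<open>n\<close> in the
  hypothesis on \<open>lr\<close>.\<close>

lemma minimax_prob_ge:
  fixes base :: "obs measure" and lr :: "'w \<Rightarrow> obs \<Rightarrow> real" and \<theta> :: "'w \<Rightarrow> nat \<Rightarrow> real"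
  assumes base: "prob_space base" "sets base = sets (obs_base d)" and W: "finite W" "W \<noteq> {}"
    and lam: "0 < lam" and K: "0 \<le> K"
    and l_meas: "\<And>w. w \<in> W \<Longrightarrow> lr w \<in> borel_measurable (obs_base d)"
    and l_nn: "\<And>w x. w \<in> W \<Longrightarrow> 0 \<le> lr w x"
    and P: "\<And>w. w \<in> W \<Longrightarrow> P w = density base (\<lambda>x. ennreal (lr w x))" "\<And>w. w \<in> W \<Longrightarrow> prob_space (P w)"
    and second: "\<And>w. w \<in> W \<Longrightarrow> (\<integral>\<^sup>+x. ennreal ((lr w x)^2) \<partial>base) ^ n \<le> ennreal K"
    and TP: "\<And>w. w \<in> W \<Longrightarrow> (\<theta> w, P w) \<in> TP"
    and overlap: "\<And>\<tau>. real (card {w \<in> W. lq_norm d q (\<lambda>i. \<tau> i - \<theta> w i) < r}) \<le> V"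
    and \<epsilon>: "K / (2 * lam) + lam * V / (2 * real (card W)) \<le> \<epsilon>"
  shows "ennreal (1 - \<epsilon>) \<le> minimax_prob n d q TP r"
  unfolding minimax_prob_def
proof (rule INF_greatest)
  fix T assume T: "T \<in> estimators n d"
  interpret base: prob_space base by (rule base(1))
  let ?P0n = "PiM {..<n} (\<lambda>_. base)"
  have P0n: "prob_space ?P0n" by (intro prob_space_PiM base(1))
  have sets_n: "sets (PiM {..<n} (\<lambda>_. Q)) = sets (PiM {..<n} (\<lambda>_. obs_base d))" if "sets Q = sets (obs_base d)" for Q
    using that by (intro sets_PiM_cong) auto
  have Ti: "(\<lambda>\<omega>. T \<omega> i) \<in> borel_measurable (PiM {..<n} (\<lambda>_. obs_base d))" if "i < d" for i
  proof -
    have "T \<in> PiM {..<n} (\<lambda>_. obs_base d) \<rightarrow>\<^sub>M lebesgue_vec d" using T by (simp add: estimators_def)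
    moreover have "(\<lambda>z. z i) \<in> lebesgue_vec d \<rightarrow>\<^sub>M lborel"
      unfolding lebesgue_vec_def using that by (intro measurable_component_singleton) auto
    ultimately show ?thesis using measurable_compose by fastforce
  qed
  define N where "N w \<omega> = lq_norm d q (\<lambda>i. T \<omega> i - \<theta> w i)" for w \<omega>
  have N: "N w \<in> borel_measurable (PiM {..<n} (\<lambda>_. obs_base d))" for w
    unfolding N_def using Ti by (intro lq_norm_measurable borel_measurable_diff) auto
  define A where "A w = {\<omega> \<in> space ?P0n. N w \<omega> < r}" for w
  have A: "A w \<in> sets ?P0n" for w
  proof -
    have "N w \<in> borel_measurable ?P0n" using N sets_n[OF base(2)] by (simp cong: measurable_cong_sets)
    then show ?thesis unfolding A_def by measurable
  qed
  define ln where "ln w \<omega> = (\<Prod>k<n. lr w (\<omega> k))" for w and \<omega> :: "nat \<Rightarrow> obs"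
  have l_meas0: "lr w \<in> borel_measurable base" if "w \<in> W" for w
    using l_meas[OF that] base(2) by (simp cong: measurable_cong_sets)
  have dens: "PiM {..<n} (\<lambda>_. P w) = density ?P0n (\<lambda>\<omega>. ennreal (ln w \<omega>))" if w: "w \<in> W" for w
  proof -
    have "density ?P0n (\<lambda>\<omega>. \<Prod>k<n. ennreal (lr w (\<omega> k))) = PiM {..<n} (\<lambda>_. density base (\<lambda>x. ennreal (lr w x)))"
      using l_meas0[OF w] P[OF w] prob_space_imp_sigma_finite
      by (intro density_PiM base.sigma_finite_measure_axioms) auto
    then show ?thesis using P(1)[OF w] l_nn[OF w] by (simp add: ln_def prod_ennreal)
  qed
  have "\<exists>w\<in>W. emeasure (density ?P0n (\<lambda>\<omega>. ennreal (ln w \<omega>))) (A w) \<le> ennreal (K / (2 * lam) + lam * V / (2 * real (card W)))"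
  proof (rule exists_small_error_set[OF P0n W lam K])
    show "ln w \<in> borel_measurable ?P0n" if "w \<in> W" for w
      unfolding ln_def using l_meas0[OF that] by measurable
    show "0 \<le> ln w \<omega>" if "w \<in> W" for w \<omega> unfolding ln_def using l_nn[OF that] by (intro prod_nonneg) auto
    show "(\<integral>\<^sup>+\<omega>. ennreal ((ln w \<omega>)^2) \<partial>?P0n) \<le> ennreal K" if w: "w \<in> W" for w
    proof -
      interpret PP: product_sigma_finite "\<lambda>_::nat. base" by standard
      have "(\<integral>\<^sup>+\<omega>. ennreal ((ln w \<omega>)^2) \<partial>?P0n) = (\<integral>\<^sup>+\<omega>. (\<Prod>k<n. ennreal ((lr w (\<omega> k))^2)) \<partial>?P0n)"
        by (simp add: ln_def prod_ennreal prod_power_distrib)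
      also have "\<dots> = (\<Prod>k<n. \<integral>\<^sup>+x. ennreal ((lr w x)^2) \<partial>base)"
        using l_meas0[OF w] by (intro PP.product_nn_integral_prod) auto
      finally show ?thesis using second[OF w] by simp
    qed
    show "real (card {w \<in> W. \<omega> \<in> A w}) \<le> V" if "\<omega> \<in> space ?P0n" for \<omega>
    proof -
      have "{w \<in> W. \<omega> \<in> A w} = {w \<in> W. lq_norm d q (\<lambda>i. T \<omega> i - \<theta> w i) < r}"
        using that by (auto simp: A_def N_def)
      then show ?thesis using overlap by simp
    qed
  qed (rule A)
  then obtain w where w: "w \<in> W"
    and le: "emeasure (density ?P0n (\<lambda>\<omega>. ennreal (ln w \<omega>))) (A w) \<le> ennreal (K / (2 * lam) + lam * V / (2 * real (card W)))"
    by blast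
  have small: "emeasure (PiM {..<n} (\<lambda>_. P w)) (A w) \<le> ennreal \<epsilon>"
    unfolding dens[OF w] by (rule order_trans[OF le ennreal_leI[OF \<epsilon>]])
  interpret Pn: prob_space "PiM {..<n} (\<lambda>_. P w)" by (intro prob_space_PiM P(2)[OF w])
  have sP: "sets (PiM {..<n} (\<lambda>_. P w)) = sets ?P0n" using dens[OF w] by simp
  have spP: "space (PiM {..<n} (\<lambda>_. P w)) = space ?P0n" using sP by (rule sets_eq_imp_space_eq)
  let ?G = "{\<omega> \<in> space (PiM {..<n} (\<lambda>_. P w)). lq_norm d q (\<lambda>i. T \<omega> i - \<theta> w i) \<ge> r}"
  have G: "?G = space (PiM {..<n} (\<lambda>_. P w)) - A w" unfolding A_def N_def spP by auto
  have "ennreal (1 - \<epsilon>) \<le> emeasure (PiM {..<n} (\<lambda>_. P w)) ?G"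
  proof -
    have Am: "A w \<in> sets (PiM {..<n} (\<lambda>_. P w))" using A sP by simp
    have "Pn.prob (A w) \<le> \<epsilon> \<or> \<epsilon> < 0"
      using small unfolding Pn.emeasure_eq_measure by (simp add: ennreal_le_iff2) linarith
    moreover have "\<not> \<epsilon> < 0"
    proof -
      have "0 \<le> V" using overlap[of undefined] of_nat_0_le_iff order_trans by blast
      then have "0 \<le> K / (2 * lam) + lam * V / (2 * real (card W))" using K lam by simp
      then show ?thesis using \<epsilon> by linarith
    qed
    moreover have "Pn.prob ?G = 1 - Pn.prob (A w)" unfolding G by (rule Pn.prob_compl[OF Am])
    ultimately have "1 - \<epsilon> \<le> Pn.prob ?G" by auto
    then show ?thesis unfolding Pn.emeasure_eq_measure by (rule ennreal_leI)
  qed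
  also have "\<dots> \<le> (SUP (t, P)\<in>TP. emeasure (PiM {..<n} (\<lambda>_. P)) {\<omega> \<in> space (PiM {..<n} (\<lambda>_. P)). lq_norm d q (\<lambda>i. T \<omega> i - t i) \<ge> r})"
    using TP[OF w] by (intro SUP_upper2[of "(\<theta> w, P w)"]) auto
  finally show "ennreal (1 - \<epsilon>) \<le> (SUP (t, P)\<in>TP. emeasure (PiM {..<n} (\<lambda>_. P)) {\<omega> \<in> space (PiM {..<n} (\<lambda>_. P)). lq_norm d q (\<lambda>i. T \<omega> i - t i) \<ge> r})" .
qed

section \<open>The lower bound\<close>

lemma lq_norm_triangle:
  assumes "q \<in> {1, 2}"
  shows "lq_norm d q (\<lambda>i. u i - v i) \<le> lq_norm d q (\<lambda>i. x i - u i) + lq_norm d q (\<lambda>i. x i - v i)"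
proof (cases "q = 1")
  case True
  have "(\<Sum>i<d. \<bar>u i - v i\<bar>) \<le> (\<Sum>i<d. \<bar>x i - u i\<bar> + \<bar>x i - v i\<bar>)" by (intro sum_mono) linarith
  then show ?thesis unfolding True lq_norm_1 by (simp only: sum.distrib)
next
  case False
  then have q: "q = 2" using assms by simp
  have "L2_set (\<lambda>i. u i - v i) {..<d} = L2_set (\<lambda>i. - (x i - u i) + (x i - v i)) {..<d}" by simp
  also have "\<dots> \<le> L2_set (\<lambda>i. - (x i - u i)) {..<d} + L2_set (\<lambda>i. x i - v i) {..<d}"
    by (rule L2_set_triangle_ineq)
  also have "L2_set (\<lambda>i. - (x i - u i)) {..<d} = L2_set (\<lambda>i. x i - u i) {..<d}"
    unfolding L2_set_def by (simp add: power2_commute)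
  finally show ?thesis by (simp add: q lq_norm_2)
qed

lemma word_vec_norm_le:
  assumes a: "0 \<le> a"
  shows "(\<Sum>i<d. \<bar>word_vec d m a s w i\<bar>) \<le> real s * a"
    and "lq_norm d 2 (word_vec d m a s w) \<le> sqrt (real s) * a"
proof -
  show "(\<Sum>i<d. \<bar>word_vec d m a s w i\<bar>) \<le> real s * a"
    using word_vec_sum_le[of a abs a d m s w] a by simp
  have "(\<Sum>i<d. (word_vec d m a s w i)^2) \<le> real s * a^2"
    using word_vec_sum_le[of "a^2" "\<lambda>x. x^2" a d m s w] by simp
  then have "sqrt (\<Sum>i<d. (word_vec d m a s w i)^2) \<le> sqrt (real s * a^2)" by simp
  then show "lq_norm d 2 (word_vec d m a s w) \<le> sqrt (real s) * a"
    using a by (simp add: lq_norm_2 L2_set_def real_sqrt_mult)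
qed

lemma strict_floor_bounds:
  assumes "\<beta> > 0"
  shows "0 < \<beta> - real (strict_floor \<beta>)" "\<beta> - real (strict_floor \<beta>) \<le> 1"
  using assms unfolding strict_floor_def by linarith+

text \<open>All words close to \<open>\<tau>\<close> lie within \<open>2 * r\<close> of one of them,
  \<open>w0\<close>, and separation converts this into few differing letters. The factor 1/16 is
  fitted to the radius \<open>s / 8\<close> of \<open>hamming_ball_card_le\<close>: for
  \<open>q = 1\<close> it gives \<open>2 * r = s * a / 8\<close>, and for \<open>q = 2\<close> it
  gives \<open>(2 * r)^2 = s * a^2 / 64\<close>, more than enough.\<close>

lemma word_vec_close_card_le:
  assumes sm: "s * m \<le> d" and s: "1 \<le> s" and m: "1 \<le> m" and q: "q \<in> {1, 2}" and a0: "0 < a0" and R: "0 < R"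
  defines "a \<equiv> a0 / sqrt (real s) * R"
  shows "real (card {w \<in> {..<s} \<rightarrow>\<^sub>E {..<Suc m}. lq_norm d q (\<lambda>i. \<tau> i - word_vec d m a s w i)
      < a0 / 16 * real s powr (1 / real q - 1 / 2) * R}) \<le> real (Suc m) powr (7/8 * real s)"
    (is "real (card ?N) \<le> _")
proof (cases "?N = {}")
  case True
  show ?thesis unfolding True by simp
next
  case False
  define r where "r = a0 / 16 * real s powr (1 / real q - 1 / 2) * R"
  obtain w0 where w0: "w0 \<in> {..<s} \<rightarrow>\<^sub>E {..<Suc m}" "lq_norm d q (\<lambda>i. \<tau> i - word_vec d m a s w0 i) < r"
    using False by (auto simp: r_def)
  have sp: "0 < real s" using s by simp
  have a: "0 < a" using a0 R sp by (simp add: a_def)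
  have close: "real (card {b \<in> {..<s}. w b \<noteq> w0 b}) \<le> real s / 8" if w: "w \<in> ?N" for w
  proof -
    define k where "k = real (card {b \<in> {..<s}. w b \<noteq> w0 b})"
    have "lq_norm d q (\<lambda>i. \<tau> i - word_vec d m a s w i) < r" using w by (simp add: r_def)
    then have lt: "lq_norm d q (\<lambda>i. word_vec d m a s w i - word_vec d m a s w0 i) < 2 * r"
      using lq_norm_triangle[OF q, of d "word_vec d m a s w" "word_vec d m a s w0" \<tau>] w0(2) by linarith
    have sep: "k * a ^ p \<le> (\<Sum>i<d. \<bar>word_vec d m a s w i - word_vec d m a s w0 i\<bar> ^ p)" if "p > 0" for p
      using word_vec_separation[OF sm _ w0(1) that, of w a] w a by (simp add: k_def)
    show ?thesis
    proof (cases "q = 1")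
      case True
      have "k * a < 2 * r" using sep[of 1] lt by (simp add: True lq_norm_1 del: One_nat_def)
      also have "r = a0 / 16 * sqrt (real s) * R" using sp by (simp add: r_def True powr_half_sqrt)
      also have "2 * \<dots> = real s / 8 * a" using sp by (simp add: a_def real_div_sqrt field_simps)
      finally show ?thesis using a by (simp add: k_def)
    next
      case False
      then have q2: "q = 2" using q by simp
      have r: "r = a0 / 16 * R" using sp by (simp add: r_def q2)
      have "k * a ^ 2 \<le> (lq_norm d 2 (\<lambda>i. word_vec d m a s w i - word_vec d m a s w0 i))^2"
        using sep[of 2] by (simp add: lq_norm_2_sq)
      also have "\<dots> \<le> (2 * r)^2"
        using lt q2 lq_norm_2_nonneg by (intro power_mono) auto
      also have "\<dots> = real s / 64 * a^2"
        using sp by (simp add: a_def r power_mult_distrib power_divide)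
      finally have "k \<le> real s / 64" using a by simp
      then show ?thesis by (simp add: k_def)
    qed
  qed
  have "?N \<subseteq> {w \<in> {..<s} \<rightarrow>\<^sub>E {..<Suc m}. real (card {b \<in> {..<s}. w b \<noteq> w0 b}) \<le> real s / 8}"
    using close by auto
  then have "card ?N \<le> card {w \<in> {..<s} \<rightarrow>\<^sub>E {..<Suc m}. real (card {b \<in> {..<s}. w b \<noteq> w0 b}) \<le> real s / 8}"
    by (rule card_mono[rotated]) (rule finite_subset[of _ "{..<s} \<rightarrow>\<^sub>E {..<Suc m}"], auto intro: finite_PiE)
  also have "real \<dots> \<le> real (Suc m) powr (7/8 * real s)"
    using m by (intro hamming_ball_card_le w0) auto
  finally show ?thesis by simp
qed

text \<open>The sample size condition says that \<open>\<surd>s h\<^sup>\<beta> \<le> h\<close>: the margins \<open>\<theta> \<bullet> z\<close> stay within the bandwidth.\<close>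

lemma bandwidth_bounds:
  fixes \<beta> n s g :: real
  assumes \<beta>: "\<beta> > 1" and s: "s \<ge> 1" and lam: "g > 0" and n: "n > 0"
    and le: "2 powr (2 * \<beta> + 1) * g * s powr ((4 * \<beta> - 1) / (2 * \<beta> - 2)) \<le> n"
  defines "h \<equiv> (s * g / n) powr (1 / (2 * \<beta> + 1))"
  shows "0 < h" "h \<le> 1/2" "sqrt s * h powr \<beta> \<le> h" "h * (h powr \<beta>)^2 = s * g / n"
    "(s * g / n) powr (\<beta> / (2 * \<beta> + 1)) = h powr \<beta>"
proof -
  let ?\<gamma> = "(4 * \<beta> - 1) / (2 * \<beta> - 2)"
  let ?e = "2 * \<beta> + 1"
  have g: "?e > 0" using \<beta> by simp
  have \<tau>0: "0 < s * g / n" using s lam n by simp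
  show h0: "0 < h" unfolding h_def powr_gt_zero by (rule less_imp_neq[OF \<tau>0, symmetric])
  have "s * g / n \<le> s * g / (2 powr ?e * g * s powr ?\<gamma>)"
    using le s lam n by (intro divide_left_mono mult_pos_pos) auto
  also have "\<dots> = s powr 1 / (2 powr ?e * s powr ?\<gamma>)" using lam s by simp
  also have "\<dots> = s powr (1 - ?\<gamma>) * (1/2) powr ?e"
    using s by (simp add: powr_diff powr_divide)
  \<comment> \<open>This identity explains the sample size exponent: after the root of order
    \<open>2 * \<beta> + 1\<close> it leaves \<open>h\<close> at most half of
    \<open>s powr (- 1 / (2 * \<beta> - 2))\<close>, and the power \<open>\<beta> - 1\<close> of the
    latter is \<open>1 / sqrt s\<close>. The factor \<open>2 powr (2 * \<beta> + 1)\<close> becomes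
    the 1/2.\<close>
  also have "1 - ?\<gamma> = - (1 / (2 * \<beta> - 2)) * ?e" using \<beta> by (simp add: field_simps)
  finally have \<tau>: "s * g / n \<le> s powr (- (1 / (2 * \<beta> - 2)) * ?e) * (1/2) powr ?e" .
  have "h \<le> (s powr (- (1 / (2 * \<beta> - 2)) * ?e) * (1/2) powr ?e) powr (1 / ?e)"
    unfolding h_def using \<tau> \<tau>0 g by (intro powr_mono2) auto
  also have "\<dots> = s powr (- (1 / (2 * \<beta> - 2))) * (1/2)"
    using g by (simp add: powr_mult powr_powr)
  finally have h_le: "h \<le> s powr (- (1 / (2 * \<beta> - 2))) * (1/2)" .
  have "s powr (- (1 / (2 * \<beta> - 2))) \<le> s powr 0" using s \<beta> by (intro powr_mono) auto
  then have "s powr (- (1 / (2 * \<beta> - 2))) \<le> 1" using s by simp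
  then show "h \<le> 1/2" using h_le by linarith
  have "h \<le> s powr (- (1 / (2 * \<beta> - 2)))" using h_le powr_ge_zero[of s "- (1 / (2 * \<beta> - 2))"] by linarith
  then have "h powr (\<beta> - 1) \<le> (s powr (- (1 / (2 * \<beta> - 2)))) powr (\<beta> - 1)"
    using h0 \<beta> by (intro powr_mono2) auto
  also have "\<dots> = s powr (- 1/2)"
  proof -
    have "- (1 / (2 * \<beta> - 2)) * (\<beta> - 1) = - 1/2" using \<beta> by (simp add: field_simps)
    then show ?thesis by (simp only: powr_powr)
  qed
  finally have "sqrt s * h powr (\<beta> - 1) \<le> s powr (1/2) * s powr (- 1/2)"
    using s by (intro mult_mono) (auto simp: powr_half_sqrt)
  also have "\<dots> = 1" using s by (simp flip: powr_add)
  finally have "sqrt s * h powr (\<beta> - 1) * h \<le> 1 * h" using h0 by (intro mult_right_mono) auto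
  moreover have "h powr \<beta> = h powr (\<beta> - 1) * h" using h0 powr_add[of h "\<beta> - 1" 1] by simp
  ultimately show "sqrt s * h powr \<beta> \<le> h" by (simp add: mult.assoc)
  have "h * (h powr \<beta>)^2 = h powr 1 * (h powr \<beta> * h powr \<beta>)" using h0 by (simp add: power2_eq_square)
  also have "\<dots> = h powr (1 + (\<beta> + \<beta>))" by (simp only: powr_add)
  also have "1 + (\<beta> + \<beta>) = ?e" by simp
  also have "h powr ?e = s * g / n"
  proof -
    have "1 / ?e * ?e = 1" using g by simp
    then show ?thesis unfolding h_def powr_powr by (simp only: powr_one[OF less_imp_le[OF \<tau>0]])
  qed
  finally show "h * (h powr \<beta>)^2 = s * g / n" .
  show "(s * g / n) powr (\<beta> / ?e) = h powr \<beta>" by (simp add: h_def powr_powr)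
qed

theorem theorem3p14:
  fixes \<beta> L \<rho> C' :: real
  assumes "\<beta> > 1" and "L > 0" and "\<rho> > 0" and "C' > 0"
  shows "\<exists>C>0. \<exists>c>0. \<exists>c'>0. \<forall>n d s q :: nat.
    n \<ge> 1 \<longrightarrow> d \<ge> 2 \<longrightarrow> 1 \<le> s \<longrightarrow> s \<le> d \<longrightarrow> q \<in> {1, 2} \<longrightarrow>
    real n \<ge> C * ln (real d / real s) * real s powr ((4 * \<beta> - 1) / (2 * \<beta> - 2)) \<longrightarrow>
    minimax_prob n d q (Theta d s \<beta> L \<rho> C')
      (c * real s powr (1 / real q - 1 / 2) *
        (real s * ln (real d / real s) / real n) powr (\<beta> / (2 * \<beta> + 1))) > ennreal c'"
proof -
  define l where "l = strict_floor \<beta>"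
  have \<beta>0: "\<beta> > 0" using assms(1) by simp
  obtain K where K: "K > 0" and holder: "\<And>h t y \<Delta>. 0 < h \<Longrightarrow> h \<le> 1 \<Longrightarrow> y \<in> {-1, 1} \<Longrightarrow>
    \<bar>(cond_dens_deriv l h y t (\<Delta> + t) - cond_dens_deriv l h y t t)
      - (cond_dens_deriv l h y 0 \<Delta> - cond_dens_deriv l h y 0 0)\<bar>
    \<le> K * \<bar>t\<bar> * h powr (- (\<beta> - real l + real l)) * \<bar>\<Delta>\<bar> powr (\<beta> - real l)"
    using cond_dens_deriv_holder[OF strict_floor_bounds[OF \<beta>0], of l] unfolding l_def by blast
  \<comment> \<open>Solves \<open>c\<^sub>0 / 2 * (B^2 / 3) = \<rho>\<close>, the eigenvalue bound
    of the Hessian.\<close>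
  define B where "B = sqrt (6 * \<rho> / c\<^sub>0)"
  have B: "0 < B" using assms(3) gauss_const_pos by (simp add: B_def)
  have \<rho>: "c\<^sub>0 / 2 * (B^2 / 3) = \<rho>" using assms(3) gauss_const_pos by (simp add: B_def)
  define \<kappa> where "\<kappa> = 11 * (\<integral>x. \<bar>bump x\<bar> \<partial>lborel)"
  have \<kappa>: "0 \<le> \<kappa>" unfolding \<kappa>_def by (intro mult_nonneg_nonneg integral_nonneg_AE) auto
  \<comment> \<open>In this order, the entries give \<open>a0^2 <= a0\<close>, margins at most
    \<open>h / 10\<close>, the smoothness constant \<open>L\<close>, and a chi-square distance over
    all \<open>n\<close> observations of at most one sixteenth of
    \<open>s * ln (d / s)\<close>.\<close>
  define a0 where "a0 = Min {1, 1 / (10 * B), L / (K * (B^2 / 3)), 1 / (16 * (\<kappa> * (B^2 / 3) + 1))}"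
  have pos: "0 < \<kappa> * (B^2 / 3) + 1" using \<kappa> by (intro add_nonneg_pos mult_nonneg_nonneg) auto
  have a0: "0 < a0" using B K assms(2) pos by (auto simp: a0_def)
  have a0_le: "a0 \<le> 1" "a0 \<le> 1 / (10 * B)" "a0 \<le> L / (K * (B^2 / 3))" "a0 \<le> 1 / (16 * (\<kappa> * (B^2 / 3) + 1))"
    unfolding a0_def by (intro Min_le; simp)+
  have a0_B: "B * a0 \<le> 1/10" using a0_le(2) B by (simp add: field_simps)
  have a0_L: "K * (B^2 / 3) * a0 \<le> L" using a0_le(3) B K by (simp add: field_simps)
  have a0_\<kappa>: "\<kappa> * (B^2 / 3) * a0^2 \<le> 1/16"
  proof -
    have "a0^2 \<le> a0" using a0 a0_le(1) by (simp add: power2_eq_square mult_left_le)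
    then have "\<kappa> * (B^2 / 3) * a0^2 \<le> (\<kappa> * (B^2 / 3) + 1) * a0" using \<kappa> a0 by (intro mult_mono) auto
    also have "\<dots> \<le> 1/16" using a0_le(4) pos by (simp add: field_simps)
    finally show ?thesis .
  qed
  \<comment> \<open>The largest value of \<open>Q powr (- s / 32)\<close>, attained at alphabet size
    \<open>Q = 2\<close> and \<open>s = 1\<close>.\<close>
  define \<epsilon> :: real where "\<epsilon> = 2 powr (- 1/32)"
  have \<epsilon>: "1/2 \<le> \<epsilon>" "\<epsilon> < 1"
  proof -
    have "(2::real) powr (- 1) \<le> 2 powr (- 1/32)" by (intro powr_mono) auto
    then show "1/2 \<le> \<epsilon>" by (simp add: \<epsilon>_def powr_minus_divide)
    have "(2::real) powr (- 1/32) < 2 powr 0" by (intro powr_less_mono) auto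
    then show "\<epsilon> < 1" by (simp add: \<epsilon>_def)
  qed
  have member: "(\<theta>, obs_law d h B \<theta>) \<in> Theta d s \<beta> L \<rho> C'"
    if model: "threshold_model d h B \<theta>" and "0 < d" "\<theta> \<in> vecs d" "l0_norm d \<theta> \<le> s"
      and norm: "lq_norm d 2 \<theta> \<le> a0 * h powr \<beta>" for d s h \<theta>
  proof -
    interpret threshold_model d h B \<theta> by (rule model)
    have "K * h powr (- \<beta>) * (B^2 / 3) * lq_norm d 2 \<theta> \<le> K * h powr (- \<beta>) * (B^2 / 3) * (a0 * h powr \<beta>)"
      using K norm by (intro mult_left_mono) auto
    also have "\<dots> = K * (B^2 / 3) * a0 * (h powr (- \<beta>) * h powr \<beta>)" by (simp only: mult_ac)
    also have "h powr (- \<beta>) * h powr \<beta> = 1" using h by (simp flip: powr_add)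
    finally have L: "K * h powr (- \<beta>) * (B^2 / 3) * lq_norm d 2 \<theta> \<le> L" using a0_L by simp
    have "obs_law d h B \<theta> \<in> smooth_class d \<beta> L (C' * real s)"
    proof (rule obs_law_in_smooth_class[OF \<open>\<theta> \<in> vecs d\<close> _ _ L])
      fix y t \<Delta> :: real assume y: "y \<in> {-1, 1}"
      show "\<bar>(cond_dens_deriv (strict_floor \<beta>) h y t (\<Delta> + t) - cond_dens_deriv (strict_floor \<beta>) h y t t)
        - (cond_dens_deriv (strict_floor \<beta>) h y 0 \<Delta> - cond_dens_deriv (strict_floor \<beta>) h y 0 0)\<bar>
        \<le> K * h powr (- \<beta>) * \<bar>t\<bar> * \<bar>\<Delta>\<bar> powr (\<beta> - real (strict_floor \<beta>))"
        using holder[OF h(1) _ y, of t \<Delta>] h(2) by (simp add: l_def mult_ac)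
    qed (use K in simp)
    then show ?thesis using that \<rho> by (intro obs_law_in_Theta) auto
  qed
  have main: "minimax_prob n d q (Theta d s \<beta> L \<rho> C')
      (a0 / 16 * real s powr (1 / real q - 1 / 2) *
        (real s * ln (real d / real s) / real n) powr (\<beta> / (2 * \<beta> + 1))) \<ge> ennreal (1 - \<epsilon>)"
    if n: "n \<ge> 1" and d: "d \<ge> 2" and s: "1 \<le> s" "s \<le> d" and q: "q \<in> {1, 2}"
      and size: "2 powr (2 * \<beta> + 1) * ln (real d / real s) * real s powr ((4 * \<beta> - 1) / (2 * \<beta> - 2)) \<le> real n"
    for n d s q :: nat
  proof (cases "s = d")
    \<comment> \<open>Now \<open>ln (d / s) = 0\<close>, and as \<open>0 powr x = 0\<close> the
      radius is 0, so the event is certain. It still takes a member of \<open>Theta\<close> to keep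
      the supremum from being taken over the empty set; \<open>\<theta> = 0\<close> with bandwidth
      1/2 is one.\<close>
    case True
    define \<theta> where "\<theta> = (\<lambda>i\<in>{..<d}. 0 :: real)"
    have model: "threshold_model d (1/2) B \<theta>" unfolding \<theta>_def using B by (intro threshold_model_zero) auto
    interpret threshold_model d "1/2" B \<theta> by (rule model)
    have "lq_norm d 2 \<theta> = 0" by (simp add: \<theta>_def lq_norm_def)
    then have mem: "(\<theta>, obs_law d (1/2) B \<theta>) \<in> Theta d s \<beta> L \<rho> C'"
      using d a0 by (intro member model) (auto simp: \<theta>_def vecs_def l0_norm_def)
    have "ennreal (1 - \<epsilon>) \<le> minimax_prob n d q (Theta d s \<beta> L \<rho> C') 0"
    proof (rule minimax_prob_ge[where W="{()}" and lr="\<lambda>_ _. 1" and P="\<lambda>_. obs_law d (1/2) B \<theta>"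
          and \<theta>="\<lambda>_. \<theta>" and lam=1 and K=1 and V=0, OF prob_space_obs_law sets_obs_law])
      show "(\<integral>\<^sup>+\<omega>. ennreal (1\<^sup>2) \<partial>obs_law d (1/2) B \<theta>) ^ n \<le> ennreal 1"
        using prob_space.emeasure_space_1[OF prob_space_obs_law] by simp
      have "0 \<le> lq_norm d q v" for v using q by (auto simp: lq_norm_def intro!: real_root_ge_zero sum_nonneg)
      then show "real (card {w \<in> {()}. lq_norm d q (\<lambda>i. \<tau> i - \<theta> i) < 0}) \<le> 0" for \<tau>
        by (simp add: not_less)
    qed (use mem prob_space_obs_law \<epsilon> in \<open>auto simp: density_1\<close>)
    then show ?thesis using True s by simp
  next
    case False
    then have sd: "s < d" using s by simp
    define lam0 where "lam0 = ln (real d / real s)"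
    have lam0: "0 < lam0" using sd s by (simp add: lam0_def)
    define h where "h = (real s * lam0 / real n) powr (1 / (2 * \<beta> + 1))"
    note bw = bandwidth_bounds[of \<beta> "real s" lam0 "real n", folded h_def]
    have h: "0 < h" "h \<le> 1/2" "sqrt (real s) * h powr \<beta> \<le> h" "h * (h powr \<beta>)^2 = real s * lam0 / real n"
      "(real s * lam0 / real n) powr (\<beta> / (2 * \<beta> + 1)) = h powr \<beta>"
      using bw assms(1) s n lam0 size by (auto simp: lam0_def)
    \<comment> \<open>The block length. Rounding down is harmless because the empty letter gives
      \<open>m + 1 > d / s\<close> letters, so the entropy per block is still at least
      \<open>ln (d / s)\<close>.\<close>
    define m where "m = d div s"
    have m: "1 \<le> m" "s * m \<le> d" using s sd by (auto simp: m_def div_greater_zero_iff Suc_le_eq)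
    have "d < s * Suc m" using s by (simp add: m_def dividend_less_times_div)
    then have "real d < real (Suc m) * real s"
      by (simp only: of_nat_mult[symmetric] of_nat_less_iff mult.commute)
    then have ds: "real d / real s < real (Suc m)"
      using s by (simp only: pos_divide_less_eq of_nat_0_less_iff Suc_le_eq[symmetric] One_nat_def)
    define Q where "Q = real (Suc m)"
    have Q: "2 \<le> Q" using m by (simp add: Q_def)
    have lam0_le: "lam0 \<le> ln Q" unfolding lam0_def using ds s sd by (intro ln_mono) (auto simp: Q_def)
    \<comment> \<open>The common height of the nonzero entries; with at most \<open>s\<close> of
      them the 2-norm stays below \<open>a0 * h powr \<beta>\<close>, as \<open>member\<close>
      requires.\<close>
    define a where "a = a0 / sqrt (real s) * h powr \<beta>"
    have sp: "0 < real s" using s by simp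
    have a: "0 < a" using a0 h sp by (simp add: a_def)
    define W where "W = {..<s} \<rightarrow>\<^sub>E {..<Suc m}"
    define \<theta> where "\<theta> w = word_vec d m a s w" for w
    have norm: "lq_norm d 2 (\<theta> w) \<le> a0 * h powr \<beta>" for w
      using word_vec_norm_le(2)[of a d m s w] a sp by (simp add: \<theta>_def a_def)
    have model: "threshold_model d h B (\<theta> w)" for w
    proof
      have "B * (\<Sum>i<d. \<bar>\<theta> w i\<bar>) \<le> B * (real s * a)"
        unfolding \<theta>_def using word_vec_norm_le(1)[of a d m s w] a B by (intro mult_left_mono) auto
      also have "\<dots> = (B * a0) * (sqrt (real s) * h powr \<beta>)"
      proof -
        have "real s * a = a0 * (real s / sqrt (real s) * h powr \<beta>)" by (simp add: a_def)
        also have "real s / sqrt (real s) = sqrt (real s)" by (rule real_div_sqrt) simp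
        finally show ?thesis by (simp only: mult.assoc)
      qed
      also have "\<dots> \<le> 1/10 * h" using a0_B h a0 B by (intro mult_mono) auto
      finally show "B * (\<Sum>i<d. \<bar>\<theta> w i\<bar>) \<le> h / 10" by simp
    qed (use h B in auto)
    \<comment> \<open>The budget for the second moment over \<open>n\<close> observations, by
      \<open>(1 + x)^n <= exp (n * x)\<close>. Its exponent 1/16 must stay below 1/8, the gap
      between the exponents 1 of \<open>card W\<close> and 7/8 of the overlap.\<close>
    define K1 where "K1 = Q powr (real s / 16)"
    define P0 where "P0 = obs_law d h B (\<lambda>i\<in>{..<d}. 0)"
    have base: "threshold_model d h B (\<lambda>i\<in>{..<d}. 0)" by (intro threshold_model_zero h B)
    have second: "(\<integral>\<^sup>+\<omega>. ennreal ((likelihood_ratio d h (\<theta> w) \<omega>)^2) \<partial>P0) ^ n \<le> ennreal K1" for w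
    proof -
      define x where "x = \<kappa> * h * (B^2 / 3) * (lq_norm d 2 (\<theta> w))^2"
      have x0: "0 \<le> x" using \<kappa> h by (simp add: x_def)
      have "x \<le> \<kappa> * h * (B^2 / 3) * (a0 * h powr \<beta>)^2"
        unfolding x_def using \<kappa> h norm[of w] lq_norm_2_nonneg by (intro mult_left_mono power_mono) auto
      also have "\<dots> = (\<kappa> * (B^2 / 3) * a0^2) * (h * (h powr \<beta>)^2)" by (simp only: power_mult_distrib mult_ac)
      also have "\<dots> \<le> 1/16 * (h * (h powr \<beta>)^2)" using a0_\<kappa> h(1) by (intro mult_right_mono) auto
      finally have "real n * x \<le> real n * (1/16 * (real s * lam0 / real n))"
        unfolding h(4) by (intro mult_left_mono) auto
      also have "\<dots> = real s / 16 * lam0" using n by simp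
      also have "\<dots> \<le> real s / 16 * ln Q" using lam0_le by (intro mult_left_mono) auto
      finally have nx: "real n * x \<le> real s / 16 * ln Q" .
      have "(\<integral>\<^sup>+\<omega>. ennreal ((likelihood_ratio d h (\<theta> w) \<omega>)^2) \<partial>P0) ^ n \<le> (ennreal (1 + x)) ^ n"
        unfolding P0_def x_def \<kappa>_def
        by (intro power_mono threshold_model.likelihood_ratio_second_moment[OF model]) auto
      also have "\<dots> = ennreal ((1 + x) ^ n)" using x0 by (intro ennreal_power) simp
      also have "\<dots> \<le> ennreal K1"
      proof (rule ennreal_leI)
        have "(1 + x) ^ n \<le> exp x ^ n" using x0 by (intro power_mono exp_ge_add_one_self) auto
        also have "\<dots> = exp (real n * x)" by (simp add: exp_of_nat_mult)
        also have "\<dots> \<le> exp (real s / 16 * ln Q)" using nx by simp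
        also have "\<dots> = K1" using Q by (simp add: K1_def powr_def)
        finally show "(1 + x) ^ n \<le> K1" .
      qed
      finally show ?thesis .
    qed
    have "ennreal (1 - \<epsilon>) \<le> minimax_prob n d q (Theta d s \<beta> L \<rho> C')
      (a0 / 16 * real s powr (1 / real q - 1 / 2) * h powr \<beta>)"
    proof (rule minimax_prob_ge[where W=W and lr="\<lambda>w. likelihood_ratio d h (\<theta> w)" and P="\<lambda>w. obs_law d h B (\<theta> w)"
          and \<theta>=\<theta> and base=P0 and lam="Q powr (3/32 * real s)" and K=K1 and V="Q powr (7/8 * real s)"])
      show "prob_space P0" "sets P0 = sets (obs_base d)"
        unfolding P0_def
        by (rule threshold_model.prob_space_obs_law[OF base], rule threshold_model.sets_obs_law[OF base])
      show "finite W" by (auto simp: W_def intro: finite_PiE)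
      show "W \<noteq> {}" by (auto simp: W_def PiE_eq_empty_iff)
      show "0 < Q powr (3/32 * real s)" "0 \<le> K1" using Q by (auto simp: K1_def)
      show "0 \<le> likelihood_ratio d h (\<theta> w) \<omega>" for w \<omega>
        by (rule threshold_model.likelihood_ratio_nonneg[OF model])
      show "obs_law d h B (\<theta> w) = density P0 (\<lambda>\<omega>. ennreal (likelihood_ratio d h (\<theta> w) \<omega>))" for w
        unfolding P0_def by (rule threshold_model.obs_law_density[OF model])
      show "prob_space (obs_law d h B (\<theta> w))" for w
        by (rule threshold_model.prob_space_obs_law[OF model])
      show "(\<integral>\<^sup>+\<omega>. ennreal ((likelihood_ratio d h (\<theta> w) \<omega>)^2) \<partial>P0) ^ n \<le> ennreal K1" for w
        by (rule second)
      show "(\<theta> w, obs_law d h B (\<theta> w)) \<in> Theta d s \<beta> L \<rho> C'" for w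
        using d by (intro member model norm) (auto simp: \<theta>_def word_vec_mem l0_norm_word_vec)
      show "real (card {w \<in> W. lq_norm d q (\<lambda>i. \<tau> i - \<theta> w i) < a0 / 16 * real s powr (1 / real q - 1 / 2) * h powr \<beta>})
        \<le> Q powr (7/8 * real s)" for \<tau>
        unfolding W_def \<theta>_def a_def Q_def using h by (intro word_vec_close_card_le m s q a0) auto
      have "real (card W) = Q ^ s" by (simp add: W_def card_PiE Q_def)
      then have cW: "real (card W) = Q powr real s" using Q by (simp add: powr_realpow)
      \<comment> \<open>The choice 3/32 lies halfway between 1/16 and 1/8 and balances the two error
        terms: \<open>1/16 - 3/32 = 3/32 + 7/8 - 1 = - 1/32\<close>.\<close>
      have "K1 / (2 * Q powr (3/32 * real s)) = Q powr (- real s / 32) / 2"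
        using Q by (simp add: K1_def powr_diff[symmetric] field_simps flip: powr_add)
      moreover have "Q powr (3/32 * real s) * Q powr (7/8 * real s) / (2 * real (card W)) = Q powr (- real s / 32) / 2"
      proof -
        have "Q powr (3/32 * real s) * Q powr (7/8 * real s) = Q powr (- real s / 32) * Q powr real s"
          by (simp flip: powr_add)
        then show ?thesis using Q by (simp add: cW)
      qed
      moreover have "Q powr (- real s / 32) \<le> \<epsilon>"
      proof -
        have "Q powr (- real s / 32) \<le> Q powr (- 1 / 32)" using Q s by (intro powr_mono) auto
        also have "\<dots> \<le> 2 powr (- 1 / 32)" using Q by (intro powr_mono2') auto
        finally show ?thesis by (simp add: \<epsilon>_def)
      qed
      ultimately show "K1 / (2 * Q powr (3/32 * real s)) + Q powr (3/32 * real s) * Q powr (7/8 * real s) / (2 * real (card W)) \<le> \<epsilon>"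
        by simp
    qed measurable
    then show ?thesis using h(5) by (simp add: lam0_def)
  qed
  \<comment> \<open>Halving the constant turns the bound into the strict inequality of the
    claim.\<close>
  have less: "ennreal ((1 - \<epsilon>) / 2) < ennreal (1 - \<epsilon>)" using \<epsilon> by (intro ennreal_lessI) auto
  have pos: "(0::real) < 2 powr (2 * \<beta> + 1)" "0 < a0 / 16" "0 < (1 - \<epsilon>) / 2" using a0 \<epsilon> by auto
  show ?thesis
    by (rule exI[of _ "2 powr (2 * \<beta> + 1)"], rule conjI[OF pos(1)], rule exI[of _ "a0 / 16"], rule conjI[OF pos(2)],
        rule exI[of _ "(1 - \<epsilon>) / 2"], rule conjI[OF pos(3)], intro allI impI, rule less_le_trans[OF less main])
qed

end
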